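(* Let $E=\{n_1<n_2<\ldots\}\subset\mathbb{N}$ be a set that belongs to one of the classes $\mathcal{D}^{(\infty)}$, $\mathcal{E}_{\mathrm{c.pt.}}$ or $\mathcal{E}_{\mathrm{pol}}$. Suppose $h\colon(0,\infty)\to\mathbb{R}$ belongs to a Hardy field, has polynomial growth and satisfies $|h(t)-r(t)|\succ\log^2(t)$ for all polynomials $r\in\mathbb{Q}[t]$. If the natural density $d(E)$ exists and is positive, then the sequence $\big(h(n_j)\big)_{j\in\mathbb{N}}$ is uniformly distributed mod $1$.
   Context: $\mathbb{N}=\{1,2,\ldots\}$; $\log^2(t)=(\log t)^2$. The natural density is $d(E):=\lim_{N\to\infty}\frac{|E\cap\{1,\ldots,N\}|}{N}$ when the limit exists. A real sequence $(x_j)$ is uniformly distributed mod $1$ if for all $0\le a<b\le 1$ the proportion of $j\le N$ whose fractional part $\{x_j\}$ lies in $[a,b)$ tends to $b-a$ as $N\to\infty$. Hardy fields: let $G$ be the ring (under pointwise operations) of germs at $\infty$ of real valued functions defined on half-lines $(t_0,\infty)$ (two functions have the same germ if they agree on some $(t_0,\infty)$). A Hardy field is a subfield of the ring $G$ that is closed under differentiation. A function $h$ belongs to a Hardy field if its germ at $\infty$ does. Write $f\prec g$ (equivalently $g\succ f$) if $g(t)/f(t)\to\infty$ as $t\to\infty$. A function $h$ has polynomial growth if $|h(t)|\prec t^k$ for some $k\in\mathbb{N}$. A function $f\colon\mathbb{N}\to\mathbb{C}$ is multiplicative if $f(1)=1$ and $f(mn)=f(m)f(n)$ whenever $\gcd(m,n)=1$.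 For $r\in\mathbb{N}$, $\mathcal{D}^{(r)}$ is the collection of all sets of the form $\{n\in\mathbb{N}: f_1(n)=z_1,\ldots,f_r(n)=z_r\}$, where $f_1,\ldots,f_r\colon\mathbb{N}\to\mathbb{C}$ are arbitrary multiplicative functions and $z_1,\ldots,z_r$ are arbitrary complex numbers; $\mathcal{D}^{(\infty)}:=\bigcup_{r\geq 1}\mathcal{D}^{(r)}$. A point $z\in\mathbb{C}$ is a concentration point for $f\colon\mathbb{N}\to\mathbb{C}$ if $\sum_{p\text{ prime},\,f(p)=z}\frac1p=\infty$. $\mathcal{E}_{\mathrm{c.pt.}}$ is the collection of all sets of the form $\{n\in\mathbb{N}:f(n)\in K\}$, where $K\subset\mathbb{C}$ is arbitrary and $f\colon\mathbb{N}\to\mathbb{C}$ is a multiplicative function possessing at least one concentration point. A set $K\subset\mathbb{C}$ is an elementary set in polar coordinates if it is a finite union of sets of the form $\{re^{2\pi i\varphi}: r\in I_1,\varphi\in I_2\}$, where $I_1,I_2$ are (open, closed or half-open) intervals in $\mathbb{R}$. $\mathcal{E}_{\mathrm{pol}}$ is the collection of all sets of the form $\{n\in\mathbb{N}:f(n)\in K\}$, where $K$ is an elementary set in polar coordinates and $f$ is a multiplicative function bounded in modulus by $1$ with $\lim_{N\to\infty}\frac1N\sum_{n=1}^N|f(n)|\neq 0$ (this limit always exists, by Wirsing's theorem). *)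

theory Defs
  imports
    "HOL-Analysis.Analysis"
    "HOL-Computational_Algebra.Computational_Algebra"
    "HOL-Library.Infinite_Set"
begin

section \<open>Hardy fields\<close>

text \<open>
  Every function on a half-line extends to a total function, and the extension does not
  affect the germ; so total functions modulo eventual equality give all germs at infinity.
\<close>

quotient_type germ = "real \<Rightarrow> real" / "\<lambda>f g. \<forall>\<^sub>F t in at_top. f t = g t"
proof (rule equivpI)
  show "reflp (\<lambda>f g :: real \<Rightarrow> real. \<forall>\<^sub>F t in at_top. f t = g t)"
    by (simp add: reflp_def)
  show "symp (\<lambda>f g :: real \<Rightarrow> real. \<forall>\<^sub>F t in at_top. f t = g t)"
    by (simp add: symp_def eq_commute)
  show "transp (\<lambda>f g :: real \<Rightarrow> real. \<forall>\<^sub>F t in at_top. f t = g t)"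
    by (rule transpI) (erule (1) eventually_elim2, simp)
qed

lift_definition germ_of :: "(real \<Rightarrow> real) \<Rightarrow> germ" is "\<lambda>f. f" .

instantiation germ :: comm_ring_1
begin

lift_definition zero_germ :: germ is "\<lambda>_. 0" .

lift_definition one_germ :: germ is "\<lambda>_. 1" .

lift_definition plus_germ :: "germ \<Rightarrow> germ \<Rightarrow> germ" is "\<lambda>f g t. f t + g t"
  by (erule (1) eventually_elim2) simp

lift_definition minus_germ :: "germ \<Rightarrow> germ \<Rightarrow> germ" is "\<lambda>f g t. f t - g t"
  by (erule (1) eventually_elim2) simp

lift_definition uminus_germ :: "germ \<Rightarrow> germ" is "\<lambda>f t. - f t"
  by (erule eventually_mono) simp

lift_definition times_germ :: "germ \<Rightarrow> germ \<Rightarrow> germ" is "\<lambda>f g t. f t * g t"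
  by (erule (1) eventually_elim2) simp

instance
  by standard (transfer, simp add: algebra_simps)+

end

definition germ_has_derivative :: "germ \<Rightarrow> germ \<Rightarrow> bool" where
  "germ_has_derivative u v \<longleftrightarrow>
    (\<exists>f f'. u = germ_of f \<and> v = germ_of f' \<and>
      (\<forall>\<^sub>F t in at_top. (f has_real_derivative f' t) (at t)))"

definition hardy_field :: "germ set \<Rightarrow> bool" where
  "hardy_field H \<longleftrightarrow>
    1 \<in> H \<and>
    (\<forall>u\<in>H. \<forall>v\<in>H. u - v \<in> H) \<and>
    (\<forall>u\<in>H. \<forall>v\<in>H. u * v \<in> H) \<and>
    (\<forall>u\<in>H. u \<noteq> 0 \<longrightarrow> (\<exists>v\<in>H. u * v = 1)) \<and>
    (\<forall>u\<in>H. \<exists>v\<in>H. germ_has_derivative u v)"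

definition belongs_to_hardy_field :: "(real \<Rightarrow> real) \<Rightarrow> bool" where
  "belongs_to_hardy_field h \<longleftrightarrow> (\<exists>H. hardy_field H \<and> germ_of h \<in> H)"

definition grows_slower :: "(real \<Rightarrow> real) \<Rightarrow> (real \<Rightarrow> real) \<Rightarrow> bool"  (infix \<open>\<prec>\<close> 50) where
  "f \<prec> g \<longleftrightarrow> filterlim (\<lambda>t. g t / f t) at_top at_top"

definition polynomial_growth :: "(real \<Rightarrow> real) \<Rightarrow> bool" where
  "polynomial_growth h \<longleftrightarrow> (\<exists>k::nat. k \<ge> 1 \<and> (\<lambda>t. \<bar>h t\<bar>) \<prec> (\<lambda>t. t ^ k))"


section \<open>Density and uniform distribution\<close>

definition has_natural_density :: "nat set \<Rightarrow> real \<Rightarrow> bool" where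
  "has_natural_density E d \<longleftrightarrow>
    (\<lambda>N. real (card (E \<inter> {1..N})) / real N) \<longlonglongrightarrow> d"

text \<open>Sequences are indexed from 0, so the first \<open>N\<close> terms are those with \<open>j < N\<close>.\<close>

definition uniformly_distributed_mod1 :: "(nat \<Rightarrow> real) \<Rightarrow> bool" where
  "uniformly_distributed_mod1 x \<longleftrightarrow>
    (\<forall>a b. 0 \<le> a \<and> a < b \<and> b \<le> 1 \<longrightarrow>
      (\<lambda>N. real (card {j. j < N \<and> frac (x j) \<in> {a..<b}}) / real N) \<longlonglongrightarrow> b - a)"


section \<open>Level sets of multiplicative functions\<close>

text \<open>
  Arithmetic functions live on the positive integers; their value at 0 is irrelevant, and all
  level sets below exclude 0.
\<close>

definition multiplicative :: "(nat \<Rightarrow> complex) \<Rightarrow> bool" where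
  "multiplicative f \<longleftrightarrow>
    f 1 = 1 \<and> (\<forall>m n. m \<ge> 1 \<and> n \<ge> 1 \<and> coprime m n \<longrightarrow> f (m * n) = f m * f n)"

definition D_class :: "nat \<Rightarrow> nat set set" where
  "D_class r =
    {{n. n \<ge> 1 \<and> (\<forall>i\<in>{1..r}. f i n = z i)} | (f :: nat \<Rightarrow> nat \<Rightarrow> complex) (z :: nat \<Rightarrow> complex).
      \<forall>i\<in>{1..r}. multiplicative (f i)}"

definition D_infinity :: "nat set set" where
  "D_infinity = (\<Union>r\<in>{1..}. D_class r)"

text \<open>The terms are nonnegative, so the sum is infinite iff the family is not summable.\<close>

definition concentration_point :: "(nat \<Rightarrow> complex) \<Rightarrow> complex \<Rightarrow> bool" where
  "concentration_point f z \<longleftrightarrow>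
    \<not> (\<lambda>p. 1 / real p) summable_on {p. prime p \<and> f p = z}"

definition E_cpt :: "nat set set" where
  "E_cpt =
    {{n. n \<ge> 1 \<and> f n \<in> K} | f K. multiplicative f \<and> (\<exists>z. concentration_point f z)}"

definition polar_box :: "real set \<Rightarrow> real set \<Rightarrow> complex set" where
  "polar_box I1 I2 = {rcis r (2 * pi * \<phi>) | r \<phi>. r \<in> I1 \<and> \<phi> \<in> I2}"

definition elementary_polar :: "complex set \<Rightarrow> bool" where
  "elementary_polar K \<longleftrightarrow>
    (\<exists>\<C>. finite \<C> \<and> K = \<Union>\<C> \<and>
      (\<forall>S\<in>\<C>. \<exists>I1 I2. is_interval I1 \<and> is_interval I2 \<and> S = polar_box I1 I2))"

definition E_pol :: "nat set set" where
  "E_pol =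
    {{n. n \<ge> 1 \<and> f n \<in> K} | f K.
      elementary_polar K \<and> multiplicative f \<and> (\<forall>n\<ge>1. norm (f n) \<le> 1) \<and>
      (\<exists>L. L \<noteq> 0 \<and> (\<lambda>N. (\<Sum>n=1..N. norm (f n)) / real N) \<longlonglongrightarrow> L)}"

end

theory Submission
  imports Defs
begin

text \<open>
  Write \<open>e(x) = exp(2 \<pi> i x)\<close>. By Weyl's criterion, and because the density of \<open>E\<close> is
  positive, it is enough that \<open>1\<^sub>E(n) e(l h(n))\<close> has mean value zero for every \<open>l \<ge> 1\<close>
  (\<open>weyl_criterion\<close>, \<open>null_mean_along_enumeration\<close>); as \<open>l h\<close> satisfies the same hypotheses
  as \<open>h\<close>, consider \<open>l = 1\<close>.

  The arithmetic part is a variant of the criterion of Daboussi and Katai. Let \<open>a\<close> be a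
  bounded sequence such that \<open>a(pn)\<close> and \<open>a(qn)\<close> are uncorrelated for distinct primes
  \<open>p, q\<close>. Almost all integers have about \<open>A = \<Sum>\<^sub>p 1/p\<close> divisors in a finite set \<open>P\<close> of
  primes (\<open>turan_kubilius\<close>), so the sum of \<open>u(n) a(n)\<close> is \<open>1/A\<close> times the sum of all
  \<open>u(pm) a(pm)\<close> with \<open>p \<in> P\<close>, up to a small error. Suppose that \<open>u(pm)\<close> depends on \<open>p\<close>,
  apart from a factor \<open>c\<^sub>p\<close>, only through a class \<open>\<kappa>(p)\<close>: \<open>u(pm) = c\<^sub>p x\<^sub>k(m)\<close> with
  \<open>k = \<kappa>(p)\<close>. One application of the Cauchy--Schwarz inequality to the sum over the pairs
  \<open>(m, k)\<close> then leaves correlations of \<open>a\<close>, and the loss is the largest value of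
  \<open>\<Sum>\<^sub>k |x\<^sub>k(m)|\<^sup>2\<close>; the number of classes itself does not matter (\<open>katai_bound\<close>). A
  multiplicative \<open>u\<close> is the case of one class. The indicator function of \<open>E\<close> is in general
  not multiplicative, but it is within reach:

  \<^item> If \<open>f\<close> has a concentration point \<open>z\<close>, then the primes with \<open>f(p) = z\<close> form one class.

  \<^item> If \<open>E\<close> is given by \<open>f\<^sub>i(n) = z\<^sub>i\<close> for \<open>i \<le> r\<close>, let the class of \<open>p\<close> be the vector of the
    values \<open>f\<^sub>i(p)\<close>. For given \<open>m\<close> the condition forces \<open>f\<^sub>i(p) = z\<^sub>i / f\<^sub>i(m)\<close>, or concerns
    only the vanishing of \<open>f\<^sub>i(p)\<close> if \<open>z\<^sub>i = 0\<close>, so at most \<open>2\<^sup>r\<close> classes contribute.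

  \<^item> For polar boxes, all monomials in \<open>|f|\<close>, \<open>sgn f\<close> and its conjugate are bounded
    multiplicative functions, which settles continuous functions of \<open>|f|\<close> and \<open>sgn f\<close> by
    Weierstrass approximation. An indicator function differs from a suitable continuous
    function only near finitely many nonzero points, and for the difference few classes
    \<open>f(p)\<close> are active for each \<open>m\<close>, as soon as the neighbourhoods are small
    (\<open>orthogonal_up_to_small_neighbourhoods\<close>).

  In all cases an additional periodic factor is harmless, for the classes may be refined by
  the residue of \<open>p\<close> modulo the period.

  The analytic part provides such \<open>a\<close> (\<open>hardy_dilation_correlations\<close>). Write \<open>h = r + f\<close>
  with a rational polynomial \<open>r\<close>; then \<open>e(r(n))\<close> is periodic. All iterated derivatives of
  \<open>h\<close> are eventually monotone, hence have a finite or infinite limit, and polynomial growth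
  makes one of the limits finite. Removing rational monomials from the top, one may choose
  \<open>r\<close> so that for some \<open>k \<ge> 1\<close> either \<open>f\<^bsup>(k)\<^esup>\<close> has an irrational limit, or \<open>f\<^bsup>(k)\<^esup>\<close> tends to
  \<open>0\<close> and \<open>k = 1\<close> or \<open>f\<^bsup>(k-1)\<^esup>\<close> is unbounded. Put \<open>G(t) = f(pt) - f(qt)\<close>. If the limit is
  irrational, the \<open>k\<close>-th difference of \<open>G(n)\<close> has an irrational limit and van der Corput's
  inequality applies repeatedly. In the second case, with \<open>k\<close> replaced by \<open>max k 2\<close>, the
  derivative \<open>G\<^bsup>(k)\<^esup>\<close> is monotone with limit \<open>0\<close>, and \<open>t\<^sup>2 G\<^bsup>(k)\<^esup>(t)\<close> is monotone and
  unbounded: otherwise \<open>f\<^bsup>(k)\<^esup>(t) = O(log t / t\<^sup>2)\<close>, which makes \<open>f\<^bsup>(k-1)\<^esup>\<close> bounded and, if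
  \<open>k = 2\<close> and \<open>f'\<close> tends to \<open>0\<close>, yields \<open>f(t) = O(log\<^sup>2 t)\<close>. Here the growth hypothesis
  enters with its rate \<open>log\<^sup>2 t\<close>. Now van der Corput's inequality reduces to \<open>k = 2\<close>, where
  one more application with shifts of growing length leads to sums covered by the
  Kusmin--Landau inequality.

  The monotonicity statements about \<open>G\<close> need care, because \<open>G\<close> and the function \<open>t\<close> need not
  lie in the Hardy field. But polynomials in \<open>t\<close> over a Hardy field have eventually constant
  sign, and so do the functions \<open>\<psi>(pt) - \<psi>(qt)\<close> for such polynomials \<open>\<psi>\<close>, by monotonicity of
  \<open>\<psi>\<close>; both facts are applied to \<open>t\<^sup>k f\<^bsup>(k)\<^esup>(t)\<close> and its relatives.
\<close>

section \<open>The criterion of Daboussi and Katai\<close>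

definition avg :: "(nat \<Rightarrow> complex) \<Rightarrow> nat \<Rightarrow> complex" where
  "avg w N = (\<Sum>n=1..N. w n) / of_nat N"

definition null_mean :: "(nat \<Rightarrow> complex) \<Rightarrow> bool" where
  "null_mean w \<longleftrightarrow> avg w \<longlonglongrightarrow> 0"

lemma multiples_upto:
  fixes d N :: nat
  assumes "d > 0"
  shows "{n\<in>{1..N}. d dvd n} = (\<lambda>m. d * m) ` {1..N div d}"
proof (intro equalityI subsetI)
  fix n assume "n \<in> {n\<in>{1..N}. d dvd n}"
  then obtain m where m: "n = d * m" "1 \<le> n" "n \<le> N" by auto
  have "m \<ge> 1" using m by (cases m) auto
  moreover have "m \<le> N div d" using m assms by (metis div_le_mono nonzero_mult_div_cancel_left less_not_refl)
  ultimately show "n \<in> (\<lambda>m. d * m) ` {1..N div d}" using m by auto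
next
  fix n assume "n \<in> (\<lambda>m. d * m) ` {1..N div d}"
  then obtain m where m: "n = d * m" "1 \<le> m" "m \<le> N div d" by (auto simp only: image_iff atLeastAtMost_iff)
  have "d * m \<le> N" using m(3) assms by (meson le_trans mult_le_mono2 times_div_less_eq_dividend)
  then show "n \<in> {n\<in>{1..N}. d dvd n}" using m assms by auto
qed

lemma sum_over_multiples:
  fixes d N :: nat
  assumes "d > 0"
  shows "(\<Sum>n=1..N. of_bool (d dvd n) * g n) = (\<Sum>m=1..N div d. g (d * m) :: 'a :: semiring_1)"
proof -
  have "(\<Sum>n=1..N. of_bool (d dvd n) * g n) = (\<Sum>n\<in>{n\<in>{1..N}. d dvd n}. g n)"
    by (intro sum.mono_neutral_cong_right) auto
  also have "\<dots> = (\<Sum>m=1..N div d. g (d * m))"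
    unfolding multiples_upto[OF assms]
    by (subst sum.reindex) (use assms in \<open>auto simp: inj_on_def\<close>)
  finally show ?thesis .
qed

lemma density_of_multiples:
  fixes d :: nat
  assumes "d > 0"
  shows "(\<lambda>N. (\<Sum>n=1..N. of_bool (d dvd n)) / real N) \<longlonglongrightarrow> 1 / real d"
proof -
  have eq: "(\<Sum>n=1..N. of_bool (d dvd n)) = real (N div d)" for N
    using sum_over_multiples[OF assms, where g = "\<lambda>_. 1 :: real"] by simp
  have lower: "1 / real d - 1 / real N \<le> real (N div d) / real N" if "N > 0" for N
  proof -
    have "real N = real d * real (N div d) + real (N mod d)"
      by (metis div_mult_mod_eq mult.commute of_nat_add of_nat_mult)
    moreover have "real (N mod d) \<le> real d" using assms by (simp add: less_imp_le)
    ultimately have "real N / real d \<le> real (N div d) + 1"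
      using assms by (simp add: field_simps)
    then have "real N / real d / real N \<le> (real (N div d) + 1) / real N"
      by (intro divide_right_mono) auto
    moreover have "real N / real d / real N = 1 / real d" using that by simp
    ultimately show ?thesis by (simp add: add_divide_distrib)
  qed
  have upper: "real (N div d) / real N \<le> 1 / real d" for N
  proof -
    have "real d * real (N div d) \<le> real N"
      by (metis of_nat_le_iff of_nat_mult times_div_less_eq_dividend)
    then show ?thesis using assms by (cases "N = 0") (auto simp: field_simps)
  qed
  show ?thesis unfolding eq
  proof (rule tendsto_sandwich)
    show "\<forall>\<^sub>F N in sequentially. 1 / real d - 1 / real N \<le> real (N div d) / real N"
      using eventually_gt_at_top[of 0] by eventually_elim (use lower in auto)
    show "\<forall>\<^sub>F N in sequentially. real (N div d) / real N \<le> 1 / real d"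
      using upper by auto
    show "(\<lambda>N. 1 / real d - 1 / real N) \<longlonglongrightarrow> 1 / real d"
      using tendsto_diff[OF tendsto_const[of "1/real d"] lim_inverse_n'] by simp
  qed simp
qed

text \<open>Divisibility by different primes is asymptotically independent, so the number of divisors
  in \<open>P\<close> has mean \<open>A\<close> and variance \<open>\<Sum>\<^sub>p (1/p - 1/p\<^sup>2)\<close>. For a fixed set \<open>P\<close> and \<open>N \<rightarrow> \<infinity>\<close> this
  is an exact limit; no uniformity in \<open>P\<close> is involved.\<close>

lemma turan_kubilius:
  fixes P :: "nat set"
  assumes P: "finite P" "\<And>p. p \<in> P \<Longrightarrow> prime p"
  defines "A \<equiv> \<Sum>p\<in>P. 1 / real p"
  shows "(\<lambda>N. (\<Sum>n=1..N. ((\<Sum>p\<in>P. of_bool (p dvd n)) - A)\<^sup>2) / real N)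
           \<longlonglongrightarrow> A - (\<Sum>p\<in>P. 1 / (real p)\<^sup>2)"
proof -
  define b :: "nat \<Rightarrow> nat \<Rightarrow> real" where "b p n = of_bool (p dvd n)" for p n
  \<comment> \<open>the least common multiple, which turns products of divisibility conditions into one condition\<close>
  define L where "L p q = (if p = q then p else p * q)" for p q :: nat
  have bb: "b p n * b q n = b (L p q) n" if "p \<in> P" "q \<in> P" for p q n
  proof (cases "p = q")
    case False
    then have "coprime p q" using P(2) that primes_coprime by blast
    then have "p * q dvd n \<longleftrightarrow> p dvd n \<and> q dvd n"
      by (meson divides_mult dvd_mult_left dvd_mult_right)
    then show ?thesis using False by (auto simp: b_def L_def)
  qed (auto simp: b_def L_def)
  have expand: "((\<Sum>p\<in>P. of_bool (p dvd n)) - A)\<^sup>2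
      = (\<Sum>p\<in>P. \<Sum>q\<in>P. b (L p q) n) - 2 * A * (\<Sum>p\<in>P. b p n) + A\<^sup>2" for n
  proof -
    have "(\<Sum>p\<in>P. b p n)\<^sup>2 = (\<Sum>p\<in>P. \<Sum>q\<in>P. b (L p q) n)"
      unfolding power2_eq_square sum_product using bb by (intro sum.cong) auto
    then show ?thesis by (simp add: power2_diff b_def algebra_simps)
  qed
  have dens: "(\<lambda>N. (\<Sum>n=1..N. b d n) / real N) \<longlonglongrightarrow> 1 / real d" if "d > 0" for d
    using density_of_multiples[OF that] by (simp add: b_def)
  have Lpos: "L p q > 0" "p > 0" if "p \<in> P" "q \<in> P" for p q
    using that P(2) by (auto simp: L_def prime_gt_0_nat)
  have "(\<lambda>N. (\<Sum>p\<in>P. \<Sum>q\<in>P. (\<Sum>n=1..N. b (L p q) n) / real N)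
          - 2 * A * (\<Sum>p\<in>P. (\<Sum>n=1..N. b p n) / real N) + A\<^sup>2 * (real N / real N))
        \<longlonglongrightarrow> (\<Sum>p\<in>P. \<Sum>q\<in>P. 1 / real (L p q)) - 2 * A * (\<Sum>p\<in>P. 1 / real p) + A\<^sup>2 * 1"
    by (intro tendsto_intros dens Lpos) 
      (auto intro!: tendsto_eventually eventually_sequentiallyI[of 1])
  moreover have "(\<Sum>p\<in>P. \<Sum>q\<in>P. (\<Sum>n=1..N. b (L p q) n) / real N)
          - 2 * A * (\<Sum>p\<in>P. (\<Sum>n=1..N. b p n) / real N) + A\<^sup>2 * (real N / real N)
       = (\<Sum>n=1..N. ((\<Sum>p\<in>P. of_bool (p dvd n)) - A)\<^sup>2) / real N" for N
  proof -
    have "(\<Sum>n=1..N. \<Sum>p\<in>P. \<Sum>q\<in>P. b (L p q) n) = (\<Sum>p\<in>P. \<Sum>q\<in>P. \<Sum>n=1..N. b (L p q) n)"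
      by (subst sum.swap) (intro sum.cong refl sum.swap)
    moreover have "(\<Sum>n=1..N. \<Sum>p\<in>P. b p n) = (\<Sum>p\<in>P. \<Sum>n=1..N. b p n)"
      by (rule sum.swap)
    ultimately show ?thesis unfolding expand
      by (simp add: sum.distrib sum_subtractf add_divide_distrib diff_divide_distrib
          flip: sum_divide_distrib sum_distrib_left)
  qed
  moreover have "(\<Sum>p\<in>P. \<Sum>q\<in>P. 1 / real (L p q)) = A\<^sup>2 + A - (\<Sum>p\<in>P. 1 / (real p)\<^sup>2)"
  proof -
    have "(\<Sum>q\<in>P. 1 / real (L p q)) = 1 / real p * A + 1 / real p - 1 / (real p)\<^sup>2" if "p \<in> P" for p
    proof -
      have "(\<Sum>q\<in>P. 1 / real (L p q)) = 1 / real p + (\<Sum>q\<in>P-{p}. 1 / real p * (1 / real q))"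
        using that P(1) by (subst sum.remove[of P p]) (auto simp: L_def intro!: sum.cong)
      also have "(\<Sum>q\<in>P-{p}. 1 / real p * (1 / real q)) = 1 / real p * (A - 1 / real p)"
        unfolding A_def using P(1) that
        by (simp add: sum_diff1 right_diff_distrib sum_divide_distrib flip: sum_distrib_left)
          (simp add: sum_divide_distrib mult.commute)
      finally show ?thesis by (simp add: algebra_simps power2_eq_square)
    qed
    then have "(\<Sum>p\<in>P. \<Sum>q\<in>P. 1 / real (L p q))
        = (\<Sum>p\<in>P. 1 / real p * A + 1 / real p - 1 / (real p)\<^sup>2)" by (rule sum.cong[OF refl])
    also have "\<dots> = A\<^sup>2 + A - (\<Sum>p\<in>P. 1 / (real p)\<^sup>2)"
      unfolding sum.distrib sum_subtractf sum_distrib_right[symmetric] A_def[symmetric]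
      by (simp add: power2_eq_square)
    finally show ?thesis .
  qed
  ultimately show ?thesis by (simp add: A_def[symmetric] power2_eq_square)
qed

lemma sum_inverse_squares_le_1:
  fixes P :: "nat set"
  assumes "finite P" "\<And>p. p \<in> P \<Longrightarrow> p \<ge> 2"
  shows "(\<Sum>p\<in>P. 1 / (real p)\<^sup>2) \<le> 1"
proof -
  obtain M where M: "P \<subseteq> {2..<M + 2}"
  proof -
    obtain k where "\<forall>x\<in>P. x < k" using assms(1) finite_nat_set_iff_bounded by blast
    then show ?thesis using that[of k] assms(2) by fastforce
  qed
  have "(\<Sum>p\<in>P. 1 / (real p)\<^sup>2) \<le> (\<Sum>p\<in>{2..<M+2}. 1 / (real p)\<^sup>2)"
    using M by (intro sum_mono2) auto
  also have "\<dots> \<le> (\<Sum>p\<in>{2..<M+2}. 1 / (real p - 1) - 1 / real p)"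
    by (intro sum_mono) (auto simp: field_simps power2_eq_square)
  also have "\<dots> = 1 - 1 / (real M + 1)"
  proof (induction M)
    case (Suc M)
    have "{2..<Suc M + 2} = insert (M + 2) {2..<M + 2}" by auto
    then show ?case using Suc by simp
  qed simp
  finally show ?thesis by (smt (verit) divide_nonneg_nonneg of_nat_0_le_iff)
qed

lemma norm_sum_mult_le_sqrt:
  fixes x T :: "'i \<Rightarrow> complex"
  assumes "finite I" "(\<Sum>i\<in>I. (norm (x i))\<^sup>2) \<le> X" "(\<Sum>i\<in>I. (norm (T i))\<^sup>2) \<le> Y"
  shows "norm (\<Sum>i\<in>I. x i * T i) \<le> sqrt X * sqrt Y"
proof -
  have nn: "0 \<le> (\<Sum>i\<in>I. (norm (x i))\<^sup>2)" by (intro sum_nonneg) auto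
  have "norm (\<Sum>i\<in>I. x i * T i) \<le> (\<Sum>i\<in>I. norm (x i) * norm (T i))"
    by (rule order_trans[OF norm_sum]) (simp add: norm_mult)
  also have "\<dots> \<le> sqrt ((\<Sum>i\<in>I. (norm (x i))\<^sup>2) * (\<Sum>i\<in>I. (norm (T i))\<^sup>2))"
    by (rule real_le_rsqrt) (rule Cauchy_Schwarz_ineq_sum)
  also have "\<dots> \<le> sqrt (X * Y)"
    using assms nn by (intro real_sqrt_le_mono mult_mono) (auto intro: sum_nonneg)
  finally show ?thesis by (simp add: real_sqrt_mult)
qed

text \<open>The three terms on the right have different origins: the fluctuation of the number of
  prime divisors in \<open>P\<close>, the integers divisible by the square of a prime of \<open>P\<close> (where
  \<open>u_eq\<close> says nothing), and the Cauchy--Schwarz inequality over the pairs of an integer \<open>m\<close>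
  and a class \<open>k\<close>. In the last term the diagonal \<open>p = q\<close> contributes \<open>N A\<close>, which is smaller
  than the trivial \<open>N A\<^sup>2\<close>. Only the bound \<open>B\<close> on the sum over the classes enters, so there
  may be many classes as long as few of them are active for each \<open>m\<close>.\<close>

lemma katai_inequality:
  fixes a u :: "nat \<Rightarrow> complex" and P :: "nat set" and c :: "nat \<Rightarrow> complex"
    and x :: "'k \<Rightarrow> nat \<Rightarrow> complex" and \<kappa> :: "nat \<Rightarrow> 'k"
  assumes P: "finite P" "\<And>p. p \<in> P \<Longrightarrow> prime p"
    and a: "\<And>n. norm (a n) \<le> 1" and u: "\<And>n. n \<ge> 1 \<Longrightarrow> norm (u n) \<le> 1"
    and c: "\<And>p. p \<in> P \<Longrightarrow> norm (c p) \<le> 1"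
    and x: "\<And>m. m \<ge> 1 \<Longrightarrow> (\<Sum>k\<in>\<kappa> ` P. (norm (x k m))\<^sup>2) \<le> B" and B: "B \<ge> 1"
    and u_eq: "\<And>p m. p \<in> P \<Longrightarrow> m \<ge> 1 \<Longrightarrow> \<not> p dvd m \<Longrightarrow> u (p * m) = c p * x (\<kappa> p) m"
  defines "A \<equiv> \<Sum>p\<in>P. 1 / real p"
  shows "A * norm (\<Sum>n=1..N. u n * a n)
     \<le> sqrt (real N * (\<Sum>n=1..N. ((\<Sum>p\<in>P. of_bool (p dvd n)) - A)\<^sup>2))
       + 2 * sqrt B * real N
       + sqrt (B * real N) * sqrt (real N * A + (\<Sum>p\<in>P. \<Sum>q\<in>P-{p}.
            norm (\<Sum>m=1..min (N div p) (N div q). a (p * m) * cnj (a (q * m)))))"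
proof -
  define w :: "nat \<Rightarrow> real" where "w n = (\<Sum>p\<in>P. of_bool (p dvd n))" for n
  define S where "S = (\<Sum>n=1..N. u n * a n)"
  define C where "C p q = (\<Sum>m=1..min (N div p) (N div q). a (p * m) * cnj (a (q * m)))" for p q
  have ppos: "p > 0" "p \<ge> 2" if "p \<in> P" for p
    using P(2)[OF that] prime_gt_0_nat prime_ge_2_nat by auto
  have xB: "norm (x (\<kappa> p) m) \<le> sqrt B" if "p \<in> P" "m \<ge> 1" for p m
  proof -
    have "(norm (x (\<kappa> p) m))\<^sup>2 \<le> (\<Sum>k\<in>\<kappa> ` P. (norm (x k m))\<^sup>2)"
      using that P(1) by (intro member_le_sum) auto
    then show ?thesis using x[OF that(2)] by (intro real_le_rsqrt) linarith
  qed
  \<comment> \<open>\<open>w n\<close> is close to \<open>A\<close> in square mean\<close>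
  have 1: "norm (of_real A * S - (\<Sum>n=1..N. u n * a n * of_real (w n)))
      \<le> sqrt (real N * (\<Sum>n=1..N. (w n - A)\<^sup>2))"
  proof -
    have "of_real A * S - (\<Sum>n=1..N. u n * a n * of_real (w n))
        = (\<Sum>n=1..N. (- (u n * a n)) * of_real (w n - A))"
      unfolding S_def by (simp add: sum_distrib_left sum_subtractf algebra_simps sum_negf)
    also have "norm \<dots> \<le> sqrt (real N) * sqrt (\<Sum>n=1..N. (w n - A)\<^sup>2)"
    proof (rule norm_sum_mult_le_sqrt)
      have "(norm (- (u n * a n)))\<^sup>2 \<le> 1" if "n \<in> {1..N}" for n
        using a[of n] u[of n] that by (simp add: norm_mult mult_le_one power_le_one)
      then have "(\<Sum>n=1..N. (norm (- (u n * a n)))\<^sup>2) \<le> (\<Sum>n=1..N. 1)" by (intro sum_mono)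
      then show "(\<Sum>n=1..N. (norm (- (u n * a n)))\<^sup>2) \<le> real N" by simp
    qed (auto simp del: of_real_diff)
    finally show ?thesis by (simp add: real_sqrt_mult)
  qed
  \<comment> \<open>the integer \<open>n\<close> is counted once for every factorisation \<open>n = p m\<close>\<close>
  have sumw: "(\<Sum>n=1..N. u n * a n * of_real (w n)) = (\<Sum>p\<in>P. \<Sum>m=1..N div p. u (p * m) * a (p * m))"
  proof -
    have "(\<Sum>n=1..N. u n * a n * of_real (w n)) = (\<Sum>n=1..N. \<Sum>p\<in>P. of_bool (p dvd n) * (u n * a n))"
      unfolding w_def by (auto simp: sum_distrib_left mult.commute of_bool_def intro!: sum.cong)
    also have "\<dots> = (\<Sum>p\<in>P. \<Sum>n=1..N. of_bool (p dvd n) * (u n * a n))" by (rule sum.swap)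
    also have "\<dots> = (\<Sum>p\<in>P. \<Sum>m=1..N div p. u (p * m) * a (p * m))"
      by (intro sum.cong refl sum_over_multiples) (use ppos in auto)
    finally show ?thesis .
  qed
  \<comment> \<open>the factorisation of \<open>u (p * m)\<close> can fail only if \<open>p\<^sup>2\<close> divides \<open>p * m\<close>\<close>
  define M where "M = (\<Sum>p\<in>P. \<Sum>m=1..N div p. c p * x (\<kappa> p) m * a (p * m))"
  have 2: "norm ((\<Sum>n=1..N. u n * a n * of_real (w n)) - M) \<le> 2 * sqrt B * real N"
  proof -
    have "norm ((\<Sum>m=1..N div p. u (p * m) * a (p * m)) - (\<Sum>m=1..N div p. c p * x (\<kappa> p) m * a (p * m)))
        \<le> 2 * sqrt B * real N * (1 / (real p)\<^sup>2)" if "p \<in> P" for p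
    proof -
      have "norm (u (p * m) * a (p * m) - c p * x (\<kappa> p) m * a (p * m))
          \<le> of_bool (p dvd m) * (2 * sqrt B)" if "m \<ge> 1" for m
      proof (cases "p dvd m")
        case True
        have "norm (u (p * m) * a (p * m)) \<le> 1 * 1"
          unfolding norm_mult using u a that ppos[OF \<open>p \<in> P\<close>] by (intro mult_mono) auto
        moreover have "norm (c p * x (\<kappa> p) m * a (p * m)) \<le> 1 * sqrt B * 1"
          unfolding norm_mult using c a xB \<open>p \<in> P\<close> that B by (intro mult_mono) auto
        moreover have "sqrt B \<ge> 1" using B by simp
        ultimately have "norm (u (p * m) * a (p * m) - c p * x (\<kappa> p) m * a (p * m)) \<le> 2 * sqrt B"
          using norm_triangle_ineq4[of "u (p * m) * a (p * m)" "c p * x (\<kappa> p) m * a (p * m)"] by linarith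
        then show ?thesis using True by simp
      next
        case False then show ?thesis using u_eq[OF \<open>p \<in> P\<close> that] by simp
      qed
      then have "norm ((\<Sum>m=1..N div p. u (p * m) * a (p * m) - c p * x (\<kappa> p) m * a (p * m)))
          \<le> (\<Sum>m=1..N div p. of_bool (p dvd m) * (2 * sqrt B))"
        by (intro sum_norm_le) auto
      also have "\<dots> = real (N div p div p) * (2 * sqrt B)"
        by (subst sum_over_multiples) (use ppos that in auto)
      also have "\<dots> \<le> real N / (real p)\<^sup>2 * (2 * sqrt B)"
      proof (intro mult_right_mono)
        have "real (N div (p * p)) \<le> real N / real (p * p)" by (rule of_nat_div_le_of_nat)
        then show "real (N div p div p) \<le> real N / (real p)\<^sup>2"
          by (simp add: div_mult2_eq power2_eq_square)
      qed (use B in auto)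
      finally show ?thesis by (simp add: sum_subtractf mult_ac)
    qed
    then have "norm ((\<Sum>n=1..N. u n * a n * of_real (w n)) - M)
        \<le> (\<Sum>p\<in>P. 2 * sqrt B * real N * (1 / (real p)\<^sup>2))"
      unfolding sumw M_def sum_subtractf[symmetric] by (rule sum_norm_le)
    also have "\<dots> = 2 * sqrt B * real N * (\<Sum>p\<in>P. 1 / (real p)\<^sup>2)" by (simp add: sum_distrib_left)
    also have "\<dots> \<le> 2 * sqrt B * real N * 1"
      using B ppos P(1) by (intro mult_left_mono sum_inverse_squares_le_1) auto
    finally show ?thesis by simp
  qed
  \<comment> \<open>the primes of one class share the coefficient \<open>x k m\<close>, so they are summed before Cauchy--Schwarz\<close>
  define t where "t p m = of_bool (m \<le> N div p) * (c p * a (p * m))" for p m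
  define T where "T k m = (\<Sum>p\<in>{p\<in>P. \<kappa> p = k}. t p m)" for k m
  define I where "I = {1..N} \<times> (\<kappa> ` P)"
  have M_eq: "M = (\<Sum>(m,k)\<in>I. x k m * T k m)"
  proof -
    have "M = (\<Sum>p\<in>P. \<Sum>m=1..N. x (\<kappa> p) m * t p m)"
      unfolding M_def t_def
    proof (rule sum.cong[OF refl])
      fix p assume "p \<in> P"
      have "N div p \<le> N" by simp
      then show "(\<Sum>m=1..N div p. c p * x (\<kappa> p) m * a (p * m)) =
         (\<Sum>m=1..N. x (\<kappa> p) m * (of_bool (m \<le> N div p) * (c p * a (p * m))))"
        by (intro sum.mono_neutral_cong_left) auto
    qed
    also have "\<dots> = (\<Sum>m=1..N. \<Sum>p\<in>P. x (\<kappa> p) m * t p m)" by (rule sum.swap)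
    also have "\<dots> = (\<Sum>m=1..N. \<Sum>k\<in>\<kappa> ` P. x k m * T k m)"
    proof (rule sum.cong[OF refl])
      fix m
      show "(\<Sum>p\<in>P. x (\<kappa> p) m * t p m) = (\<Sum>k\<in>\<kappa> ` P. x k m * T k m)"
        unfolding T_def sum_distrib_left
        by (subst sum.image_gen[OF P(1), where g = \<kappa>]) (auto intro!: sum.cong)
    qed
    also have "\<dots> = (\<Sum>(m,k)\<in>I. x k m * T k m)"
      unfolding I_def by (rule sum.cartesian_product)
    finally show ?thesis .
  qed
  have Tsum: "(\<Sum>(m,k)\<in>I. (norm (T k m))\<^sup>2) \<le> real N * A + (\<Sum>p\<in>P. \<Sum>q\<in>P-{p}. norm (C p q))"
  proof -
    have tt: "(\<Sum>m=1..N. t p m * cnj (t q m)) = c p * cnj (c q) * C p q" if "p \<in> P" "q \<in> P" for p q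
    proof -
      have "(\<Sum>m=1..N. t p m * cnj (t q m))
         = (\<Sum>m=1..min (N div p) (N div q). c p * cnj (c q) * (a (p * m) * cnj (a (q * m))))"
        unfolding t_def by (intro sum.mono_neutral_cong_right) (auto intro: min.coboundedI1)
      then show ?thesis by (simp add: C_def sum_distrib_left)
    qed
    have tt_le: "norm (\<Sum>m=1..N. t p m * cnj (t q m)) \<le> norm (C p q)" if "p \<in> P" "q \<in> P" for p q
    proof -
      have "norm (c p * cnj (c q)) \<le> 1 * 1"
        unfolding norm_mult using c that by (intro mult_mono) auto
      then show ?thesis unfolding tt[OF that] norm_mult[of _ "C p q"]
        by (simp add: mult_left_le_one_le)
    qed
    have C_diag: "norm (C p p) \<le> real N * (1 / real p)" for p
    proof -
      have "norm (a (p * m) * cnj (a (p * m))) \<le> 1 * 1" for m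
        unfolding norm_mult using a by (intro mult_mono) auto
      then have "norm (C p p) \<le> (\<Sum>m=1..N div p. 1)" unfolding C_def min.idem by (intro sum_norm_le) auto
      also have "\<dots> \<le> real N / real p" by (simp add: of_nat_div_le_of_nat)
      finally show ?thesis by simp
    qed
    have "(\<Sum>(m,k)\<in>I. of_real ((norm (T k m))\<^sup>2))
        = (\<Sum>m=1..N. \<Sum>k\<in>\<kappa> ` P. T k m * cnj (T k m))"
      unfolding I_def sum.cartesian_product by (intro sum.cong) (auto simp: complex_norm_square[symmetric])
    also have "\<dots> = (\<Sum>k\<in>\<kappa> ` P. \<Sum>p\<in>{p\<in>P. \<kappa> p = k}. \<Sum>q\<in>{p\<in>P. \<kappa> p = k}. \<Sum>m=1..N. t p m * cnj (t q m))"
      unfolding T_def cnj_sum sum_product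
      by (subst sum.swap, rule sum.cong[OF refl], subst sum.swap, rule sum.cong[OF refl], rule sum.swap)
    also have "norm \<dots> \<le> (\<Sum>k\<in>\<kappa> ` P. \<Sum>p\<in>{p\<in>P. \<kappa> p = k}. \<Sum>q\<in>{p\<in>P. \<kappa> p = k}. norm (C p q))"
      by (intro sum_norm_le tt_le) auto
    also have "\<dots> \<le> (\<Sum>k\<in>\<kappa> ` P. \<Sum>p\<in>{p\<in>P. \<kappa> p = k}. \<Sum>q\<in>P. norm (C p q))"
      using P(1) by (intro sum_mono sum_mono2) auto
    also have "\<dots> = (\<Sum>p\<in>P. \<Sum>q\<in>P. norm (C p q))"
      by (rule sum.image_gen[OF P(1), symmetric])
    also have "\<dots> = (\<Sum>p\<in>P. norm (C p p) + (\<Sum>q\<in>P-{p}. norm (C p q)))"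
      by (intro sum.cong refl sum.remove P(1))
    also have "\<dots> \<le> (\<Sum>p\<in>P. real N * (1 / real p) + (\<Sum>q\<in>P-{p}. norm (C p q)))"
      by (intro sum_mono add_right_mono C_diag)
    also have "\<dots> = real N * A + (\<Sum>p\<in>P. \<Sum>q\<in>P-{p}. norm (C p q))"
      by (simp add: A_def sum.distrib sum_distrib_left)
    finally have "norm (complex_of_real (\<Sum>(m,k)\<in>I. (norm (T k m))\<^sup>2)) \<le> real N * A + (\<Sum>p\<in>P. \<Sum>q\<in>P-{p}. norm (C p q))"
      by (simp add: case_prod_unfold)
    then show ?thesis unfolding norm_of_real by linarith
  qed
  have 3: "norm M \<le> sqrt (B * real N) * sqrt (real N * A + (\<Sum>p\<in>P. \<Sum>q\<in>P-{p}. norm (C p q)))"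
  proof -
    have "(\<Sum>(m,k)\<in>I. (norm (x k m))\<^sup>2) = (\<Sum>m=1..N. \<Sum>k\<in>\<kappa> ` P. (norm (x k m))\<^sup>2)"
      unfolding I_def by (rule sum.cartesian_product[symmetric])
    also have "\<dots> \<le> (\<Sum>m=1..N. B)" by (intro sum_mono x) auto
    finally have X: "(\<Sum>(m,k)\<in>I. (norm (x k m))\<^sup>2) \<le> B * real N" by (simp add: mult.commute)
    show ?thesis unfolding M_eq case_prod_unfold
      by (rule norm_sum_mult_le_sqrt) 
         (use X Tsum P(1) in \<open>auto simp: I_def case_prod_unfold\<close>)
  qed
  have "A * norm S = norm (of_real A * S)"
  proof -
    have "A \<ge> 0" by (simp add: A_def sum_nonneg)
    then show ?thesis by (simp add: norm_mult)
  qed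
  also have "\<dots> \<le> norm (of_real A * S - (\<Sum>n=1..N. u n * a n * of_real (w n)))
       + norm ((\<Sum>n=1..N. u n * a n * of_real (w n)) - M) + norm M"
    by norm
  also have "\<dots> \<le> sqrt (real N * (\<Sum>n=1..N. (w n - A)\<^sup>2)) + 2 * sqrt B * real N
      + sqrt (B * real N) * sqrt (real N * A + (\<Sum>p\<in>P. \<Sum>q\<in>P-{p}. norm (C p q)))"
    by (intro add_mono 1 2 3)
  finally show ?thesis unfolding S_def w_def C_def .
qed

text \<open>The correlations of two dilations come with a shorter range of summation than the one by
  which they are normalised.\<close>

lemma null_mean_correlation_restricted:
  assumes "null_mean w" "filterlim K sequentially sequentially" "\<And>N. K N \<le> N"
  shows "(\<lambda>N. norm (\<Sum>m=1..K N. w m) / real N) \<longlonglongrightarrow> 0"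
proof -
  have lim: "(\<lambda>N. norm (avg w (K N))) \<longlonglongrightarrow> 0"
    using filterlim_compose[OF assms(1)[unfolded null_mean_def] assms(2)] tendsto_norm_zero by blast
  have "norm (\<Sum>m=1..K N. w m) / real N \<le> norm (avg w (K N))" for N
  proof (cases "K N = 0")
    case False
    then have pos: "real (K N) > 0" by simp
    have "norm (\<Sum>m=1..K N. w m) / real N \<le> norm (\<Sum>m=1..K N. w m) / real (K N)"
      using assms(3)[of N] pos by (intro divide_left_mono mult_pos_pos) auto
    then show ?thesis by (simp add: avg_def norm_divide)
  qed simp
  then show ?thesis
    by (intro tendsto_sandwich[OF _ _ tendsto_const lim]) auto
qed

text \<open>Dividing by \<open>A N\<close> and letting \<open>N \<rightarrow> \<infinity>\<close> for fixed \<open>P\<close> removes the off-diagonal correlations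
  and leaves \<open>O(\<surd>B / \<surd>A)\<close>, which is small once the sum of the reciprocals of the primes in
  \<open>P\<close> is large.\<close>

lemma katai_bound:
  fixes a u :: "nat \<Rightarrow> complex" and P :: "nat set" and c :: "nat \<Rightarrow> complex"
    and x :: "'k \<Rightarrow> nat \<Rightarrow> complex" and \<kappa> :: "nat \<Rightarrow> 'k"
  assumes P: "finite P" "\<And>p. p \<in> P \<Longrightarrow> prime p"
    and a: "\<And>n. norm (a n) \<le> 1" and u: "\<And>n. n \<ge> 1 \<Longrightarrow> norm (u n) \<le> 1"
    and c: "\<And>p. p \<in> P \<Longrightarrow> norm (c p) \<le> 1"
    and x: "\<And>m. m \<ge> 1 \<Longrightarrow> (\<Sum>k\<in>\<kappa> ` P. (norm (x k m))\<^sup>2) \<le> B" and B: "B \<ge> 1"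
    and u_eq: "\<And>p m. p \<in> P \<Longrightarrow> m \<ge> 1 \<Longrightarrow> \<not> p dvd m \<Longrightarrow> u (p * m) = c p * x (\<kappa> p) m"
    and corr: "\<And>p q. p \<in> P \<Longrightarrow> q \<in> P \<Longrightarrow> p \<noteq> q \<Longrightarrow> null_mean (\<lambda>n. a (p * n) * cnj (a (q * n)))"
    and A: "(\<Sum>p\<in>P. 1 / real p) \<ge> 1"
  shows "\<forall>\<^sub>F N in sequentially. norm (avg (\<lambda>n. u n * a n) N) \<le> 5 * sqrt B / sqrt (\<Sum>p\<in>P. 1 / real p)"
proof -
  define A where "A = (\<Sum>p\<in>P. 1 / real p)"
  have A1: "A \<ge> 1" using A by (simp add: A_def)
  define V where "V N = (\<Sum>n=1..N. ((\<Sum>p\<in>P. of_bool (p dvd n)) - A)\<^sup>2)" for N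
  define C where "C N p q = norm (\<Sum>m=1..min (N div p) (N div q). a (p * m) * cnj (a (q * m)))" for N p q
  define R where "R N = sqrt (V N / real N) + 2 * sqrt B + sqrt B * sqrt (A + (\<Sum>p\<in>P. \<Sum>q\<in>P-{p}. C N p q / real N))" for N
  have bound: "A * norm (avg (\<lambda>n. u n * a n) N) \<le> R N" if "N > 0" for N
  proof -
    have "A * norm (\<Sum>n=1..N. u n * a n)
      \<le> sqrt (real N * V N) + 2 * sqrt B * real N
        + sqrt (B * real N) * sqrt (real N * A + (\<Sum>p\<in>P. \<Sum>q\<in>P-{p}. C N p q))"
      unfolding A_def V_def C_def using P a u c x B u_eq by (rule katai_inequality)
    also have "\<dots> = real N * R N"
    proof -
      have N2: "real N = sqrt (real N) * sqrt (real N)" by simp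
      have 1: "sqrt (real N * V N) = real N * sqrt (V N / real N)"
      proof -
        have "real N * V N = (real N)\<^sup>2 * (V N / real N)" using that by (simp add: power2_eq_square)
        then have "sqrt (real N * V N) = sqrt ((real N)\<^sup>2) * sqrt (V N / real N)"
          by (simp only: real_sqrt_mult)
        then show ?thesis by simp
      qed
      have "real N * A + (\<Sum>p\<in>P. \<Sum>q\<in>P-{p}. C N p q) = real N * (A + (\<Sum>p\<in>P. \<Sum>q\<in>P-{p}. C N p q / real N))"
        using that by (simp add: distrib_left sum_distrib_left)
      then have "sqrt (B * real N) * sqrt (real N * A + (\<Sum>p\<in>P. \<Sum>q\<in>P-{p}. C N p q))
        = (sqrt (real N) * sqrt (real N)) * (sqrt B * sqrt (A + (\<Sum>p\<in>P. \<Sum>q\<in>P-{p}. C N p q / real N)))"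
        by (simp add: real_sqrt_mult)
      then show ?thesis unfolding R_def 1 N2[symmetric] by (simp add: algebra_simps)
    qed
    finally show ?thesis using that by (simp add: avg_def norm_divide field_simps)
  qed
  have V: "(\<lambda>N. V N / real N) \<longlonglongrightarrow> A - (\<Sum>p\<in>P. 1 / (real p)\<^sup>2)"
    unfolding V_def A_def using P by (rule turan_kubilius)
  have "(\<lambda>N. C N p q / real N) \<longlonglongrightarrow> 0" if "p \<in> P" "q \<in> P - {p}" for p q
    unfolding C_def
  proof (rule null_mean_correlation_restricted)
    show "null_mean (\<lambda>m. a (p * m) * cnj (a (q * m)))" using that corr by auto
    have pos: "p > 0" "q > 0" using P(2) that by (auto simp: prime_gt_0_nat)
    show "filterlim (\<lambda>N. min (N div p) (N div q)) sequentially sequentially"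
      unfolding filterlim_at_top
    proof
      fix Z
      show "\<forall>\<^sub>F N in sequentially. Z \<le> min (N div p) (N div q)"
        using eventually_ge_at_top[of "Z * p + Z * q"]
      proof eventually_elim
        case (elim N)
        then have "Z * p \<le> N" "Z * q \<le> N" by auto
        then show ?case using pos by (simp add: less_eq_div_iff_mult_less_eq)
      qed
    qed
  qed (auto intro: min.coboundedI1)
  then have "R \<longlonglongrightarrow> sqrt (A - (\<Sum>p\<in>P. 1 / (real p)\<^sup>2)) + 2 * sqrt B + sqrt B * sqrt (A + (\<Sum>p\<in>P. \<Sum>q\<in>P-{p}. 0))"
    unfolding R_def by (intro tendsto_intros V) auto
  moreover have "sqrt (A - (\<Sum>p\<in>P. 1 / (real p)\<^sup>2)) + 2 * sqrt B + sqrt B * sqrt (A + (\<Sum>p\<in>P. \<Sum>q\<in>P-{p}. 0))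
      < 5 * sqrt B * sqrt A"
  proof -
    have B1: "sqrt B \<ge> 1" and sA: "sqrt A \<ge> 1" using B A1 by auto
    have "sqrt (A - (\<Sum>p\<in>P. 1 / (real p)\<^sup>2)) \<le> sqrt A" by (simp add: sum_nonneg)
    also have "\<dots> \<le> sqrt B * sqrt A" using B1 sA by (simp add: mult_le_cancel_right1)
    finally have 1: "sqrt (A - (\<Sum>p\<in>P. 1 / (real p)\<^sup>2)) \<le> sqrt B * sqrt A" .
    have 2: "sqrt B \<le> sqrt B * sqrt A" using B1 sA by (simp add: mult_le_cancel_left1)
    have "sqrt B * sqrt A > 0" using B1 sA by simp
    then have "sqrt (A - (\<Sum>p\<in>P. 1 / (real p)\<^sup>2)) + 2 * sqrt B + sqrt B * sqrt A < 5 * (sqrt B * sqrt A)"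
      using 1 2 by linarith
    then show ?thesis by (simp add: mult.assoc)
  qed
  ultimately have "\<forall>\<^sub>F N in sequentially. R N < 5 * sqrt B * sqrt A" by (rule order_tendstoD)
  then have "\<forall>\<^sub>F N in sequentially. norm (avg (\<lambda>n. u n * a n) N) \<le> 5 * sqrt B / sqrt A"
    using eventually_gt_at_top[of 0]
  proof eventually_elim
    case (elim N)
    have "A * norm (avg (\<lambda>n. u n * a n) N) < 5 * sqrt B * sqrt A" using bound[of N] elim by linarith
    then have "norm (avg (\<lambda>n. u n * a n) N) < 5 * sqrt B * sqrt A / A" using A1 by (simp add: field_simps)
    also have "\<dots> = 5 * sqrt B * (sqrt A / A)" by simp
    also have "sqrt A / A = 1 / sqrt A" using A1 real_div_sqrt[of A] by (simp add: field_simps)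
    also have "5 * sqrt B * (1 / sqrt A) = 5 * sqrt B / sqrt A" by simp
    finally show ?case by simp
  qed
  then show ?thesis by (simp add: A_def)
qed

lemma avg_add: "avg (\<lambda>n. f n + g n) N = avg f N + avg g N"
  by (simp add: avg_def sum.distrib add_divide_distrib)

lemma avg_diff: "avg (\<lambda>n. f n - g n) N = avg f N - avg g N"
  by (simp add: avg_def sum_subtractf diff_divide_distrib)

lemma avg_cmult: "avg (\<lambda>n. c * f n) N = c * avg f N"
  by (simp add: avg_def sum_distrib_left)

lemma avg_cong: "(\<And>n. n \<ge> 1 \<Longrightarrow> f n = g n) \<Longrightarrow> avg f = avg g"
  by (auto simp: avg_def fun_eq_iff intro!: sum.cong arg_cong2[where f = "(/)"])

lemma avg_bound:
  assumes "\<And>n. n \<ge> 1 \<Longrightarrow> norm (f n) \<le> e" "e \<ge> 0"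
  shows "norm (avg f N) \<le> e"
proof -
  have "norm (\<Sum>n=1..N. f n) \<le> (\<Sum>n=1..N. e)" using assms by (intro sum_norm_le) auto
  then show ?thesis using assms(2) by (cases "N = 0") (auto simp: avg_def norm_divide field_simps)
qed

lemma null_mean_add: "null_mean f \<Longrightarrow> null_mean g \<Longrightarrow> null_mean (\<lambda>n. f n + g n)"
  unfolding null_mean_def avg_add[abs_def] using tendsto_add_zero by blast

lemma null_mean_diff: "null_mean f \<Longrightarrow> null_mean g \<Longrightarrow> null_mean (\<lambda>n. f n - g n)"
  unfolding null_mean_def avg_diff[abs_def] using tendsto_diff[of _ 0 _ _ 0] by auto

lemma null_mean_cmult: "null_mean f \<Longrightarrow> null_mean (\<lambda>n. c * f n)"
  unfolding null_mean_def avg_cmult[abs_def] using tendsto_mult_right_zero by blast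

lemma null_mean_zero: "null_mean (\<lambda>n. 0)"
  by (simp add: null_mean_def avg_def[abs_def])

lemma null_mean_sum:
  assumes "\<And>i. i \<in> I \<Longrightarrow> null_mean (f i)"
  shows "null_mean (\<lambda>n. \<Sum>i\<in>I. f i n)"
  using assms by (induction I rule: infinite_finite_induct) (auto simp: null_mean_zero null_mean_add)

lemma null_mean_cong: "(\<And>n. n \<ge> 1 \<Longrightarrow> f n = g n) \<Longrightarrow> null_mean f \<longleftrightarrow> null_mean g"
  unfolding null_mean_def using avg_cong[of f g] by metis

lemma null_mean_approx:
  assumes "\<And>e. e > 0 \<Longrightarrow> \<exists>g. null_mean g \<and> (\<forall>\<^sub>F N in sequentially. norm (avg (\<lambda>n. f n - g n) N) \<le> e)"
  shows "null_mean f"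
  unfolding null_mean_def tendsto_iff dist_norm
proof (intro allI impI)
  fix e :: real assume "e > 0"
  then obtain g where g: "null_mean g" "\<forall>\<^sub>F N in sequentially. norm (avg (\<lambda>n. f n - g n) N) \<le> e/2"
    using assms[of "e/2"] by auto
  have "\<forall>\<^sub>F N in sequentially. norm (avg g N) < e/2"
  proof -
    have "\<forall>\<^sub>F N in sequentially. dist (avg g N) 0 < e/2"
      using g(1) \<open>e > 0\<close> unfolding null_mean_def by (intro tendstoD) auto
    then show ?thesis by simp
  qed
  with g(2) show "\<forall>\<^sub>F N in sequentially. norm (avg f N - 0) < e"
  proof eventually_elim
    case (elim N)
    have "norm (avg f N) \<le> norm (avg (\<lambda>n. f n - g n) N) + norm (avg g N)"
      unfolding avg_diff by norm
    then show ?case using elim by simp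
  qed
qed

lemma null_mean_uniform_approx:
  assumes "\<And>e. e > 0 \<Longrightarrow> \<exists>g. null_mean g \<and> (\<forall>n\<ge>1. norm (f n - g n) \<le> e)"
  shows "null_mean f"
proof (rule null_mean_approx)
  fix e :: real assume e: "e > 0"
  from assms[OF this] obtain g where g: "null_mean g" "\<forall>n\<ge>1. norm (f n - g n) \<le> e" by blast
  then have "norm (avg (\<lambda>n. f n - g n) N) \<le> e" for N using e by (intro avg_bound) auto
  then show "\<exists>g. null_mean g \<and> (\<forall>\<^sub>F N in sequentially. norm (avg (\<lambda>n. f n - g n) N) \<le> e)"
    using g(1) by (intro exI[of _ g]) (auto intro!: always_eventually)
qed

section \<open>Exponential sums and the method of van der Corput\<close>

definition circ :: "real \<Rightarrow> complex" where
  "circ x = cis (2 * pi * x)"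

lemma norm_circ [simp]: "norm (circ x) = 1"
  by (simp add: circ_def)

lemma circ_add: "circ (x + y) = circ x * circ y"
  by (simp add: circ_def cis_mult distrib_left)

lemma circ_diff: "circ (x - y) = circ x * cnj (circ y)"
  by (simp add: circ_def cis_cnj cis_mult right_diff_distrib)

lemma circ_minus: "circ (- x) = cnj (circ x)"
  by (simp add: circ_def cis_cnj)

lemma circ_neq_0 [simp]: "circ x \<noteq> 0"
  by (simp add: circ_def)

lemma circ_of_int [simp]: "circ (of_int n) = 1"
  by (simp add: circ_def cis_multiple_2pi)

lemma circ_eq_1_imp_Ints:
  assumes "circ x = 1"
  shows "x \<in> \<int>"
proof -
  have "cos (2 * pi * x) = 1"
    using arg_cong[OF assms[unfolded circ_def], of Re] by (simp only: cis.sel one_complex.sel)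
  then obtain n :: int where n: "2 * pi * x = of_int n * 2 * pi"
    unfolding cos_one_2pi_int by (elim exE)
  have "x = of_int n" using n pi_neq_zero by algebra
  then show ?thesis by (simp only: Ints_of_int)
qed

text \<open>Means over \<open>0, \<dots>, N - 1\<close> are more convenient for shifts and differences than means over
  \<open>1, \<dots>, N\<close>.\<close>

definition null_mean0 :: "(nat \<Rightarrow> complex) \<Rightarrow> bool" where
  "null_mean0 z \<longleftrightarrow> (\<lambda>N. (\<Sum>n<N. z n) / of_nat N) \<longlonglongrightarrow> 0"

lemma null_mean0_iff_norm: "null_mean0 z \<longleftrightarrow> (\<lambda>N. norm (\<Sum>n<N. z n) / real N) \<longlonglongrightarrow> 0"
proof -
  have "norm ((\<Sum>n<N. z n) / of_nat N) = norm (\<Sum>n<N. z n) / real N" for N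
    by (simp only: norm_divide norm_of_nat)
  then show ?thesis
    using tendsto_norm_zero_iff[of "\<lambda>N. (\<Sum>n<N. z n) / of_nat N" sequentially]
    by (simp only: null_mean0_def)
qed

lemma mult_cos_le_sin:
  assumes "0 \<le> t" "t \<le> pi"
  shows "t * cos t \<le> sin t"
proof -
  have "(\<lambda>t. sin t - t * cos t) 0 \<le> (\<lambda>t. sin t - t * cos t) t"
  proof (rule DERIV_nonneg_imp_nondecreasing[OF assms(1)])
    fix s assume "0 \<le> s" "s \<le> t"
    then show "\<exists>y. ((\<lambda>t. sin t - t * cos t) has_real_derivative y) (at s) \<and> 0 \<le> y"
      using assms by (intro exI[of _ "s * sin s"]) (auto intro!: derivative_eq_intros mult_nonneg_nonneg sin_ge_zero)
  qed
  then show ?thesis by simp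
qed

lemma cot_le_inverse:
  assumes "0 < t" "t < pi"
  shows "cot t \<le> 1 / t"
  using mult_cos_le_sin[of t] assms sin_gt_zero[of t] by (simp add: cot_def field_simps)

lemma inverse_circ_minus_1:
  assumes "0 < d" "d < 1"
  shows "1 / (circ d - 1) = Complex (- 1 / 2) (- cot (pi * d) / 2)"
proof -
  define t where "t = pi * d"
  have s: "sin t \<noteq> 0" using sin_gt_zero[of t] assms by (auto simp: t_def)
  have eq: "circ d - 1 = Complex (- 2 * (sin t * sin t)) (2 * sin t * cos t)"
    using cos_double_sin[of t] sin_double[of t]
    by (simp add: circ_def t_def mult.assoc complex_eq_iff power2_eq_square)
  have "(circ d - 1) * Complex (- 1 / 2) (- cot t / 2) = 1"
  proof (rule complex_eqI)
    have "Re ((circ d - 1) * Complex (- 1 / 2) (- cot t / 2)) = sin t * sin t + cos t * cos t"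
      unfolding eq using s by (simp add: cot_def field_simps)
    then show "Re ((circ d - 1) * Complex (- 1 / 2) (- cot t / 2)) = Re 1"
      using sin_cos_squared_add[of t] by (simp add: power2_eq_square)
    show "Im ((circ d - 1) * Complex (- 1 / 2) (- cot t / 2)) = Im 1"
      unfolding eq using s by (simp add: cot_def field_simps)
  qed
  moreover from this have "circ d - 1 \<noteq> 0" by auto
  ultimately show ?thesis unfolding t_def by (simp add: field_simps)
qed

text \<open>Kusmin and Landau write the terms of an exponential sum as a difference \<open>z (Suc n) - z n\<close>
  times the quotient \<open>b n = 1 / (e(x (Suc n) - x n) - 1)\<close>. After partial summation only the
  variation of \<open>b\<close> matters.\<close>

lemma abel_quotient_sum:
  fixes z b :: "nat \<Rightarrow> complex"
  assumes "\<And>n. n \<le> L \<Longrightarrow> z n = (z (Suc n) - z n) * b n"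
  shows "(\<Sum>n<Suc L. z n) = z (Suc L) * b L - z 0 * b 0 - (\<Sum>n<L. z (Suc n) * (b (Suc n) - b n))"
  using assms
proof (induction L)
  case 0
  then show ?case by (simp add: algebra_simps)
next
  case (Suc L)
  have "(\<Sum>n<Suc (Suc L). z n) = (\<Sum>n<Suc L. z n) + (z (Suc (Suc L)) - z (Suc L)) * b (Suc L)"
    using Suc.prems[of "Suc L"] by simp
  also have "(\<Sum>n<Suc L. z n) = z (Suc L) * b L - z 0 * b 0 - (\<Sum>n<L. z (Suc n) * (b (Suc n) - b n))"
    by (rule Suc.IH) (use Suc.prems in auto)
  finally show ?case by (simp add: algebra_simps)
qed

text \<open>The quotient \<open>1 / (e(d) - 1) = - 1/2 - (i/2) cot(\<pi> d)\<close> has constant real part and an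
  imaginary part that is monotone in \<open>d\<close>. Since the increments are monotone, the total
  variation in the partial summation telescopes, and \<open>cot(\<pi> d) \<le> 1 / (2 \<mu>)\<close> bounds all
  terms.\<close>

lemma kusmin_landau:
  fixes x :: "nat \<Rightarrow> real"
  assumes lower: "\<And>n. n < L \<Longrightarrow> \<mu> \<le> x (Suc n) - x n"
    and upper: "\<And>n. n < L \<Longrightarrow> x (Suc n) - x n \<le> 1 / 2"
    and anti: "\<And>n. Suc n < L \<Longrightarrow> x (Suc (Suc n)) - x (Suc n) \<le> x (Suc n) - x n"
    and \<mu>: "\<mu> > 0"
  shows "norm (\<Sum>n<L. circ (x n)) \<le> 2 / \<mu>"
proof (cases L)
  case 0 then show ?thesis using \<mu> by simp
next
  case (Suc K)
  define \<delta> where "\<delta> n = x (Suc n) - x n" for n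
  define ct where "ct n = cot (pi * \<delta> n)" for n
  define b where "b n = Complex (- 1 / 2) (- ct n / 2)" for n
  have \<delta>: "0 < \<delta> n" "\<mu> \<le> \<delta> n" "\<delta> n \<le> 1 / 2" if "n \<le> K" for n
    using lower[of n] upper[of n] that Suc \<mu> by (auto simp: \<delta>_def)
  have z_eq: "circ (x n) = (circ (x (Suc n)) - circ (x n)) * b n" if "n \<le> K" for n
  proof -
    have "x (Suc n) = x n + \<delta> n" by (simp add: \<delta>_def)
    then have "circ (x (Suc n)) - circ (x n) = circ (x n) * (circ (\<delta> n) - 1)"
      by (simp add: circ_add algebra_simps)
    moreover have "circ (\<delta> n) - 1 \<noteq> 0"
    proof
      assume "circ (\<delta> n) - 1 = 0"
      then have "\<delta> n \<in> \<int>" by (intro circ_eq_1_imp_Ints) simp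
      then obtain k where "\<delta> n = of_int k" by (rule Ints_cases)
      then have "0 < k" "k < 1" using \<delta>[OF that] by linarith+
      then show False by simp
    qed
    moreover have "b n = 1 / (circ (\<delta> n) - 1)"
      unfolding b_def ct_def by (rule inverse_circ_minus_1[symmetric]) (use \<delta>[OF that] in auto)
    ultimately show ?thesis by simp
  qed
  have ct0: "0 \<le> ct n" and ct1: "ct n \<le> 1 / (2 * \<mu>)" if "n \<le> K" for n
  proof -
    have r: "0 < pi * \<delta> n" "pi * \<delta> n \<le> pi / 2" using \<delta>[OF that] by (auto simp: field_simps)
    then show "0 \<le> ct n" using cos_ge_zero[of "pi * \<delta> n"] sin_gt_zero[of "pi * \<delta> n"] pi_gt_zero
      by (auto simp: ct_def cot_def intro!: divide_nonneg_pos)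
    have "ct n \<le> 1 / (pi * \<delta> n)" unfolding ct_def using r pi_gt_zero by (intro cot_le_inverse) linarith+
    also have "\<dots> \<le> 1 / (2 * \<mu>)"
      using \<delta>[OF that] \<mu> pi_gt3 by (intro divide_left_mono mult_mono) auto
    finally show "ct n \<le> 1 / (2 * \<mu>)" .
  qed
  have ct_mono: "ct n \<le> ct (Suc n)" if "Suc n \<le> K" for n
  proof -
    have "\<delta> (Suc n) \<le> \<delta> n" using anti[of n] that Suc by (simp add: \<delta>_def)
    moreover have r: "0 < pi * \<delta> (Suc n)" "pi * \<delta> n \<le> pi / 2" using \<delta>[OF that] \<delta>[of n] that by (auto simp: field_simps)
    ultimately have le: "pi * \<delta> (Suc n) \<le> pi * \<delta> n" by simp
    have pos: "0 < sin (pi * \<delta> (Suc n))" "0 < sin (pi * \<delta> n)"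
      using r le pi_gt_zero by (intro sin_gt_zero; linarith)+
    have "0 \<le> sin (pi * \<delta> n - pi * \<delta> (Suc n))"
      using r le pi_gt_zero by (intro sin_ge_zero) linarith+
    then show ?thesis using pos by (simp add: ct_def cot_def field_simps sin_diff)
  qed
  have norm_b: "norm (b n) \<le> 3 / (4 * \<mu>)" if "n \<le> K" for n
  proof -
    have "norm (b n) \<le> \<bar>- 1 / 2\<bar> + \<bar>- ct n / 2\<bar>" unfolding b_def using cmod_le[of "Complex (- 1 / 2) (- ct n / 2)"] by simp
    also have "\<dots> \<le> 1 / 2 + 1 / (4 * \<mu>)" using ct0[OF that] ct1[OF that] by simp
    also have "1 / 2 \<le> 1 / (2 * \<mu>) / (2::real)" using \<delta>[OF that] \<mu> by (simp add: field_simps)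
    finally show ?thesis using \<mu> by (simp add: field_simps)
  qed
  have tele: "(\<Sum>n<K. norm (b (Suc n) - b n)) = (ct K - ct 0) / 2"
  proof -
    have "(\<Sum>n<K. norm (b (Suc n) - b n)) = (\<Sum>n<K. (ct (Suc n) - ct n) / 2)"
    proof (intro sum.cong refl)
      fix n assume "n \<in> {..<K}"
      then have "ct n \<le> ct (Suc n)" using ct_mono by auto
      moreover have "b (Suc n) - b n = Complex 0 ((ct n - ct (Suc n)) / 2)"
        by (simp add: b_def complex_eq_iff)
      ultimately show "norm (b (Suc n) - b n) = (ct (Suc n) - ct n) / 2"
        by (simp add: cmod_def)
    qed
    also have "\<dots> = (ct K - ct 0) / 2"
      by (simp add: sum_lessThan_telescope flip: sum_divide_distrib)
    finally show ?thesis .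
  qed
  have "norm (\<Sum>n<L. circ (x n)) = norm (circ (x (Suc K)) * b K - circ (x 0) * b 0
       - (\<Sum>n<K. circ (x (Suc n)) * (b (Suc n) - b n)))"
    unfolding Suc by (subst abel_quotient_sum[where b = b]) (use z_eq in auto)
  also have "\<dots> \<le> norm (b K) + norm (b 0) + norm (\<Sum>n<K. circ (x (Suc n)) * (b (Suc n) - b n))"
    by (intro order_trans[OF norm_triangle_ineq4] add_mono order_refl) (simp_all add: norm_mult)
  also have "norm (\<Sum>n<K. circ (x (Suc n)) * (b (Suc n) - b n)) \<le> (\<Sum>n<K. norm (b (Suc n) - b n))"
    by (intro sum_norm_le) (simp add: norm_mult)
  also have "\<dots> \<le> 1 / (4 * \<mu>)" unfolding tele using ct0[of 0] ct1[of K] by simp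
  also have "norm (b K) + norm (b 0) + 1 / (4 * \<mu>) \<le> 3 / (4 * \<mu>) + 3 / (4 * \<mu>) + 1 / (4 * \<mu>)"
    by (intro add_mono norm_b) auto
  also have "\<dots> \<le> 2 / \<mu>" using \<mu> by (simp add: field_simps)
  finally show ?thesis by simp
qed

text \<open>The left-hand sum is the same for each of the \<open>H\<close> translates \<open>s m i\<close> of the sequence,
  extended by zero. Add them for fixed \<open>m\<close>; the Cauchy--Schwarz inequality in \<open>m\<close> brings in
  the autocorrelations.\<close>

lemma van_der_corput_inequality:
  fixes z :: "nat \<Rightarrow> complex" and L H :: nat
  defines "C \<equiv> \<lambda>r. \<Sum>n<L-r. z (n + r) * cnj (z n)"
  shows "(real H)\<^sup>2 * (norm (\<Sum>n<L. z n))\<^sup>2 \<le> real (L + H) * (\<Sum>i<H. \<Sum>j<H. norm (C (max i j - min i j)))"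
proof -
  define s where "s m i = (if i \<le> m \<and> m < L + i then z (m - i) else 0)" for m i
  have sum_s: "(\<Sum>m<L+H. s m i) = (\<Sum>n<L. z n)" if "i < H" for i
  proof -
    have "(\<Sum>n<L. z n) = (\<Sum>m\<in>{i..<L+i}. z (m - i))"
      by (rule sum.reindex_bij_witness[of _ "\<lambda>m. m - i" "\<lambda>n. n + i"]) auto
    also have "\<dots> = (\<Sum>m<L+H. s m i)"
      unfolding s_def using that by (intro sum.mono_neutral_cong_left) auto
    finally show ?thesis ..
  qed
  have corr: "(\<Sum>m<L+H. s m i * cnj (s m j)) = C (j - i)" if "i \<le> j" "j < H" for i j
  proof -
    have "C (j - i) = (\<Sum>m\<in>{j..<L+i}. z (m - i) * cnj (z (m - j)))"
      unfolding C_def using that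
      by (intro sum.reindex_bij_witness[of _ "\<lambda>m. m - j" "\<lambda>n. n + j"]) auto
    also have "\<dots> = (\<Sum>m<L+H. s m i * cnj (s m j))"
      unfolding s_def using that by (intro sum.mono_neutral_cong_left) auto
    finally show ?thesis ..
  qed
  have corr_norm: "norm (\<Sum>m<L+H. s m i * cnj (s m j)) = norm (C (max i j - min i j))"
    if "i < H" "j < H" for i j
  proof (cases "i \<le> j")
    case False
    then have "(\<Sum>m<L+H. s m i * cnj (s m j)) = cnj (C (i - j))"
      using corr[of j i] that by (simp flip: corr add: mult.commute)
    then show ?thesis using False by simp
  qed (use corr that in auto)
  have "of_nat H * (\<Sum>n<L. z n) = (\<Sum>i<H. \<Sum>m<L+H. s m i)"
    using sum_s by simp
  also have "\<dots> = (\<Sum>m<L+H. 1 * (\<Sum>i<H. s m i))" by (subst sum.swap) simp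
  finally have eq: "real H * norm (\<Sum>n<L. z n) = norm (\<Sum>m<L+H. 1 * (\<Sum>i<H. s m i))"
    by (metis norm_mult norm_of_nat)
  have "(real H)\<^sup>2 * (norm (\<Sum>n<L. z n))\<^sup>2 = (norm (\<Sum>m<L+H. 1 * (\<Sum>i<H. s m i)))\<^sup>2"
    unfolding eq[symmetric] by (simp add: power_mult_distrib)
  also have "\<dots> \<le> (\<Sum>m<L+H. 1 * norm (\<Sum>i<H. s m i))\<^sup>2"
    by (intro power_mono) (auto intro: order_trans[OF norm_sum])
  also have "\<dots> \<le> (\<Sum>m<L+H. 1\<^sup>2) * (\<Sum>m<L+H. (norm (\<Sum>i<H. s m i))\<^sup>2)"
    by (rule Cauchy_Schwarz_ineq_sum)
  also have "(\<Sum>m<L+H. (norm (\<Sum>i<H. s m i))\<^sup>2) \<le> (\<Sum>i<H. \<Sum>j<H. norm (C (max i j - min i j)))"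
  proof -
    have "complex_of_real (\<Sum>m<L+H. (norm (\<Sum>i<H. s m i))\<^sup>2)
        = (\<Sum>m<L+H. (\<Sum>i<H. s m i) * cnj (\<Sum>i<H. s m i))"
      unfolding of_real_sum complex_norm_square ..
    also have "\<dots> = (\<Sum>i<H. \<Sum>j<H. \<Sum>m<L+H. s m i * cnj (s m j))"
      unfolding cnj_sum sum_product by (subst sum.swap, rule sum.cong[OF refl], rule sum.swap)
    also have "norm \<dots> \<le> (\<Sum>i<H. \<Sum>j<H. norm (C (max i j - min i j)))"
      by (intro sum_norm_le) (auto simp: corr_norm)
    finally show ?thesis unfolding norm_of_real by linarith
  qed
  finally show ?thesis by (simp add: mult_left_mono)
qed

text \<open>The autocorrelations with shifts below \<open>R\<close>, for which nothing is known, are estimated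
  trivially; there are at most \<open>2 R H\<close> of them among the \<open>H\<^sup>2\<close> pairs.\<close>

lemma van_der_corput_bound:
  fixes z :: "nat \<Rightarrow> complex"
  assumes z: "\<And>n. norm (z n) \<le> 1" and H: "H \<ge> 1"
    and D: "\<And>r. R \<le> r \<Longrightarrow> r < H \<Longrightarrow> norm (\<Sum>n<L-r. z (n + r) * cnj (z n)) \<le> D"
    and D0: "D \<ge> 0"
  shows "(norm (\<Sum>n<L. z n))\<^sup>2 \<le> real (L + H) * (2 * real R * real L / real H + D)"
proof -
  define C where "C r = norm (\<Sum>n<L-r. z (n + r) * cnj (z n))" for r
  have triv: "C r \<le> real L" for r
  proof -
    have "norm (z (n + r) * cnj (z n)) \<le> 1 * 1" for n
      unfolding norm_mult using z by (intro mult_mono) auto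
    then have "C r \<le> (\<Sum>n<L-r. 1)" unfolding C_def by (intro sum_norm_le) auto
    then show ?thesis by simp
  qed
  have inner: "(\<Sum>j<H. C (max i j - min i j)) \<le> 2 * real R * real L + real H * D" if "i < H" for i
  proof -
    have "C (max i j - min i j) \<le> of_bool (j \<in> {i - R..<i + R}) * real L + D" if "j < H" for j
    proof (cases "max i j - min i j < R")
      case True
      then have "j \<in> {i - R..<i + R}" by (auto simp: max_def min_def split: if_splits)
      then show ?thesis using triv[of "max i j - min i j"] D0 by simp
    next
      case False
      then have "C (max i j - min i j) \<le> D" unfolding C_def using that \<open>i < H\<close> by (intro D) auto
      then show ?thesis by (simp add: add_increasing)
    qed
    then have "(\<Sum>j<H. C (max i j - min i j)) \<le> (\<Sum>j<H. of_bool (j \<in> {i - R..<i + R}) * real L + D)"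
      by (intro sum_mono) auto
    also have "\<dots> = real (card ({..<H} \<inter> {i - R..<i + R})) * real L + real H * D"
      by (simp add: sum.distrib Int_def flip: sum_distrib_right)
    also have "card ({..<H} \<inter> {i - R..<i + R}) \<le> card {i - R..<i + R}" by (intro card_mono) auto
    then have "real (card ({..<H} \<inter> {i - R..<i + R})) \<le> 2 * real R" by simp
    finally show ?thesis by (simp add: mult_right_mono)
  qed
  have "(real H)\<^sup>2 * (norm (\<Sum>n<L. z n))\<^sup>2 \<le> real (L + H) * (\<Sum>i<H. \<Sum>j<H. C (max i j - min i j))"
    unfolding C_def by (rule van_der_corput_inequality)
  also have "\<dots> \<le> real (L + H) * (\<Sum>i<H. 2 * real R * real L + real H * D)"
    by (intro mult_left_mono sum_mono inner) auto
  also have "\<dots> = (real H)\<^sup>2 * (real (L + H) * (2 * real R * real L / real H + D))"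
    using H by (simp add: power2_eq_square field_simps)
  finally show ?thesis using H by simp
qed

lemma van_der_corput_null_mean:
  fixes z :: "nat \<Rightarrow> complex"
  assumes z: "\<And>n. norm (z n) \<le> 1" and corr: "\<And>r. r \<ge> 1 \<Longrightarrow> null_mean0 (\<lambda>n. z (n + r) * cnj (z n))"
  shows "null_mean0 z"
  unfolding null_mean0_iff_norm
proof (rule LIMSEQ_I)
  fix e :: real assume e: "e > 0"
  define H where "H = nat \<lceil>4 / e\<^sup>2\<rceil> + 1"
  have H: "2 / real H < e\<^sup>2" "H \<ge> 1"
  proof -
    have "4 / e\<^sup>2 < real H" unfolding H_def by linarith
    then have "4 < real H * e\<^sup>2" using e by (simp add: pos_divide_less_eq)
    moreover have "H > 0" by (simp add: H_def)
    ultimately show "2 / real H < e\<^sup>2" by (simp add: pos_divide_less_eq mult.commute)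
  qed (simp add: H_def)
  define C where "C r N = (\<Sum>n<N-r. z (n + r) * cnj (z n))" for r N
  have C: "(\<lambda>N. norm (C r N) / real N) \<longlonglongrightarrow> 0" if "r \<ge> 1" for r
  proof -
    have "norm (C r N) / real N \<le> norm (\<Sum>n<N. z (n + r) * cnj (z n)) / real N + real r / real N" for N
    proof -
      have n1: "norm (z (n + r) * cnj (z n)) \<le> 1" for n
        unfolding norm_mult complex_mod_cnj by (intro mult_le_one z norm_ge_zero)
      have "(\<Sum>n<N. z (n + r) * cnj (z n)) = (\<Sum>n\<in>{..<N-r} \<union> {N-r..<N}. z (n + r) * cnj (z n))"
        by (rule sum.cong) auto
      also have "\<dots> = C r N + (\<Sum>n\<in>{N-r..<N}. z (n + r) * cnj (z n))"
        unfolding C_def by (rule sum.union_disjoint) auto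
      finally have "(\<Sum>n<N. z (n + r) * cnj (z n)) = C r N + (\<Sum>n\<in>{N-r..<N}. z (n + r) * cnj (z n))" .
      moreover have "norm (\<Sum>n\<in>{N-r..<N}. z (n + r) * cnj (z n)) \<le> (\<Sum>n\<in>{N-r..<N}. 1)"
        by (intro sum_norm_le n1)
      moreover have "(\<Sum>n\<in>{N-r..<N}. 1) \<le> real r" by simp
      ultimately have "norm (C r N) \<le> norm (\<Sum>n<N. z (n + r) * cnj (z n)) + real r"
        using norm_triangle_ineq4[of "\<Sum>n<N. z (n + r) * cnj (z n)" "\<Sum>n\<in>{N-r..<N}. z (n + r) * cnj (z n)"]
        by simp
      then have "norm (C r N) / real N \<le> (norm (\<Sum>n<N. z (n + r) * cnj (z n)) + real r) / real N"
        by (rule divide_right_mono) simp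
      then show ?thesis by (simp only: add_divide_distrib)
    qed
    moreover have "(\<lambda>N. norm (\<Sum>n<N. z (n + r) * cnj (z n)) / real N + real r / real N) \<longlonglongrightarrow> 0 + 0"
      by (rule tendsto_add[OF corr[OF that, unfolded null_mean0_iff_norm] lim_const_over_n])
    ultimately show ?thesis
      by - (rule Lim_null_comparison[where g = "\<lambda>N. norm (\<Sum>n<N. z (n + r) * cnj (z n)) / real N + real r / real N"],
         auto)
  qed
  define B where "B N = (1 + real H / real N) * (2 / real H + (\<Sum>r=1..<H. norm (C r N) / real N))" for N
  have "(\<lambda>N. \<Sum>r=1..<H. norm (C r N) / real N) \<longlonglongrightarrow> (\<Sum>r=1..<H. 0)"
    by (rule tendsto_sum) (rule C, simp)
  then have "B \<longlonglongrightarrow> (1 + 0) * (2 / real H + (\<Sum>r=1..<H. 0))"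
    unfolding B_def
    by (rule tendsto_mult[OF tendsto_add[OF tendsto_const lim_const_over_n] tendsto_add[OF tendsto_const]])
  then have "\<forall>\<^sub>F N in sequentially. B N < e\<^sup>2"
    by (rule order_tendstoD) (use H in simp)
  then have "\<forall>\<^sub>F N in sequentially. norm (norm (\<Sum>n<N. z n) / real N - 0) < e"
    using eventually_gt_at_top[of 0]
  proof eventually_elim
    case (elim N)
    have "(norm (\<Sum>n<N. z n))\<^sup>2 \<le> real (N + H) * (2 * real 1 * real N / real H + (\<Sum>r=1..<H. norm (C r N)))"
    proof (rule van_der_corput_bound[OF z \<open>H \<ge> 1\<close>])
      fix r assume "1 \<le> r" "r < H"
      then show "norm (\<Sum>n<N - r. z (n + r) * cnj (z n)) \<le> (\<Sum>r=1..<H. norm (C r N))"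
        unfolding C_def[symmetric] by (intro member_le_sum) auto
    qed (auto intro: sum_nonneg)
    also have "\<dots> = (real N)\<^sup>2 * B N"
    proof -
      have "real (N + H) = real N * (1 + real H / real N)" using elim by (simp add: field_simps)
      moreover have "2 * real 1 * real N / real H + (\<Sum>r=1..<H. norm (C r N))
          = real N * (2 / real H + (\<Sum>r=1..<H. norm (C r N) / real N))"
        using elim by (simp add: distrib_left sum_distrib_left)
      ultimately show ?thesis by (simp only: B_def power2_eq_square mult_ac)
    qed
    also have "\<dots> < (real N)\<^sup>2 * e\<^sup>2" by (intro mult_strict_left_mono) (use elim in auto)
    finally have "(norm (\<Sum>n<N. z n))\<^sup>2 < (real N * e)\<^sup>2" by (simp only: power_mult_distrib)
    then have "norm (\<Sum>n<N. z n) < real N * e" by (rule power_less_imp_less_base) (use e in simp)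
    then show ?case using elim by (simp add: pos_divide_less_eq mult.commute)
  qed
  then show "\<exists>no. \<forall>N\<ge>no. norm (norm (\<Sum>n<N. z n) / real N - 0) < e"
    by (simp add: eventually_sequentially)
qed

text \<open>Decay slower than \<open>1/n\<^sup>2\<close>, in a form that survives summation over a fixed number of
  shifts. The last condition is a weak monotonicity of \<open>n\<^sup>2 y n\<close>; the constant \<open>C\<close> absorbs
  the difference between a derivative and a finite difference.\<close>

definition slowly_decaying :: "(nat \<Rightarrow> real) \<Rightarrow> bool" where
  "slowly_decaying y \<longleftrightarrow> y \<longlonglongrightarrow> 0 \<and> filterlim (\<lambda>n. (real n)\<^sup>2 * y n) at_top sequentially \<and>
     (\<exists>n0 C. C \<ge> 1 \<and> (\<forall>n\<ge>n0. y (Suc n) \<le> y n) \<and>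
        (\<forall>m n. n0 \<le> m \<longrightarrow> m \<le> n \<longrightarrow> (real m)\<^sup>2 * y m \<le> C * ((real n)\<^sup>2 * y n)))"

text \<open>After differencing with a shift \<open>r\<close>, the phase has monotone increments between \<open>R y\<^sub>N\<close> and
  \<open>H y\<^sub>M\<close>, as increments of the differenced sequence are sums of \<open>r\<close> second differences. If
  the upper bound is at most \<open>1/2\<close>, the Kusmin--Landau inequality applies.\<close>

lemma second_difference_window:
  fixes x :: "nat \<Rightarrow> real"
  defines "y \<equiv> \<lambda>n. x (n + 2) - 2 * x (n + 1) + x n"
  assumes anti: "\<And>n. n \<ge> M \<Longrightarrow> y (Suc n) \<le> y n"
    and MN: "M \<le> N" and pos: "y N > 0" and H: "1 \<le> H" "H \<le> N" "real H * y M \<le> 1 / 2"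
    and R: "R \<ge> 1"
  shows "(norm (\<Sum>n\<in>{M..<N}. circ (x n)))\<^sup>2 \<le> 2 * real N * (2 * real R * real N / real H + 2 / (real R * y N))"
proof -
  define z where "z n = circ (x (M + n))" for n
  define L where "L = N - M"
  have y_mono: "y n \<le> y m" if "M \<le> m" "m \<le> n" for m n
    using that(2) by (induction n rule: dec_induct) (use that(1) anti order_trans in \<open>auto intro: order_trans\<close>)
  have sum_eq: "(\<Sum>n\<in>{M..<N}. circ (x n)) = (\<Sum>n<L. z n)"
    unfolding z_def L_def
    by (rule sum.reindex_bij_witness[of _ "\<lambda>n. M + n" "\<lambda>n. n - M"]) (use MN in auto)
  have corr: "norm (\<Sum>n<L-r. z (n + r) * cnj (z n)) \<le> 2 / (real R * y N)" if r: "R \<le> r" "r < H" for r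
  proof -
    define \<phi> where "\<phi> n = x (M + n + r) - x (M + n)" for n
    have d: "\<phi> (Suc n) - \<phi> n = (\<Sum>i<r. y (M + n + i))" for n
    proof -
      have "(\<Sum>i<r. y (M + n + i)) = (\<Sum>i<r. (x (M + n + Suc i + 1) - x (M + n + Suc i)) - (x (M + n + i + 1) - x (M + n + i)))"
        by (intro sum.cong) (auto simp: y_def)
      also have "\<dots> = (x (M + n + r + 1) - x (M + n + r)) - (x (M + n + 1) - x (M + n))"
        by (subst sum_lessThan_telescope[where f = "\<lambda>i. x (M + n + i + 1) - x (M + n + i)"]) simp
      finally show ?thesis by (simp add: \<phi>_def)
    qed
    have "norm (\<Sum>n<L-r. circ (\<phi> n)) \<le> 2 / (real R * y N)"
    proof (rule kusmin_landau)
      fix n assume n: "n < L - r"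
      have "real R * y N \<le> real r * y N" using r pos by simp
      also have "\<dots> = (\<Sum>i<r. y N)" by simp
      also have "\<dots> \<le> (\<Sum>i<r. y (M + n + i))"
        using n by (intro sum_mono y_mono) (auto simp: L_def)
      finally show "real R * y N \<le> \<phi> (Suc n) - \<phi> n" unfolding d .
      have "(\<Sum>i<r. y (M + n + i)) \<le> (\<Sum>i<r. y M)" by (intro sum_mono y_mono) auto
      also have "\<dots> = real r * y M" by simp
      also have "\<dots> \<le> real H * y M" using r y_mono[of M N] MN pos by (intro mult_right_mono) auto
      finally show "\<phi> (Suc n) - \<phi> n \<le> 1 / 2" unfolding d using H by simp
    next
      fix n
      show "\<phi> (Suc (Suc n)) - \<phi> (Suc n) \<le> \<phi> (Suc n) - \<phi> n"
        unfolding d by (intro sum_mono y_mono) auto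
    qed (use R pos in auto)
    moreover have "z (n + r) * cnj (z n) = circ (\<phi> n)" for n
      by (simp add: z_def \<phi>_def circ_diff add.assoc)
    ultimately show ?thesis by simp
  qed
  have "(norm (\<Sum>n<L. z n))\<^sup>2 \<le> real (L + H) * (2 * real R * real L / real H + 2 / (real R * y N))"
    by (rule van_der_corput_bound) (use corr H R pos in \<open>auto simp: z_def\<close>)
  also have "\<dots> \<le> (2 * real N) * (2 * real R * real N / real H + 2 / (real R * y N))"
    using H R pos by (intro mult_mono add_mono divide_right_mono) (auto simp: L_def)
  finally show ?thesis unfolding sum_eq .
qed

text \<open>On a window from \<open>M = k N\<close> to \<open>N\<close> the second difference varies between \<open>y\<^sub>N\<close> and \<open>y\<^sub>M\<close>,
  which are comparable because \<open>n\<^sup>2 y\<^sub>n\<close> is essentially increasing. Take the longest shifts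
  \<open>H\<close> with \<open>H \<le> k N\<close> and \<open>H y\<^sub>M \<le> 1/2\<close>, and \<open>R\<close> about \<open>k H\<close>. Then the two terms of the
  window estimate are \<open>O(k N)\<close>: the first by the choice of \<open>R\<close>, the second because \<open>H N y\<^sub>N\<close>
  tends to infinity. For \<open>H = k N\<close> this is \<open>n\<^sup>2 y\<^sub>n \<rightarrow> \<infinity>\<close>, and for \<open>H = 1 / (2 y\<^sub>M)\<close> it
  follows from the comparability of \<open>y\<^sub>M\<close> and \<open>y\<^sub>N\<close>.\<close>

lemma second_difference_test:
  fixes x :: "nat \<Rightarrow> real"
  assumes "slowly_decaying (\<lambda>n. x (n + 2) - 2 * x (n + 1) + x n)"
  shows "null_mean0 (\<lambda>n. circ (x n))"
  unfolding null_mean0_iff_norm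
proof (rule LIMSEQ_I)
  define y where "y n = x (n + 2) - 2 * x (n + 1) + x n" for n
  note sd = assms[unfolded slowly_decaying_def, folded y_def]
  have lim: "y \<longlonglongrightarrow> 0" and large: "filterlim (\<lambda>n. (real n)\<^sup>2 * y n) at_top sequentially"
    using sd by blast+
  obtain n0 C where C: "C \<ge> 1" and anti: "\<And>n. n \<ge> n0 \<Longrightarrow> y (Suc n) \<le> y n"
    and reg: "\<And>m n. n0 \<le> m \<Longrightarrow> m \<le> n \<Longrightarrow> (real m)\<^sup>2 * y m \<le> C * ((real n)\<^sup>2 * y n)"
    using sd by blast
  fix e :: real assume e: "e > 0"
  \<comment> \<open>the mean will be at most \<open>k + \<surd>(10 k) \<le> e / 4 + e / 2\<close>\<close>
  define k where "k = min (1 / 2) (min (e / 4) (e\<^sup>2 / 64))"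
  have k: "k > 0" "k \<le> 1 / 2" "k \<le> e / 4" "k \<le> e\<^sup>2 / 64" using e by (auto simp: k_def)
  define M where "M N = nat \<lfloor>k * real N\<rfloor>" for N
  have M_le: "real (M N) \<le> k * real N" for N using k by (simp add: M_def)
  have M_ge: "real (M N) \<ge> k * real N - 1" for N using k unfolding M_def by linarith
  have M_top: "filterlim M sequentially sequentially"
  proof -
    have "filterlim (\<lambda>N. k * real N) at_top sequentially"
      by (rule filterlim_tendsto_pos_mult_at_top[OF tendsto_const k(1) filterlim_real_sequentially])
    then show ?thesis unfolding M_def
      by (intro filterlim_compose[OF filterlim_nat_sequentially] filterlim_compose[OF filterlim_floor_sequentially])
  qed
  define B where "B = 32 * C / k ^ 4"
  have B0: "B > 0" using C k by (simp add: B_def)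
  have "\<forall>\<^sub>F N in sequentially. N > 0 \<and> M N \<ge> n0 \<and> y (M N) \<le> k / 8 \<and> y (M N) > 0 \<and> y N > 0
     \<and> k * real N \<ge> 8 / k \<and> (real N)\<^sup>2 * y N \<ge> B \<and> real N \<ge> B"
  proof (intro eventually_conj)
    show "\<forall>\<^sub>F N in sequentially. N > 0" by (rule eventually_gt_at_top)
    show "\<forall>\<^sub>F N in sequentially. M N \<ge> n0" using M_top by (simp add: filterlim_at_top)
    have "\<forall>\<^sub>F n in sequentially. y n \<le> k / 8" using order_tendstoD(2)[OF lim, of "k / 8"] k
      by (auto elim: eventually_mono)
    then show "\<forall>\<^sub>F N in sequentially. y (M N) \<le> k / 8" by (rule eventually_compose_filterlim[OF _ M_top])
    have "\<forall>\<^sub>F n in sequentially. (real n)\<^sup>2 * y n \<ge> 1" using large by (simp add: filterlim_at_top)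
    then have "\<forall>\<^sub>F n in sequentially. y n > 0"
    proof eventually_elim
      case (elim n)
      then have "(real n)\<^sup>2 * y n > 0" by linarith
      then show ?case using zero_less_mult_pos[of "(real n)\<^sup>2" "y n"] by (cases "n = 0") auto
    qed
    then show "\<forall>\<^sub>F N in sequentially. y (M N) > 0" "\<forall>\<^sub>F N in sequentially. y N > 0"
      by (rule eventually_compose_filterlim[OF _ M_top], assumption)
    show "\<forall>\<^sub>F N in sequentially. (real N)\<^sup>2 * y N \<ge> B" using large by (simp add: filterlim_at_top)
    show "\<forall>\<^sub>F N in sequentially. real N \<ge> B" using filterlim_real_sequentially by (simp add: filterlim_at_top)
    have "\<forall>\<^sub>F N in sequentially. real N \<ge> 8 / k / k" using filterlim_real_sequentially by (simp add: filterlim_at_top)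
    then show "\<forall>\<^sub>F N in sequentially. k * real N \<ge> 8 / k"
      by eventually_elim (use k in \<open>simp add: field_simps\<close>)
  qed
  then have "\<forall>\<^sub>F N in sequentially. norm (norm (\<Sum>n<N. circ (x n)) / real N - 0) < e"
  proof eventually_elim
    case (elim N)
    define l l' where "l = y N" and "l' = y (M N)"
    define g where "g = min (k * real N) (1 / (2 * l'))"
    define H where "H = nat \<lfloor>g\<rfloor>"
    define R where "R = nat \<lceil>k * real H\<rceil>"
    have N0: "real N > 0" using elim by simp
    have l: "l > 0" "l' > 0" "l' \<le> k / 8" using elim by (auto simp: l_def l'_def)
    have g4: "g \<ge> 4 / k"
    proof -
      have "4 / k \<le> 1 / (2 * l')" using l k by (simp add: field_simps)
      moreover have "4 / k \<le> 8 / k" using k by (simp add: divide_right_mono)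
      ultimately show ?thesis using elim by (auto simp: g_def)
    qed
    have "4 / k \<ge> 8" using k by (simp add: field_simps)
    then have g8: "g \<ge> 8" using g4 by linarith
    have H: "real H \<le> g" "real H \<ge> g / 2" "real H \<ge> 1" using g8 unfolding H_def by linarith+
    have R: "R \<ge> 1" "real R \<ge> k * real H" "real R \<le> k * real H + 1"
    proof -
      have "k * real H > 0" using k H by simp
      then show "R \<ge> 1" "real R \<ge> k * real H" "real R \<le> k * real H + 1" unfolding R_def by linarith+
    qed
    have kN: "k * real N \<le> real N" using k by (simp add: mult_left_le_one_le)
    have "real H \<le> real N" using H kN by (simp add: g_def)
    moreover have "real H * l' \<le> 1 / 2"
    proof -
      have "real H * l' \<le> 1 / (2 * l') * l'" using H l by (intro mult_right_mono) (auto simp: g_def)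
      then show ?thesis using l by simp
    qed
    moreover have "real (M N) \<le> real N" using M_le[of N] kN by linarith
    ultimately have win: "(norm (\<Sum>n\<in>{M N..<N}. circ (x n)))\<^sup>2 \<le> 2 * real N * (2 * real R * real N / real H + 2 / (real R * l))"
      unfolding l_def y_def using elim anti H R
      by (intro second_difference_window) (auto simp: l'_def y_def)
    have 1: "2 * real R * real N / real H \<le> 4 * k * real N"
    proof -
      have "1 \<le> k * real H"
      proof -
        have "k * (g / 2) \<le> k * real H" using H(2) k by (intro mult_left_mono) auto
        moreover have "k * (4 / k) \<le> k * g" using g4 k by (intro mult_left_mono) auto
        moreover have "k * (4 / k) = 4" using k by simp
        ultimately show ?thesis by linarith
      qed
      then have "real R \<le> 2 * k * real H" using R by linarith
      then have "2 * real R * real N \<le> 2 * (2 * k * real H) * real N" by (intro mult_right_mono mult_left_mono) auto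
      then show ?thesis using H by (simp add: field_simps)
    qed
    have 2: "2 / (real R * l) \<le> k * real N"
    proof -
      have "real H * real N * l \<ge> 2 / k ^ 2"
      proof -
        have A: "k * real N * real N * l \<ge> 4 / k ^ 2"
        proof -
          have "k * real N * real N * l = k * ((real N)\<^sup>2 * l)" by (simp add: power2_eq_square)
          also have "\<dots> \<ge> k * B" using elim k by (intro mult_left_mono) (auto simp: l_def)
          also have "k * B = 32 * C / k ^ 3" using k by (simp add: B_def field_simps power_numeral_reduce)
          finally have "k * real N * real N * l \<ge> 32 * C / k ^ 3" .
          moreover have "32 * C / k ^ 3 \<ge> 8 * C / k ^ 3" using k C by (intro divide_right_mono) auto
          moreover have "8 * C / k ^ 3 \<ge> 4 / k ^ 2"
          proof -
            have "4 * k ^ 3 \<le> 8 * C * k ^ 2"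
            proof -
              have "k ^ 3 = k * k ^ 2" by (simp add: power_numeral_reduce)
              moreover have "4 * k \<le> 8 * C" using k C by linarith
              ultimately show ?thesis using mult_right_mono[of "4 * k" "8 * C" "k ^ 2"] by simp
            qed
            then show ?thesis using k by (simp add: field_simps)
          qed
          ultimately show ?thesis by linarith
        qed
        have B: "1 / (2 * l') * real N * l \<ge> 4 / k ^ 2"
        proof -
          have "real (M N) \<ge> k * real N / 2"
          proof -
            have "k * real N \<ge> 8" using elim k \<open>4 / k \<ge> 8\<close> by (smt (verit) divide_right_mono)
            then show ?thesis using M_ge[of N] by linarith
          qed
          then have "(k * real N / 2)\<^sup>2 * l' \<le> (real (M N))\<^sup>2 * l'"
            using k l by (intro mult_right_mono power_mono) auto
          also have "\<dots> \<le> C * ((real N)\<^sup>2 * l)"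
            unfolding l_def l'_def using elim \<open>real (M N) \<le> real N\<close> by (intro reg) auto
          finally have "k ^ 2 / 4 * l' * (real N)\<^sup>2 \<le> C * l * (real N)\<^sup>2"
            by (simp add: power_mult_distrib power_divide mult_ac)
          then have "k ^ 2 / 4 * l' \<le> C * l" using N0 by simp
          then have q: "k ^ 2 / (8 * C) \<le> 1 / (2 * l') * l" using l C by (simp add: field_simps)
          have "4 / k ^ 2 = k ^ 2 / (8 * C) * (32 * C / k ^ 4)" using k C by (simp add: field_simps power_numeral_reduce)
          also have "\<dots> \<le> (1 / (2 * l') * l) * real N"
          proof (intro mult_mono q)
            show "32 * C / k ^ 4 \<le> real N" using elim by (simp add: B_def)
          qed (use l C k in auto)
          finally show ?thesis by (simp add: mult_ac)
        qed
        have "2 / k ^ 2 \<le> g / 2 * (real N * l)"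
          using A B unfolding g_def min_def by (auto simp: mult_ac)
        also have "\<dots> \<le> real H * (real N * l)" using H l N0 by (intro mult_right_mono) auto
        finally show ?thesis by (simp add: mult_ac)
      qed
      then have "2 \<le> k ^ 2 * (real H * real N * l)" using k by (simp add: field_simps)
      also have "\<dots> = k * real N * ((k * real H) * l)" by (simp add: power2_eq_square)
      also have "\<dots> \<le> k * real N * (real R * l)" using R l k by (intro mult_left_mono mult_right_mono) auto
      finally show ?thesis using R l by (simp add: field_simps)
    qed
    have "(norm (\<Sum>n\<in>{M N..<N}. circ (x n)))\<^sup>2 \<le> 2 * real N * (4 * k * real N + k * real N)"
      by (rule order_trans[OF win mult_left_mono[OF add_mono[OF 1 2]]]) simp
    also have "\<dots> = 10 * k * (real N)\<^sup>2" by (simp add: power2_eq_square)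
    also have "\<dots> \<le> (e / 2 * real N)\<^sup>2"
    proof -
      have "10 * k \<le> (e / 2)\<^sup>2" using k by (simp add: power_divide)
      then show ?thesis unfolding power_mult_distrib by (intro mult_right_mono) auto
    qed
    finally have "norm (\<Sum>n\<in>{M N..<N}. circ (x n)) \<le> e / 2 * real N"
      by (rule power2_le_imp_le) (use e in simp)
    moreover have "norm (\<Sum>n<M N. circ (x n)) \<le> e / 4 * real N"
    proof -
      have "norm (\<Sum>n<M N. circ (x n)) \<le> (\<Sum>n<M N. 1)" by (intro sum_norm_le) auto
      also have "\<dots> = real (M N)" by simp
      also have "\<dots> \<le> k * real N" by (rule M_le)
      also have "\<dots> \<le> e / 4 * real N" using k(3) by (rule mult_right_mono) simp
      finally show ?thesis .
    qed
    moreover have "(\<Sum>n<N. circ (x n)) = (\<Sum>n<M N. circ (x n)) + (\<Sum>n\<in>{M N..<N}. circ (x n))"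
      using \<open>real (M N) \<le> real N\<close> by (simp add: sum.atLeastLessThan_concat lessThan_atLeast0)
    ultimately have "norm (\<Sum>n<N. circ (x n)) \<le> e / 4 * real N + e / 2 * real N"
      using norm_triangle_ineq[of "\<Sum>n<M N. circ (x n)" "\<Sum>n\<in>{M N..<N}. circ (x n)"] by simp
    also have "\<dots> < e * real N" using e N0 by simp
    finally show ?case using N0 by (simp add: pos_divide_less_eq)
  qed
  then show "\<exists>no. \<forall>N\<ge>no. norm (norm (\<Sum>n<N. circ (x n)) / real N - 0) < e"
    by (simp add: eventually_sequentially)
qed

definition fwd_diff :: "(nat \<Rightarrow> real) \<Rightarrow> nat \<Rightarrow> real" where
  "fwd_diff x n = x (Suc n) - x n"

lemma fwd_diff_shift_diff:
  "(fwd_diff ^^ k) (\<lambda>n. x (n + r) - x n) n = (fwd_diff ^^ k) x (n + r) - (fwd_diff ^^ k) x n"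
  by (induction k arbitrary: n) (simp_all add: fwd_diff_def)

lemma shift_diff_eq_sum: "x (n + r) - x n = (\<Sum>i<r. fwd_diff x (n + i))"
  by (induction r) (simp_all add: fwd_diff_def)

lemma higher_diff_of_shift:
  "(fwd_diff ^^ k) (\<lambda>n. x (n + r) - x n) n = (\<Sum>i<r. (fwd_diff ^^ Suc k) x (n + i))"
  unfolding fwd_diff_shift_diff using shift_diff_eq_sum[of "(fwd_diff ^^ k) x"] by simp

lemma slowly_decaying_shifted_sum:
  assumes "slowly_decaying y" "r \<ge> 1"
  shows "slowly_decaying (\<lambda>n. \<Sum>i<r. y (n + i))"
proof -
  have lim: "y \<longlonglongrightarrow> 0" and large: "filterlim (\<lambda>n. (real n)\<^sup>2 * y n) at_top sequentially"
    using assms(1) unfolding slowly_decaying_def by blast+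
  obtain n0 C where C: "C \<ge> 1" and anti: "\<And>n. n \<ge> n0 \<Longrightarrow> y (Suc n) \<le> y n"
    and reg: "\<And>m n. n0 \<le> m \<Longrightarrow> m \<le> n \<Longrightarrow> (real m)\<^sup>2 * y m \<le> C * ((real n)\<^sup>2 * y n)"
    using assms(1) unfolding slowly_decaying_def by blast
  have y_mono: "y n \<le> y m" if "n0 \<le> m" "m \<le> n" for m n
    using that(2) by (induction n rule: dec_induct) (use that(1) anti order_trans in \<open>auto intro: order_trans\<close>)
  have y_nonneg: "y n \<ge> 0" if "n \<ge> n0" for n
  proof (rule LIMSEQ_le_const2[OF lim])
    show "\<exists>N. \<forall>m\<ge>N. y m \<le> y n" using y_mono[OF that] by auto
  qed
  have 1: "(\<lambda>n. \<Sum>i<r. y (n + i)) \<longlonglongrightarrow> 0"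
    using tendsto_sum[of "{..<r}" "\<lambda>i n. y (n + i)" "\<lambda>_. 0"] LIMSEQ_ignore_initial_segment[OF lim] by simp
  have 2: "filterlim (\<lambda>n. (real n)\<^sup>2 * (\<Sum>i<r. y (n + i))) at_top sequentially"
  proof (rule filterlim_at_top_mono[OF large])
    show "\<forall>\<^sub>F n in sequentially. (real n)\<^sup>2 * y n \<le> (real n)\<^sup>2 * (\<Sum>i<r. y (n + i))"
      using eventually_ge_at_top[of n0]
    proof eventually_elim
      case (elim n)
      have "y (n + 0) \<le> (\<Sum>i<r. y (n + i))"
        by (rule member_le_sum) (use assms(2) elim y_nonneg in auto)
      then show ?case by (intro mult_left_mono) auto
    qed
  qed
  have 3: "(real m)\<^sup>2 * (\<Sum>i<r. y (m + i)) \<le> C * (real r + 1)\<^sup>2 * ((real n)\<^sup>2 * (\<Sum>i<r. y (n + i)))"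
    if mn: "Suc n0 \<le> m" "m \<le> n" for m n
  proof -
    have "(real m)\<^sup>2 * y (m + i) \<le> C * (real r + 1)\<^sup>2 * ((real n)\<^sup>2 * y (n + i))" if "i < r" for i
    proof -
      have "(real m)\<^sup>2 * y (m + i) \<le> (real (m + i))\<^sup>2 * y (m + i)"
        using y_nonneg[of "m + i"] mn by (intro mult_right_mono power_mono) auto
      also have "\<dots> \<le> C * ((real (n + i))\<^sup>2 * y (n + i))" using mn by (intro reg) auto
      also have "\<dots> \<le> C * (((real r + 1) * real n)\<^sup>2 * y (n + i))"
      proof (intro mult_left_mono mult_right_mono power_mono)
        have "real i * 1 \<le> real r * real n" using that mn by (intro mult_mono) auto
        then show "real (n + i) \<le> (real r + 1) * real n" by (simp add: algebra_simps)
      qed (use C y_nonneg mn in auto)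
      finally show ?thesis by (simp add: power_mult_distrib mult_ac)
    qed
    then have "(\<Sum>i<r. (real m)\<^sup>2 * y (m + i)) \<le> (\<Sum>i<r. C * (real r + 1)\<^sup>2 * ((real n)\<^sup>2 * y (n + i)))"
      by (intro sum_mono) auto
    then show ?thesis by (simp only: sum_distrib_left)
  qed
  have 4: "(\<Sum>i<r. y (Suc n + i)) \<le> (\<Sum>i<r. y (n + i))" if "n \<ge> n0" for n
    using that by (intro sum_mono y_mono) auto
  have "C * (real r + 1)\<^sup>2 \<ge> 1 * 1" using C by (intro mult_mono one_le_power) auto
  then show ?thesis unfolding slowly_decaying_def using 1 2 3 4
    by (intro conjI exI[of _ "Suc n0"] exI[of _ "C * (real r + 1)\<^sup>2"]) auto
qed

text \<open>Van der Corput's inequality with fixed shifts lowers the order of the difference by one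
  until the second difference is reached.\<close>

theorem null_mean_slowly_decaying_difference:
  assumes "slowly_decaying ((fwd_diff ^^ (k + 2)) x)"
  shows "null_mean0 (\<lambda>n. circ (x n))"
  using assms
proof (induction k arbitrary: x)
  case 0
  have "(fwd_diff ^^ (0 + 2)) x = (\<lambda>n. x (n + 2) - 2 * x (n + 1) + x n)"
    by (simp add: numeral_2_eq_2 fwd_diff_def fun_eq_iff)
  with 0 show ?case by (intro second_difference_test) simp
next
  case (Suc k)
  show ?case
  proof (rule van_der_corput_null_mean)
    fix r :: nat assume r: "r \<ge> 1"
    have "(fwd_diff ^^ (k + 2)) (\<lambda>n. x (n + r) - x n) = (\<lambda>n. \<Sum>i<r. (fwd_diff ^^ (Suc k + 2)) x (n + i))"
      unfolding higher_diff_of_shift[abs_def] by simp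
    then have "slowly_decaying ((fwd_diff ^^ (k + 2)) (\<lambda>n. x (n + r) - x n))"
      using slowly_decaying_shifted_sum[OF Suc.prems r] by (simp only:)
    from Suc.IH[OF this] show "null_mean0 (\<lambda>n. circ (x (n + r)) * cnj (circ (x n)))"
      by (simp only: circ_diff)
  qed simp
qed

lemma null_mean0_of_null:
  assumes "w \<longlonglongrightarrow> 0"
  shows "null_mean0 w"
  unfolding null_mean0_iff_norm
proof (rule LIMSEQ_I)
  fix e :: real assume e: "e > 0"
  obtain N0 where N0: "\<And>n. n \<ge> N0 \<Longrightarrow> norm (w n) < e / 2"
    using LIMSEQ_D[OF assms, of "e / 2"] e by auto
  define K where "K = (\<Sum>n<N0. norm (w n))"
  have "norm (norm (\<Sum>n<N. w n) / real N - 0) < e" if N: "N \<ge> N0" "N > 0" "real N > 2 * K / e" for N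
  proof -
    have "(\<Sum>n<N. norm (w n)) = K + (\<Sum>n\<in>{N0..<N}. norm (w n))"
      unfolding K_def lessThan_atLeast0 using N by (intro sum.atLeastLessThan_concat[symmetric]) auto
    also have "(\<Sum>n\<in>{N0..<N}. norm (w n)) \<le> (\<Sum>n\<in>{N0..<N}. e / 2)"
      using N0 by (intro sum_mono) (auto intro: less_imp_le)
    also have "\<dots> \<le> real N * (e / 2)" using e by (simp add: mult_right_mono)
    finally have "norm (\<Sum>n<N. w n) \<le> K + real N * (e / 2)" using norm_sum[of w "{..<N}"] by simp
    also have "K < real N * (e / 2)" using N(3) e by (simp add: field_simps)
    also have "real N * (e / 2) + real N * (e / 2) = e * real N" by simp
    finally have "norm (\<Sum>n<N. w n) < e * real N" by simp
    then show ?thesis using N by (simp add: pos_divide_less_eq)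
  qed
  moreover obtain N1 where "real N1 > 2 * K / e" using reals_Archimedean2 by blast
  ultimately show "\<exists>no. \<forall>N\<ge>no. norm (norm (\<Sum>n<N. w n) / real N - 0) < e"
    by (intro exI[of _ "N0 + N1 + 1"]) (auto intro: less_le_trans)
qed

text \<open>If the first difference tends to \<open>\<theta>\<close>, then \<open>e(x (Suc n)) - e(\<theta>) e(x n)\<close> tends to \<open>0\<close>;
  summing over \<open>n\<close>, the mean of \<open>e(x n)\<close> is multiplied by \<open>1 - e(\<theta>) \<noteq> 0\<close> and the result is
  null. Each differencing step replaces \<open>\<theta>\<close> by an integer multiple, which stays irrational.\<close>

theorem null_mean_irrational_difference:
  assumes "(fwd_diff ^^ Suc k) x \<longlonglongrightarrow> \<theta>" "\<theta> \<notin> \<rat>"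
  shows "null_mean0 (\<lambda>n. circ (x n))"
  using assms
proof (induction k arbitrary: x \<theta>)
  case 0
  define w where "w n = circ (x (Suc n)) - circ \<theta> * circ (x n)" for n
  have "circ \<theta> \<noteq> 1" using 0(2) circ_eq_1_imp_Ints Ints_subset_Rats by blast
  have "(\<lambda>n. circ (fwd_diff x n)) \<longlonglongrightarrow> circ \<theta>"
    using 0(1) unfolding circ_def by (auto intro!: tendsto_intros)
  then have "(\<lambda>n. norm (circ (fwd_diff x n) - circ \<theta>)) \<longlonglongrightarrow> 0"
    by (intro tendsto_norm_zero LIM_zero)
  moreover have "norm (circ (fwd_diff x n) - circ \<theta>) = norm (w n)" for n
  proof -
    have "circ (x (Suc n)) = circ (fwd_diff x n) * circ (x n)"
      by (simp add: fwd_diff_def flip: circ_add)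
    then have "w n = (circ (fwd_diff x n) - circ \<theta>) * circ (x n)"
      unfolding w_def by (simp add: algebra_simps)
    then show ?thesis by (simp add: norm_mult)
  qed
  ultimately have "w \<longlonglongrightarrow> 0" using tendsto_norm_zero_iff[of w] by simp
  then have cesaro: "(\<lambda>N. (\<Sum>n<N. w n) / of_nat N) \<longlonglongrightarrow> 0"
    using null_mean0_of_null[of w] by (simp only: null_mean0_def)
  have bdry: "(\<lambda>N. (circ (x N) - circ (x 0)) / of_nat N) \<longlonglongrightarrow> 0"
  proof (rule Lim_null_comparison)
    show "\<forall>\<^sub>F N in sequentially. norm ((circ (x N) - circ (x 0)) / of_nat N) \<le> 2 / real N"
    proof (intro always_eventually allI)
      fix N
      have "norm (circ (x N) - circ (x 0)) \<le> 2"
        using norm_triangle_ineq4[of "circ (x N)" "circ (x 0)"] by simp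
      then show "norm ((circ (x N) - circ (x 0)) / of_nat N) \<le> 2 / real N"
        unfolding norm_divide norm_of_nat by (rule divide_right_mono) simp
    qed
  qed (rule lim_const_over_n)
  have eq: "(\<Sum>n<N. circ (x n)) = ((\<Sum>n<N. w n) - (circ (x N) - circ (x 0))) * (1 / (1 - circ \<theta>))" for N
  proof -
    have "(\<Sum>n<N. w n) = (\<Sum>n<N. circ (x (Suc n)) - circ (x n)) + (\<Sum>n<N. circ (x n)) * (1 - circ \<theta>)"
      unfolding w_def sum_distrib_right sum.distrib[symmetric]
      by (rule sum.cong[OF refl]) (simp add: algebra_simps)
    also have "(\<Sum>n<N. circ (x (Suc n)) - circ (x n)) = circ (x N) - circ (x 0)"
      by (rule sum_lessThan_telescope)
    finally show ?thesis using \<open>circ \<theta> \<noteq> 1\<close> by simp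
  qed
  have "(\<lambda>N. ((\<Sum>n<N. w n) / of_nat N - (circ (x N) - circ (x 0)) / of_nat N) * (1 / (1 - circ \<theta>)))
     \<longlonglongrightarrow> (0 - 0) * (1 / (1 - circ \<theta>))"
    by (rule tendsto_mult[OF tendsto_diff[OF cesaro bdry] tendsto_const])
  then show ?case unfolding null_mean0_def eq
    by (simp add: diff_divide_distrib mult.commute)
next
  case (Suc k)
  show ?case
  proof (rule van_der_corput_null_mean)
    fix r :: nat assume r: "r \<ge> 1"
    have "(\<lambda>n. \<Sum>i<r. (fwd_diff ^^ Suc (Suc k)) x (n + i)) \<longlonglongrightarrow> (\<Sum>i<r. \<theta>)"
      by (intro tendsto_sum LIMSEQ_ignore_initial_segment[OF Suc.prems(1)])
    then have "(fwd_diff ^^ Suc k) (\<lambda>n. x (n + r) - x n) \<longlonglongrightarrow> real r * \<theta>"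
      unfolding higher_diff_of_shift[abs_def] by simp
    moreover have "real r * \<theta> \<notin> \<rat>"
    proof
      assume "real r * \<theta> \<in> \<rat>"
      then have "real r * \<theta> / real r \<in> \<rat>" by (intro Rats_divide) auto
      then show False using r Suc.prems(2) by simp
    qed
    ultimately have "null_mean0 (\<lambda>n. circ (x (n + r) - x n))" by (rule Suc.IH)
    then show "null_mean0 (\<lambda>n. circ (x (n + r)) * cnj (circ (x n)))" by (simp only: circ_diff)
  qed simp
qed

section \<open>Derivatives, signs and limits at infinity\<close>

definition ev_deriv :: "(real \<Rightarrow> real) \<Rightarrow> (real \<Rightarrow> real) \<Rightarrow> bool" where
  "ev_deriv f f' \<longleftrightarrow> (\<forall>\<^sub>F t in at_top. (f has_real_derivative f' t) (at t))"

definition ev_sign :: "(real \<Rightarrow> real) \<Rightarrow> bool" where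
  "ev_sign f \<longleftrightarrow> (\<forall>\<^sub>F t in at_top. f t > 0) \<or> (\<forall>\<^sub>F t in at_top. f t < 0) \<or> (\<forall>\<^sub>F t in at_top. f t = 0)"

lemma eventually_at_top_obtain:
  assumes "\<forall>\<^sub>F t in at_top. P (t::real)"
  obtains T where "T \<ge> lo" "\<And>t. t \<ge> T \<Longrightarrow> P t"
proof -
  obtain T where T: "\<And>t. t \<ge> T \<Longrightarrow> P t" using assms by (auto simp: eventually_at_top_linorder)
  show ?thesis by (rule that[of "max T lo"]) (auto intro: T)
qed

lemma eventually_at_top_I: "(\<And>t. t \<ge> (T::real) \<Longrightarrow> P t) \<Longrightarrow> \<forall>\<^sub>F t in at_top. P t"
  by (auto simp: eventually_at_top_linorder)

lemma ev_deriv_imp_mono: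
  assumes "ev_deriv f f'" "\<forall>\<^sub>F t in at_top. f' t \<ge> 0"
  obtains T where "T \<ge> lo" "\<And>s t. T \<le> s \<Longrightarrow> s \<le> t \<Longrightarrow> f s \<le> f t"
proof -
  have "\<forall>\<^sub>F t in at_top. (f has_real_derivative f' t) (at t) \<and> f' t \<ge> 0"
    using assms unfolding ev_deriv_def by eventually_elim auto
  from eventually_at_top_obtain[OF this, where lo = lo]
  obtain T where T: "T \<ge> lo" "\<And>t. t \<ge> T \<Longrightarrow> (f has_real_derivative f' t) (at t) \<and> f' t \<ge> 0"
    by blast
  have "f s \<le> f t" if st: "T \<le> s" "s \<le> t" for s t
    by (rule DERIV_nonneg_imp_nondecreasing[OF st(2)])
       (use T(2) st(1) order_trans in blast)
  with T(1) show ?thesis by (rule that)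
qed

lemma ev_deriv_imp_strict_mono:
  assumes "ev_deriv f f'" "\<forall>\<^sub>F t in at_top. f' t > 0"
  obtains T where "T \<ge> lo" "\<And>s t. T \<le> s \<Longrightarrow> s < t \<Longrightarrow> f s < f t"
proof -
  have "\<forall>\<^sub>F t in at_top. (f has_real_derivative f' t) (at t) \<and> f' t > 0"
    using assms unfolding ev_deriv_def by eventually_elim auto
  from eventually_at_top_obtain[OF this, where lo = lo]
  obtain T where T: "T \<ge> lo" "\<And>t. t \<ge> T \<Longrightarrow> (f has_real_derivative f' t) (at t) \<and> f' t > 0"
    by blast
  have "f s < f t" if st: "T \<le> s" "s < t" for s t
    by (rule DERIV_pos_imp_increasing[OF st(2)])
       (use T(2) st(1) order_trans in blast)
  with T(1) show ?thesis by (rule that)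
qed

lemma ev_deriv_uminus: "ev_deriv f f' \<Longrightarrow> ev_deriv (\<lambda>t. - f t) (\<lambda>t. - f' t)"
  unfolding ev_deriv_def by (erule eventually_mono) (rule DERIV_minus)

lemma ev_deriv_add: "ev_deriv f f' \<Longrightarrow> ev_deriv g g' \<Longrightarrow> ev_deriv (\<lambda>t. f t + g t) (\<lambda>t. f' t + g' t)"
  unfolding ev_deriv_def by (erule (1) eventually_elim2) (rule DERIV_add)

lemma ev_deriv_diff: "ev_deriv f f' \<Longrightarrow> ev_deriv g g' \<Longrightarrow> ev_deriv (\<lambda>t. f t - g t) (\<lambda>t. f' t - g' t)"
  unfolding ev_deriv_def by (erule (1) eventually_elim2) (rule DERIV_diff)

lemma ev_deriv_cong:
  assumes "ev_deriv g g'" "\<forall>\<^sub>F t in at_top. f t = g t" "\<forall>\<^sub>F t in at_top. f' t = g' t"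
  shows "ev_deriv f f'"
proof -
  obtain T where T: "T \<ge> 0" "\<And>t. t \<ge> T \<Longrightarrow> f t = g t"
    using eventually_at_top_obtain[OF assms(2), where lo = 0] by blast
  show ?thesis unfolding ev_deriv_def
    using assms(1)[unfolded ev_deriv_def] assms(3) eventually_gt_at_top[of T]
  proof eventually_elim
    case (elim t)
    have "\<forall>\<^sub>F s in nhds t. s > T" using eventually_nhds_in_open[of "{T<..}" t] elim by simp
    then have "\<forall>\<^sub>F s in nhds t. f s = g s" by eventually_elim (use T in auto)
    then show ?case using elim DERIV_cong_ev[of t t f g "f' t" "g' t"] by simp
  qed
qed

lemma ev_sign_uminus: "ev_sign (\<lambda>t. - f t) \<longleftrightarrow> ev_sign f"
  unfolding ev_sign_def by auto

lemma ev_sign_cong: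
  assumes "\<forall>\<^sub>F t in at_top. f t = g t"
  shows "ev_sign f \<longleftrightarrow> ev_sign g"
proof -
  have "(\<forall>\<^sub>F t in at_top. f t > 0) = (\<forall>\<^sub>F t in at_top. g t > 0)"
    "(\<forall>\<^sub>F t in at_top. f t < 0) = (\<forall>\<^sub>F t in at_top. g t < 0)"
    "(\<forall>\<^sub>F t in at_top. f t = 0) = (\<forall>\<^sub>F t in at_top. g t = 0)"
    by (intro eventually_cong[OF assms]; simp)+
  then show ?thesis unfolding ev_sign_def by simp
qed

lemma ev_sign_mult:
  assumes "ev_sign f" "ev_sign g"
  shows "ev_sign (\<lambda>t. f t * g t)"
proof -
  have "\<lbrakk>\<forall>\<^sub>F t in at_top. P (f t); \<forall>\<^sub>F t in at_top. Q (g t); \<And>x y. P x \<Longrightarrow> Q y \<Longrightarrow> S (x * y)\<rbrakk>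
      \<Longrightarrow> \<forall>\<^sub>F t in at_top. S (f t * g t)" for P Q S :: "real \<Rightarrow> bool"
    by (auto elim: eventually_elim2)
  from this[of "\<lambda>x. x > 0" "\<lambda>x. x > 0" "\<lambda>x. x > 0"] this[of "\<lambda>x. x > 0" "\<lambda>x. x < 0" "\<lambda>x. x < 0"]
    this[of "\<lambda>x. x < 0" "\<lambda>x. x > 0" "\<lambda>x. x < 0"] this[of "\<lambda>x. x < 0" "\<lambda>x. x < 0" "\<lambda>x. x > 0"]
    this[of "\<lambda>x. x = 0" "\<lambda>x. True" "\<lambda>x. x = 0"] this[of "\<lambda>x. True" "\<lambda>x. x = 0" "\<lambda>x. x = 0"]
  show ?thesis using assms unfolding ev_sign_def
    by (auto simp: mult_pos_pos mult_pos_neg mult_neg_pos mult_neg_neg)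
qed

lemma ev_sign_of_pos_deriv:
  assumes "ev_deriv f f'" "\<forall>\<^sub>F t in at_top. f' t > 0"
  shows "ev_sign f"
proof -
  obtain T where T: "T \<ge> 0" "\<And>s t. T \<le> s \<Longrightarrow> s < t \<Longrightarrow> f s < f t"
    using ev_deriv_imp_strict_mono[where lo = 0, OF assms] by blast
  show ?thesis
  proof (cases "\<exists>t\<ge>T. f t \<ge> 0")
    case True
    then obtain s where s: "s \<ge> T" "f s \<ge> 0" by auto
    have "\<forall>\<^sub>F t in at_top. f t > 0"
      using eventually_gt_at_top[of s] by eventually_elim (use T(2) s in force)
    then show ?thesis by (simp add: ev_sign_def)
  next
    case False
    then have "\<forall>\<^sub>F t in at_top. f t < 0" by (intro eventually_at_top_I[of T]) auto
    then show ?thesis by (simp add: ev_sign_def)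
  qed
qed

lemma ev_sign_of_deriv:
  assumes "ev_deriv f f'" "ev_sign f'"
  shows "ev_sign f"
  using assms(2) unfolding ev_sign_def[of f']
proof (elim disjE)
  assume "\<forall>\<^sub>F t in at_top. f' t > 0"
  with assms(1) show ?thesis by (rule ev_sign_of_pos_deriv)
next
  assume "\<forall>\<^sub>F t in at_top. f' t < 0"
  then have "ev_sign (\<lambda>t. - f t)"
    by (intro ev_sign_of_pos_deriv[OF ev_deriv_uminus[OF assms(1)]]) simp
  then show ?thesis by (simp only: ev_sign_uminus)
next
  assume z: "\<forall>\<^sub>F t in at_top. f' t = 0"
  have z1: "\<forall>\<^sub>F t in at_top. f' t \<ge> 0" by (rule eventually_mono[OF z]) simp
  have z2: "\<forall>\<^sub>F t in at_top. - f' t \<ge> 0" by (rule eventually_mono[OF z]) simp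
  obtain T1 where T1: "T1 \<ge> 0" "\<And>s t. T1 \<le> s \<Longrightarrow> s \<le> t \<Longrightarrow> f s \<le> f t"
    using ev_deriv_imp_mono[where lo = 0, OF assms(1) z1] by blast
  obtain T2 where T2: "T2 \<ge> 0" "\<And>s t. T2 \<le> s \<Longrightarrow> s \<le> t \<Longrightarrow> - f s \<le> - f t"
    using ev_deriv_imp_mono[where lo = 0, OF ev_deriv_uminus[OF assms(1)] z2] by blast
  define T where "T = max T1 T2"
  have const: "f t = f T" if "t \<ge> T" for t using T1(2)[of T t] T2(2)[of T t] that by (simp add: T_def)
  have P: "\<forall>\<^sub>F t in at_top. P (f t)" if "P (f T)" for P
    using eventually_ge_at_top[of T] by eventually_elim (use const that in metis)
  show ?thesis using P[of "\<lambda>x. x > 0"] P[of "\<lambda>x. x < 0"] P[of "\<lambda>x. x = 0"]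
    unfolding ev_sign_def by linarith
qed

lemma mono_limit_cases:
  assumes "\<And>s t. T \<le> s \<Longrightarrow> s \<le> t \<Longrightarrow> f s \<le> f (t::real)"
  shows "(\<exists>c. (f \<longlongrightarrow> (c::real)) at_top) \<or> filterlim f at_top at_top"
proof (cases "\<exists>B. \<forall>t\<ge>T. f t \<le> B")
  case True
  then obtain B where B: "\<And>t. t \<ge> T \<Longrightarrow> f t \<le> B" by auto
  define c where "c = (SUP t\<in>{T..}. f t)"
  have bdd: "bdd_above (f ` {T..})" using B by (intro bdd_aboveI2[where M = B]) auto
  have "(f \<longlongrightarrow> c) at_top"
  proof (rule order_tendstoI)
    fix a assume "a < c"
    then obtain s where s: "s \<ge> T" "a < f s" unfolding c_def using less_cSUP_iff[OF _ bdd] by auto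
    show "\<forall>\<^sub>F t in at_top. a < f t"
      using eventually_ge_at_top[of s] by eventually_elim (use assms s less_le_trans in blast)
  next
    fix a assume "c < a"
    moreover have "f t \<le> c" if "t \<ge> T" for t unfolding c_def using that bdd by (intro cSUP_upper) auto
    ultimately show "\<forall>\<^sub>F t in at_top. f t < a" by (intro eventually_at_top_I[of T]) fastforce
  qed
  then show ?thesis by blast
next
  case False
  have "filterlim f at_top at_top" unfolding filterlim_at_top
  proof
    fix Z
    obtain s where s: "s \<ge> T" "f s > Z" using False by (auto simp: not_le)
    show "\<forall>\<^sub>F t in at_top. Z \<le> f t"
      using eventually_ge_at_top[of s] by eventually_elim (use assms s in force)
  qed
  then show ?thesis by blast
qed

lemma ev_deriv_limit_cases:
  assumes "ev_deriv f f'" "ev_sign f'"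
  shows "(\<exists>c. (f \<longlongrightarrow> c) at_top) \<or> filterlim (\<lambda>t. \<bar>f t\<bar>) at_top at_top"
proof -
  have "(\<forall>\<^sub>F t in at_top. f' t \<ge> 0) \<or> (\<forall>\<^sub>F t in at_top. - f' t \<ge> 0)"
    using assms(2) unfolding ev_sign_def
  proof (elim disjE)
    assume "\<forall>\<^sub>F t in at_top. f' t > 0"
    then have "\<forall>\<^sub>F t in at_top. f' t \<ge> 0" by (rule eventually_mono) simp
    then show ?thesis ..
  next
    assume "\<forall>\<^sub>F t in at_top. f' t < 0"
    then have "\<forall>\<^sub>F t in at_top. - f' t \<ge> 0" by (rule eventually_mono) simp
    then show ?thesis ..
  next
    assume "\<forall>\<^sub>F t in at_top. f' t = 0"
    then have "\<forall>\<^sub>F t in at_top. f' t \<ge> 0" by (rule eventually_mono) simp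
    then show ?thesis ..
  qed
  then consider "\<forall>\<^sub>F t in at_top. f' t \<ge> 0" | "\<forall>\<^sub>F t in at_top. - f' t \<ge> 0" by blast
  then show ?thesis
  proof cases
    case 1
    obtain T where T: "T \<ge> 0" "\<And>s t. T \<le> s \<Longrightarrow> s \<le> t \<Longrightarrow> f s \<le> f t"
      using ev_deriv_imp_mono[where lo = 0, OF assms(1) 1] by blast
    have "filterlim (\<lambda>t. \<bar>f t\<bar>) at_top at_top" if "filterlim f at_top at_top"
      by (rule filterlim_at_top_mono[OF that always_eventually]) (simp add: abs_ge_self abs_ge_minus_self)
    with mono_limit_cases[of T f, OF T(2)] show ?thesis by blast
  next
    case 2
    obtain T where T: "T \<ge> 0" "\<And>s t. T \<le> s \<Longrightarrow> s \<le> t \<Longrightarrow> - f s \<le> - f t"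
      using ev_deriv_imp_mono[where lo = 0, OF ev_deriv_uminus[OF assms(1)] 2] by blast
    have "filterlim (\<lambda>t. \<bar>f t\<bar>) at_top at_top" if "filterlim (\<lambda>t. - f t) at_top at_top"
      by (rule filterlim_at_top_mono[OF that always_eventually]) (simp add: abs_ge_self abs_ge_minus_self)
    moreover have "(f \<longlongrightarrow> - c) at_top" if "((\<lambda>t. - f t) \<longlongrightarrow> c) at_top" for c
      using tendsto_minus[OF that] by simp
    ultimately show ?thesis using mono_limit_cases[of T "\<lambda>t. - f t", OF T(2)] by blast
  qed
qed

text \<open>Both \<open>g - f\<close> and \<open>g + f\<close> are eventually increasing.\<close>

lemma ev_deriv_bound:
  assumes "ev_deriv f f'" "ev_deriv g g'" "\<forall>\<^sub>F t in at_top. \<bar>f' t\<bar> \<le> g' t"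
  obtains K where "K \<ge> 0" "\<forall>\<^sub>F t in at_top. \<bar>f t\<bar> \<le> g t + K"
proof -
  have d1: "\<forall>\<^sub>F t in at_top. g' t - f' t \<ge> 0" by (rule eventually_mono[OF assms(3)]) linarith
  have d2: "\<forall>\<^sub>F t in at_top. g' t + f' t \<ge> 0" by (rule eventually_mono[OF assms(3)]) linarith
  obtain T1 where T1: "T1 \<ge> 0" "\<And>s t. T1 \<le> s \<Longrightarrow> s \<le> t \<Longrightarrow> g s - f s \<le> g t - f t"
    using ev_deriv_imp_mono[where lo = 0, OF ev_deriv_diff[OF assms(2,1)] d1] by blast
  obtain T2 where T2: "T2 \<ge> 0" "\<And>s t. T2 \<le> s \<Longrightarrow> s \<le> t \<Longrightarrow> g s + f s \<le> g t + f t"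
    using ev_deriv_imp_mono[where lo = 0, OF ev_deriv_add[OF assms(2,1)] d2] by blast
  define T where "T = max T1 T2"
  show ?thesis
  proof (rule that[of "\<bar>g T\<bar> + \<bar>f T\<bar>"])
    show "\<forall>\<^sub>F t in at_top. \<bar>f t\<bar> \<le> g t + (\<bar>g T\<bar> + \<bar>f T\<bar>)"
      using eventually_ge_at_top[of T]
    proof eventually_elim
      case (elim t)
      then show ?case using T1(2)[of T t] T2(2)[of T t] by (simp add: T_def abs_le_iff) linarith
    qed
  qed simp
qed

text \<open>The function \<open>f\<close> is eventually constant or strictly monotone.\<close>

lemma ev_sign_dilation_diff:
  assumes "ev_deriv f f'" "ev_sign f'" "p > 0" "q > 0"
  shows "ev_sign (\<lambda>t. f (p * t) - f (q * t))"
proof -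
  have main: "ev_sign (\<lambda>t. f (p * t) - f (q * t))" if pq: "0 < q" "q < p" and f: "\<forall>\<^sub>F t in at_top. f' t > 0" "ev_deriv f f'"
    for f f' :: "real \<Rightarrow> real" and p q
  proof -
    obtain T where T: "T \<ge> 1" "\<And>s t. T \<le> s \<Longrightarrow> s < t \<Longrightarrow> f s < f t"
      using ev_deriv_imp_strict_mono[where lo = 1, OF f(2,1)] by blast
    have "\<forall>\<^sub>F t in at_top. f (p * t) - f (q * t) > 0"
    proof (rule eventually_at_top_I[of "T / q"])
      fix t assume t: "t \<ge> T / q"
      have "t > 0" using t T pq by (smt (verit) divide_pos_pos)
      moreover have "T \<le> q * t" using t pq by (simp add: field_simps)
      ultimately show "f (p * t) - f (q * t) > 0" using T(2)[of "q * t" "p * t"] pq by simp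
    qed
    then show ?thesis by (simp add: ev_sign_def)
  qed
  have lt: "ev_sign (\<lambda>t. f (p * t) - f (q * t))" if pq: "0 < q" "q < p" for p q
    using assms(2) unfolding ev_sign_def[of f']
  proof (elim disjE)
    assume "\<forall>\<^sub>F t in at_top. f' t > 0"
    then show ?thesis using main[OF pq] assms(1) by blast
  next
    assume "\<forall>\<^sub>F t in at_top. f' t < 0"
    then have "ev_sign (\<lambda>t. - f (p * t) - - f (q * t))"
      by (intro main[OF pq _ ev_deriv_uminus[OF assms(1)]]) simp
    then show ?thesis using ev_sign_uminus[of "\<lambda>t. f (p * t) - f (q * t)"] by simp
  next
    assume z: "\<forall>\<^sub>F t in at_top. f' t = 0"
    have z1: "\<forall>\<^sub>F t in at_top. f' t \<ge> 0" by (rule eventually_mono[OF z]) simp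
    have z2: "\<forall>\<^sub>F t in at_top. - f' t \<ge> 0" by (rule eventually_mono[OF z]) simp
    obtain T1 where T1: "T1 \<ge> 1" "\<And>s t. T1 \<le> s \<Longrightarrow> s \<le> t \<Longrightarrow> f s \<le> f t"
      using ev_deriv_imp_mono[where lo = 1, OF assms(1) z1] by blast
    obtain T2 where T2: "T2 \<ge> T1" "\<And>s t. T2 \<le> s \<Longrightarrow> s \<le> t \<Longrightarrow> - f s \<le> - f t"
      using ev_deriv_imp_mono[where lo = T1, OF ev_deriv_uminus[OF assms(1)] z2] by blast
    have "\<forall>\<^sub>F t in at_top. f (p * t) - f (q * t) = 0"
    proof (rule eventually_at_top_I[of "T2 / q"])
      fix t assume t: "t \<ge> T2 / q"
      have "t > 0" using t T1 T2 pq by (smt (verit) divide_pos_pos)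
      moreover have "T2 \<le> q * t" using t pq by (simp add: field_simps)
      ultimately show "f (p * t) - f (q * t) = 0"
        using T1(2)[of "q * t" "p * t"] T2(2)[of "q * t" "p * t"] T2(1) pq by simp
    qed
    then show ?thesis by (simp add: ev_sign_def)
  qed
  consider "q < p" | "p < q" | "p = q" by linarith
  then show ?thesis
  proof cases
    case 1 then show ?thesis using lt assms by blast
  next
    case 2
    then have "ev_sign (\<lambda>t. f (q * t) - f (p * t))" using lt assms by blast
    then show ?thesis using ev_sign_uminus[of "\<lambda>t. f (q * t) - f (p * t)"] by simp
  next
    case 3 then show ?thesis by (simp add: ev_sign_def)
  qed
qed

section \<open>Polynomials in the variable over a Hardy field\<close>

lemma germ_of_eq_iff: "germ_of f = germ_of g \<longleftrightarrow> (\<forall>\<^sub>F t in at_top. f t = g t)"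
  by transfer simp

lemma germ_of_diff: "germ_of (\<lambda>t. f t - g t) = germ_of f - germ_of g"
  by transfer simp

lemma germ_of_mult: "germ_of (\<lambda>t. f t * g t) = germ_of f * germ_of g"
  by transfer simp

lemma germ_of_const_1: "germ_of (\<lambda>_. 1) = 1"
  by transfer simp

lemma germ_of_const_0: "germ_of (\<lambda>_. 0) = 0"
  by transfer simp

lemma germ_obtain: obtains f where "u = germ_of f"
proof -
  have "\<exists>f. u = germ_of f" by transfer (rule exI, rule always_eventually, rule allI, rule refl)
  then show ?thesis using that by blast
qed

locale hardy =
  fixes H :: "germ set"
  assumes hardy: "hardy_field H"
begin

definition hfun :: "(real \<Rightarrow> real) \<Rightarrow> bool" where
  "hfun f \<longleftrightarrow> germ_of f \<in> H"

lemma hfun_cong: "\<forall>\<^sub>F t in at_top. f t = g t \<Longrightarrow> hfun f \<longleftrightarrow> hfun g"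
  unfolding hfun_def using germ_of_eq_iff by metis

lemma hfun_1: "hfun (\<lambda>_. 1)"
  using hardy by (simp add: hfun_def germ_of_const_1 hardy_field_def)

lemma hfun_diff: "hfun f \<Longrightarrow> hfun g \<Longrightarrow> hfun (\<lambda>t. f t - g t)"
  using hardy by (simp add: hfun_def germ_of_diff hardy_field_def)

lemma hfun_mult: "hfun f \<Longrightarrow> hfun g \<Longrightarrow> hfun (\<lambda>t. f t * g t)"
  using hardy by (simp add: hfun_def germ_of_mult hardy_field_def)

lemma hfun_0: "hfun (\<lambda>_. 0)"
  using hfun_diff[OF hfun_1 hfun_1] by simp

lemma hfun_uminus: "hfun f \<Longrightarrow> hfun (\<lambda>t. - f t)"
  using hfun_diff[OF hfun_0, of f] by simp

lemma hfun_add: "hfun f \<Longrightarrow> hfun g \<Longrightarrow> hfun (\<lambda>t. f t + g t)"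
  using hfun_diff[OF _ hfun_uminus, of f g] by simp

lemma hfun_inverse:
  assumes "hfun f" "\<not> (\<forall>\<^sub>F t in at_top. f t = 0)"
  obtains g where "hfun g" "\<forall>\<^sub>F t in at_top. f t * g t = 1"
proof -
  have "germ_of f \<noteq> 0" using assms(2) germ_of_eq_iff[of f "\<lambda>_. 0"] by (simp add: germ_of_const_0)
  then obtain v where v: "v \<in> H" "germ_of f * v = 1"
    using hardy assms(1) unfolding hardy_field_def hfun_def by blast
  obtain g where g: "v = germ_of g" by (rule germ_obtain)
  have "germ_of (\<lambda>t. f t * g t) = germ_of (\<lambda>_. 1)" using v g by (simp add: germ_of_mult germ_of_const_1)
  then have "\<forall>\<^sub>F t in at_top. f t * g t = 1" by (simp only: germ_of_eq_iff)
  with v g show ?thesis using that by (simp add: hfun_def)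
qed

lemma hfun_of_nat: "hfun (\<lambda>_. of_nat n)"
  by (induction n) (use hfun_0 hfun_add[OF hfun_1] in auto)

lemma hfun_of_int: "hfun (\<lambda>_. of_int n)"
proof (cases "n \<ge> 0")
  case True
  then show ?thesis using hfun_of_nat[of "nat n"] by simp
next
  case False
  then show ?thesis using hfun_uminus[OF hfun_of_nat[of "nat (- n)"]] by simp
qed

lemma hfun_Rats:
  assumes "c \<in> \<rat>"
  shows "hfun (\<lambda>_. c)"
proof -
  obtain a b :: int where ab: "b > 0" "c = of_int a / of_int b" using assms by (auto elim: Rats_cases')
  have "\<not> (\<forall>\<^sub>F t::real in at_top. real_of_int b = 0)" using ab by simp
  then obtain g where g: "hfun g" "\<forall>\<^sub>F t in at_top. of_int b * g t = 1"
    using hfun_inverse[OF hfun_of_int[of b]] by blast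
  have "\<forall>\<^sub>F t in at_top. of_int a * g t = c"
    using g(2)
  proof eventually_elim
    case (elim t)
    then have "g t = 1 / of_int b" using ab by (simp add: field_simps)
    then show ?case using ab by simp
  qed
  from hfun_cong[OF this] show ?thesis using hfun_mult[OF hfun_of_int[of a] g(1)] by simp
qed

lemma hfun_deriv:
  assumes "hfun f"
  obtains f' where "hfun f'" "ev_deriv f f'"
proof -
  obtain v where v: "v \<in> H" "germ_has_derivative (germ_of f) v"
    using hardy assms unfolding hardy_field_def hfun_def by blast
  then obtain g g' where g: "germ_of f = germ_of g" "v = germ_of g'" "ev_deriv g g'"
    unfolding germ_has_derivative_def ev_deriv_def by blast
  have "ev_deriv f g'" by (rule ev_deriv_cong[OF g(3)]) (use g(1) in \<open>simp_all add: germ_of_eq_iff\<close>)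
  with v g that show ?thesis by (simp add: hfun_def)
qed

text \<open>A function that is invertible in the Hardy field and differentiable has no zeros near
  infinity.\<close>

lemma hfun_sign:
  assumes "hfun f"
  shows "ev_sign f"
proof (cases "\<forall>\<^sub>F t in at_top. f t = 0")
  case False
  then obtain g where g: "\<forall>\<^sub>F t in at_top. f t * g t = 1" by (rule hfun_inverse[OF assms])
  obtain f' where f': "ev_deriv f f'" by (rule hfun_deriv[OF assms])
  have "\<forall>\<^sub>F t in at_top. f t \<noteq> 0 \<and> isCont f t"
    using g f'[unfolded ev_deriv_def] by eventually_elim (auto intro: DERIV_isCont)
  then obtain T where T: "\<And>t. t \<ge> T \<Longrightarrow> f t \<noteq> 0 \<and> isCont f t"
    by (auto simp: eventually_at_top_linorder)
  have "(\<forall>t\<ge>T. f t > 0) \<or> (\<forall>t\<ge>T. f t < 0)"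
  proof (rule ccontr)
    assume "\<not> ?thesis"
    then obtain s t where st: "s \<ge> T" "t \<ge> T" "f s \<le> 0" "f t \<ge> 0" by (auto simp: not_less)
    have "\<exists>x. min s t \<le> x \<and> x \<le> max s t \<and> f x = 0"
    proof (cases "s \<le> t")
      case True
      then show ?thesis using IVT[of f s 0 t] st T by auto
    next
      case False
      then show ?thesis using IVT2[of f s 0 t] st T by auto
    qed
    then show False using T st by (metis min_le_iff_disj order_trans min_def)
  qed
  then show ?thesis unfolding ev_sign_def by (auto simp: eventually_at_top_linorder)
qed (simp add: ev_sign_def)

text \<open>A Hardy field need not contain the function \<open>t\<close>, and the field generated by \<open>t\<close> over it is
  a Hardy field only by a theorem. The polynomials of degree below \<open>n\<close> in \<open>t\<close> suffice here,
  and for them the decisive property, an eventually constant sign, has a short proof.\<close>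

definition tpoly :: "nat \<Rightarrow> (real \<Rightarrow> real) \<Rightarrow> bool" where
  "tpoly n f \<longleftrightarrow> (\<exists>u. (\<forall>i. hfun (u i)) \<and> (\<forall>\<^sub>F t in at_top. f t = (\<Sum>i<n. t ^ i * u i t)))"

lemma tpoly_mono:
  assumes "tpoly n f" "n \<le> m"
  shows "tpoly m f"
proof -
  obtain u where u: "\<forall>i. hfun (u i)" "\<forall>\<^sub>F t in at_top. f t = (\<Sum>i<n. t ^ i * u i t)"
    using assms(1) by (auto simp: tpoly_def)
  have "(\<Sum>i<m. t ^ i * (if i < n then u i else (\<lambda>_. 0)) t) = (\<Sum>i<n. t ^ i * u i t)" for t
    using assms(2) by (intro sum.mono_neutral_cong_right) auto
  with u show ?thesis unfolding tpoly_def
    by (intro exI[of _ "\<lambda>i. if i < n then u i else (\<lambda>_. 0)"]) (auto simp: hfun_0)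
qed

text \<open>The derivative of a product \<open>t\<^sup>i v\<^sub>i\<close> is \<open>t\<^sup>i v\<^sub>i' + i t\<^bsup>i-1\<^esup> v\<^sub>i\<close>; the coefficients \<open>w\<^sub>i\<close>
  collect the terms with the same power.\<close>

lemma polynomial_deriv_same_degree:
  assumes "\<And>i. hfun (v i)"
  obtains w where "\<And>i. hfun (w i)"
    "ev_deriv (\<lambda>t. \<Sum>i<n. t ^ i * v i t) (\<lambda>t. (\<Sum>i<n. t ^ i * w i t))"
proof -
  obtain v' where v': "\<And>i. hfun (v' i)" "\<And>i. ev_deriv (v i) (v' i)"
  proof -
    have "\<forall>i. \<exists>f'. hfun f' \<and> ev_deriv (v i) f'" using hfun_deriv[OF assms] by blast
    then show ?thesis using that by metis
  qed
  define w where "w i = (\<lambda>t. v' i t + of_nat (Suc i) * (if Suc i < n then v (Suc i) t else 0))" for i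
  have "hfun (w i)" for i unfolding w_def
    by (cases "Suc i < n")
       (use hfun_add[OF v'(1) hfun_mult[OF hfun_of_nat assms, of "Suc i" "Suc i"], of i] v'(1) in auto)
  moreover have "ev_deriv (\<lambda>t. \<Sum>i<n. t ^ i * v i t) (\<lambda>t. (\<Sum>i<n. t ^ i * w i t))"
  proof -
    have "\<forall>\<^sub>F t in at_top. \<forall>i\<in>{..<n}. (v i has_real_derivative v' i t) (at t)"
      using v'(2) by (intro eventually_ball_finite) (auto simp: ev_deriv_def)
    then show ?thesis unfolding ev_deriv_def
    proof eventually_elim
      case (elim t)
      have "((\<lambda>t. \<Sum>i<n. t ^ i * v i t) has_real_derivative
          (\<Sum>i<n. t ^ i * v' i t + of_nat i * t ^ (i - 1) * v i t)) (at t)"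
        using elim by (intro DERIV_sum) (auto intro!: derivative_eq_intros)
      also have "(\<Sum>i<n. t ^ i * v' i t + of_nat i * t ^ (i - 1) * v i t) = (\<Sum>i<n. t ^ i * w i t)"
      proof -
        have "(\<Sum>i<n. of_nat i * t ^ (i - 1) * v i t) = (\<Sum>i<n. t ^ i * (of_nat (Suc i) * (if Suc i < n then v (Suc i) t else 0)))"
        proof (cases n)
          case (Suc m)
          have "(\<Sum>i<n. of_nat i * t ^ (i - 1) * v i t) = (\<Sum>i<m. of_nat (Suc i) * t ^ i * v (Suc i) t)"
            unfolding Suc by (subst sum.lessThan_Suc_shift) simp
          also have "\<dots> = (\<Sum>i<n. t ^ i * (of_nat (Suc i) * (if Suc i < n then v (Suc i) t else 0)))"
            unfolding Suc by (simp add: mult_ac)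
          finally show ?thesis .
        qed simp
        then show ?thesis by (simp only: w_def distrib_left sum.distrib)
      qed
      finally show ?case .
    qed
  qed
  ultimately show ?thesis using that by blast
qed

text \<open>Induction on the degree: after division by the leading coefficient the derivative has
  lower degree and hence eventually constant sign, so the polynomial is eventually monotone
  and has eventually constant sign itself.\<close>

lemma tpoly_sign: "tpoly n f \<Longrightarrow> ev_sign f"
proof (induction n arbitrary: f)
  case 0
  then show ?case by (auto simp: tpoly_def ev_sign_def)
next
  case (Suc n)
  obtain u where u: "\<And>i. hfun (u i)" "\<forall>\<^sub>F t in at_top. f t = (\<Sum>i<Suc n. t ^ i * u i t)"
    using Suc.prems by (auto simp: tpoly_def)
  show ?case
  proof (cases "\<forall>\<^sub>F t in at_top. u n t = 0")
    case True
    have "\<forall>\<^sub>F t in at_top. f t = (\<Sum>i<n. t ^ i * u i t)"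
      using u(2) True by eventually_elim simp
    then have "tpoly n f" unfolding tpoly_def using u(1) by blast
    then show ?thesis by (rule Suc.IH)
  next
    case False
    \<comment> \<open>divide by the leading coefficient; the derivative of a monic polynomial has lower degree\<close>
    then obtain g where g: "hfun g" "\<forall>\<^sub>F t in at_top. u n t * g t = 1" by (rule hfun_inverse[OF u(1)])
    define v where "v i = (\<lambda>t. u i t * g t)" for i
    have v: "hfun (v i)" for i unfolding v_def using hfun_mult u(1) g(1) by blast
    obtain w where w: "\<And>i. hfun (w i)" "ev_deriv (\<lambda>t. \<Sum>i<n. t ^ i * v i t) (\<lambda>t. (\<Sum>i<n. t ^ i * w i t))"
      using polynomial_deriv_same_degree[of v n, OF v] by blast
    have "ev_deriv (\<lambda>t. (\<Sum>i<n. t ^ i * v i t) + t ^ n) (\<lambda>t. (\<Sum>i<n. t ^ i * w i t) + of_nat n * t ^ (n - 1))"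
    proof (rule ev_deriv_add[OF w(2)])
      have "((\<lambda>t. t ^ n) has_real_derivative of_nat n * t ^ (n - 1)) (at t)" for t :: real
        using DERIV_pow[of n t UNIV] by simp
      then show "ev_deriv (\<lambda>t. t ^ n) (\<lambda>t. of_nat n * t ^ (n - 1))"
        unfolding ev_deriv_def by (intro always_eventually allI)
    qed
    moreover have "ev_sign (\<lambda>t. (\<Sum>i<n. t ^ i * w i t) + of_nat n * t ^ (n - 1))"
    proof (rule Suc.IH)
      define w' where "w' i = (\<lambda>t. w i t + (if i = n - 1 then of_nat n else 0))" for i
      have "hfun (w' i)" for i unfolding w'_def
        by (cases "i = n - 1") (use hfun_add[OF w(1) hfun_of_nat, of i n] w(1) in auto)
      moreover have "(\<Sum>i<n. t ^ i * w i t) + of_nat n * t ^ (n - 1) = (\<Sum>i<n. t ^ i * w' i t)" for t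
      proof (cases n)
        case (Suc m)
        have "(\<Sum>i<n. t ^ i * (if i = n - 1 then real n else 0)) = real n * t ^ (n - 1)"
          unfolding Suc by (simp add: mult.commute)
        then show ?thesis by (simp add: w'_def distrib_left sum.distrib)
      qed simp
      ultimately show "tpoly n (\<lambda>t. (\<Sum>i<n. t ^ i * w i t) + of_nat n * t ^ (n - 1))"
        unfolding tpoly_def by (intro exI[of _ w']) auto
    qed
    ultimately have "ev_sign (\<lambda>t. (\<Sum>i<n. t ^ i * v i t) + t ^ n)" by (rule ev_sign_of_deriv)
    then have sg: "ev_sign (\<lambda>t. u n t * ((\<Sum>i<n. t ^ i * v i t) + t ^ n))"
      by (rule ev_sign_mult[OF hfun_sign[OF u(1)]])
    have "\<forall>\<^sub>F t in at_top. f t = u n t * ((\<Sum>i<n. t ^ i * v i t) + t ^ n)"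
      using u(2) g(2)
    proof eventually_elim
      case (elim t)
      have "u n t * (\<Sum>i<n. t ^ i * v i t) = (\<Sum>i<n. t ^ i * u i t * (u n t * g t))"
        unfolding v_def sum_distrib_left by (intro sum.cong) auto
      then show ?case using elim by (simp add: distrib_left mult.commute)
    qed
    from ev_sign_cong[OF this] sg show ?thesis by (simp only:)
  qed
qed

definition tpolys :: "(real \<Rightarrow> real) \<Rightarrow> bool" where
  "tpolys f \<longleftrightarrow> (\<exists>n. tpoly n f)"

lemma tpolys_sign: "tpolys f \<Longrightarrow> ev_sign f"
  unfolding tpolys_def using tpoly_sign by blast

lemma tpolys_hfun: "hfun f \<Longrightarrow> tpolys f"
  unfolding tpolys_def tpoly_def by (intro exI[of _ 1] exI[of _ "\<lambda>_. f"]) simp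

lemma tpolys_add:
  assumes "tpolys f" "tpolys g"
  shows "tpolys (\<lambda>t. f t + g t)"
proof -
  obtain n m where "tpoly n f" "tpoly m g" using assms by (auto simp: tpolys_def)
  then have "tpoly (max n m) f" "tpoly (max n m) g" by (auto intro: tpoly_mono)
  then obtain u v where u: "\<And>i. hfun (u i)" "\<forall>\<^sub>F t in at_top. f t = (\<Sum>i<max n m. t ^ i * u i t)"
    and v: "\<And>i. hfun (v i)" "\<forall>\<^sub>F t in at_top. g t = (\<Sum>i<max n m. t ^ i * v i t)"
    unfolding tpoly_def by blast
  have "\<forall>\<^sub>F t in at_top. f t + g t = (\<Sum>i<max n m. t ^ i * (u i t + v i t))"
    using u(2) v(2) by eventually_elim (simp add: distrib_left sum.distrib)
  then show ?thesis unfolding tpolys_def tpoly_def using hfun_add[OF u(1) v(1)]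
    by (intro exI[of _ "max n m"] exI[of _ "\<lambda>i t. u i t + v i t"]) auto
qed

lemma tpolys_mult_hfun:
  assumes "tpolys f" "hfun g"
  shows "tpolys (\<lambda>t. g t * f t)"
proof -
  obtain n u where u: "\<And>i. hfun (u i)" "\<forall>\<^sub>F t in at_top. f t = (\<Sum>i<n. t ^ i * u i t)"
    using assms(1) unfolding tpolys_def tpoly_def by blast
  have "\<forall>\<^sub>F t in at_top. g t * f t = (\<Sum>i<n. t ^ i * (g t * u i t))"
    using u(2) by eventually_elim (simp add: sum_distrib_left mult_ac)
  then show ?thesis unfolding tpolys_def tpoly_def using hfun_mult[OF assms(2) u(1)]
    by (intro exI[of _ n] exI[of _ "\<lambda>i t. g t * u i t"]) auto
qed

lemma tpolys_mult_t:
  assumes "tpolys f"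
  shows "tpolys (\<lambda>t. t * f t)"
proof -
  obtain n u where u: "\<And>i. hfun (u i)" "\<forall>\<^sub>F t in at_top. f t = (\<Sum>i<n. t ^ i * u i t)"
    using assms(1) unfolding tpolys_def tpoly_def by blast
  define v where "v i = (case i of 0 \<Rightarrow> (\<lambda>_. 0) | Suc j \<Rightarrow> u j)" for i
  have "hfun (v i)" for i unfolding v_def using u(1) hfun_0 by (cases i) auto
  moreover have "\<forall>\<^sub>F t in at_top. t * f t = (\<Sum>i<Suc n. t ^ i * v i t)"
    using u(2)
  proof eventually_elim
    case (elim t)
    show ?case unfolding sum.lessThan_Suc_shift elim sum_distrib_left by (simp add: v_def mult_ac)
  qed
  ultimately show ?thesis unfolding tpolys_def tpoly_def by blast
qed

lemma tpolys_mult_power: "tpolys f \<Longrightarrow> tpolys (\<lambda>t. t ^ k * f t)"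
  by (induction k) (use tpolys_mult_t in \<open>auto simp: mult.assoc\<close>)

lemma tpolys_Rats_mult: "tpolys f \<Longrightarrow> c \<in> \<rat> \<Longrightarrow> tpolys (\<lambda>t. c * f t)"
  using tpolys_mult_hfun hfun_Rats by blast

lemma tpolys_diff: "tpolys f \<Longrightarrow> tpolys g \<Longrightarrow> tpolys (\<lambda>t. f t - g t)"
  using tpolys_add[OF _ tpolys_Rats_mult[of g "-1"], of f] by simp

lemma tpolys_monom: "c \<in> \<rat> \<Longrightarrow> tpolys (\<lambda>t. c * t ^ k)"
  using tpolys_mult_power[OF tpolys_hfun[OF hfun_Rats], of c k] by (simp add: mult.commute)

lemma tpolys_deriv:
  assumes "tpolys f"
  obtains f' where "tpolys f'" "ev_deriv f f'"
proof -
  obtain n u where u: "\<And>i. hfun (u i)" "\<forall>\<^sub>F t in at_top. f t = (\<Sum>i<n. t ^ i * u i t)"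
    using assms(1) unfolding tpolys_def tpoly_def by blast
  obtain w where w: "\<And>i. hfun (w i)" "ev_deriv (\<lambda>t. \<Sum>i<n. t ^ i * u i t) (\<lambda>t. (\<Sum>i<n. t ^ i * w i t))"
    using polynomial_deriv_same_degree[of u n, OF u(1)] by blast
  have "ev_deriv f (\<lambda>t. \<Sum>i<n. t ^ i * w i t)"
    by (rule ev_deriv_cong[OF w(2) u(2)]) simp
  moreover have "tpolys (\<lambda>t. \<Sum>i<n. t ^ i * w i t)" unfolding tpolys_def tpoly_def using w(1)
    by (intro exI[of _ n] exI[of _ w]) auto
  ultimately show ?thesis using that by blast
qed

lemma tpolys_limit_cases:
  assumes "tpolys f"
  shows "(\<exists>c. (f \<longlongrightarrow> c) at_top) \<or> filterlim (\<lambda>t. \<bar>f t\<bar>) at_top at_top"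
  by (metis assms tpolys_deriv tpolys_sign ev_deriv_limit_cases)

end

section \<open>Removing a rational polynomial\<close>

text \<open>Derivatives are only determined eventually, so the iterated derivatives of a function are
  carried along as a sequence \<open>D\<close> with \<open>D 0\<close> the function itself.\<close>

definition deriv_chain :: "(nat \<Rightarrow> real \<Rightarrow> real) \<Rightarrow> bool" where
  "deriv_chain D \<longleftrightarrow> (\<forall>j. ev_deriv (D j) (D (Suc j)))"

lemma deriv_chain_Suc: "deriv_chain D \<Longrightarrow> deriv_chain (\<lambda>j. D (Suc j))"
  by (simp add: deriv_chain_def)

lemma deriv_chain_uminus: "deriv_chain D \<Longrightarrow> deriv_chain (\<lambda>j t. - D j t)"
  unfolding deriv_chain_def using ev_deriv_uminus by blast

lemma ev_deriv_lower_power: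
  assumes "ev_deriv f f'" "c > 0" "\<forall>\<^sub>F t in at_top. f' t \<ge> c * t ^ j"
  obtains c' where "c' > 0" "\<forall>\<^sub>F t in at_top. f t \<ge> c' * t ^ Suc j"
proof -
  define g where "g t = c / real (Suc j) * t ^ Suc j" for t
  have g': "ev_deriv g (\<lambda>t. c * t ^ j)"
  proof -
    have "(g has_real_derivative c * t ^ j) (at t)" for t
    proof -
      have "(g has_real_derivative c / real (Suc j) * (real (Suc j) * t ^ j)) (at t)"
        unfolding g_def[abs_def] by (intro DERIV_cmult) (use DERIV_pow[of "Suc j" t UNIV] in simp)
      then show ?thesis by simp
    qed
    then show ?thesis unfolding ev_deriv_def by (intro always_eventually allI)
  qed
  have "\<forall>\<^sub>F t in at_top. f' t - c * t ^ j \<ge> 0" by (rule eventually_mono[OF assms(3)]) simp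
  from ev_deriv_imp_mono[OF ev_deriv_diff[OF assms(1) g'] this, where lo = 1]
  obtain T where T: "T \<ge> 1" "\<And>s t. T \<le> s \<Longrightarrow> s \<le> t \<Longrightarrow> f s - g s \<le> f t - g t" by blast
  define c' where "c' = c / (2 * real (Suc j))"
  define K where "K = \<bar>f T - g T\<bar>"
  have c': "c' > 0" using assms(2) by (simp add: c'_def)
  have g_eq: "g t = 2 * (c' * t ^ Suc j)" for t by (simp add: g_def c'_def del: of_nat_Suc)
  show ?thesis
  proof (rule that[OF c'])
    show "\<forall>\<^sub>F t in at_top. f t \<ge> c' * t ^ Suc j"
      using eventually_ge_at_top[of T] eventually_ge_at_top[of "K / c'"]
    proof eventually_elim
      case (elim t)
      have "K \<le> c' * t" using elim c' by (simp add: field_simps)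
      also have "\<dots> \<le> c' * t ^ Suc j"
        using c' elim T(1) self_le_power[of t "Suc j"] by (intro mult_left_mono) auto
      finally have "K \<le> c' * t ^ Suc j" .
      moreover have "f t \<ge> g t - K" using T(2)[of T t] elim by (simp add: K_def)
      ultimately show ?case unfolding g_eq by linarith
    qed
  qed
qed

lemma deriv_chain_lower_power:
  assumes "deriv_chain D" "c > 0" "\<forall>\<^sub>F t in at_top. D j t \<ge> c"
  obtains c' where "c' > 0" "\<forall>\<^sub>F t in at_top. D 0 t \<ge> c' * t ^ j"
proof -
  have "\<exists>c'>0. \<forall>\<^sub>F t in at_top. D 0 t \<ge> c' * t ^ j"
    using assms
  proof (induction j arbitrary: D)
    case 0
    then show ?case by auto
  next
    case (Suc j)
    obtain c' where c': "c' > 0" "\<forall>\<^sub>F t in at_top. D (Suc 0) t \<ge> c' * t ^ j"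
      using Suc.IH[OF deriv_chain_Suc[OF Suc.prems(1)] Suc.prems(2,3)] by blast
    have "ev_deriv (D 0) (D (Suc 0))" using Suc.prems(1) by (simp add: deriv_chain_def)
    from ev_deriv_lower_power[OF this c'] show ?case by blast
  qed
  then show ?thesis using that by blast
qed

lemma filterlim_at_top_const_sign:
  assumes "filterlim (\<lambda>t. \<bar>f t\<bar>) at_top at_top" "ev_sign f"
  shows "filterlim f at_top at_top \<or> filterlim (\<lambda>t. - f t) at_top at_top"
proof -
  have "(\<forall>\<^sub>F t in at_top. \<bar>f t\<bar> = f t) \<or> (\<forall>\<^sub>F t in at_top. \<bar>f t\<bar> = - f t)"
    using assms(2) unfolding ev_sign_def
  proof (elim disjE)
    assume "\<forall>\<^sub>F t in at_top. f t > 0"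
    then have "\<forall>\<^sub>F t in at_top. \<bar>f t\<bar> = f t" by (rule eventually_mono) simp
    then show ?thesis ..
  next
    assume "\<forall>\<^sub>F t in at_top. f t < 0"
    then have "\<forall>\<^sub>F t in at_top. \<bar>f t\<bar> = - f t" by (rule eventually_mono) simp
    then show ?thesis ..
  next
    assume "\<forall>\<^sub>F t in at_top. f t = 0"
    then have "\<forall>\<^sub>F t in at_top. \<bar>f t\<bar> = f t" by (rule eventually_mono) simp
    then show ?thesis ..
  qed
  then show ?thesis
    using filterlim_cong[OF refl refl, of "\<lambda>t. \<bar>f t\<bar>" f at_top at_top]
      filterlim_cong[OF refl refl, of "\<lambda>t. \<bar>f t\<bar>" "\<lambda>t. - f t" at_top at_top] assms(1) by blast
qed

text \<open>A derivative of order \<open>j\<close> that is bounded away from zero forces growth of order \<open>t\<^sup>j\<close>.\<close>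

lemma deriv_chain_infinite_lower_power:
  assumes "deriv_chain D" "filterlim (\<lambda>t. \<bar>D j t\<bar>) at_top at_top" "ev_sign (D j)"
  obtains c where "c > 0" "\<forall>\<^sub>F t in at_top. \<bar>D 0 t\<bar> \<ge> c * t ^ j"
proof -
  from filterlim_at_top_const_sign[OF assms(2,3)] show ?thesis
  proof
    assume "filterlim (D j) at_top at_top"
    then have "\<forall>\<^sub>F t in at_top. D j t \<ge> 1" by (simp add: filterlim_at_top)
    then obtain c where c: "c > 0" "\<forall>\<^sub>F t in at_top. D 0 t \<ge> c * t ^ j"
      by (rule deriv_chain_lower_power[OF assms(1) zero_less_one])
    have "\<forall>\<^sub>F t in at_top. \<bar>D 0 t\<bar> \<ge> c * t ^ j" by (rule eventually_mono[OF c(2)]) simp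
    with c(1) show ?thesis by (rule that)
  next
    assume "filterlim (\<lambda>t. - D j t) at_top at_top"
    then have "\<forall>\<^sub>F t in at_top. - D j t \<ge> 1" unfolding filterlim_at_top by blast
    then obtain c where c: "c > 0" "\<forall>\<^sub>F t in at_top. - D 0 t \<ge> c * t ^ j"
      by (rule deriv_chain_lower_power[OF deriv_chain_uminus[OF assms(1)] zero_less_one])
    have "\<forall>\<^sub>F t in at_top. \<bar>D 0 t\<bar> \<ge> c * t ^ j" by (rule eventually_mono[OF c(2)]) simp
    with c(1) show ?thesis by (rule that)
  qed
qed

context hardy
begin

definition tchain :: "(nat \<Rightarrow> real \<Rightarrow> real) \<Rightarrow> bool" where
  "tchain D \<longleftrightarrow> deriv_chain D \<and> (\<forall>j. tpolys (D j))"

lemma tchain_exists: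
  assumes "tpolys f"
  obtains D where "D 0 = f" "tchain D"
proof -
  have "\<exists>D. \<forall>n. (tpolys (D n) \<and> (n = 0 \<longrightarrow> D n = f)) \<and> ev_deriv (D n) (D (Suc n))"
  proof (rule dependent_nat_choice)
    show "\<exists>x. tpolys x \<and> (0 = (0::nat) \<longrightarrow> x = f)" using assms by auto
    fix x and n :: nat
    assume "tpolys x \<and> (n = 0 \<longrightarrow> x = f)"
    then obtain f' where "tpolys f'" "ev_deriv x f'" using tpolys_deriv by blast
    then show "\<exists>y. (tpolys y \<and> (Suc n = 0 \<longrightarrow> y = f)) \<and> ev_deriv x y" by auto
  qed
  then show ?thesis using that unfolding tchain_def deriv_chain_def by blast
qed

lemma tchain_sign: "tchain D \<Longrightarrow> ev_sign (D j)"
  by (simp add: tchain_def tpolys_sign)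

lemma tchain_limit_cases:
  "tchain D \<Longrightarrow> (\<exists>c. (D j \<longlongrightarrow> c) at_top) \<or> filterlim (\<lambda>t. \<bar>D j t\<bar>) at_top at_top"
  by (simp add: tchain_def tpolys_limit_cases)

lemma tchain_diff_monom:
  assumes "tchain D" "c \<in> \<rat>"
  shows "tchain (\<lambda>j t. D j t - (if j \<le> n then c / fact (n - j) * t ^ (n - j) else 0))"
  unfolding tchain_def deriv_chain_def
proof (intro conjI allI)
  fix j
  have D: "ev_deriv (D j) (D (Suc j))" "tpolys (D j)" using assms(1) by (auto simp: tchain_def deriv_chain_def)
  have "((\<lambda>t. if j \<le> n then c / fact (n - j) * t ^ (n - j) else 0) has_real_derivative
     (if Suc j \<le> n then c / fact (n - Suc j) * t ^ (n - Suc j) else 0)) (at t)" for t :: real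
  proof (cases "Suc j \<le> n")
    case True
    then obtain m where m: "n - j = Suc m" by (metis Suc_diff_Suc Suc_le_lessD)
    then have m': "n - Suc j = m" by simp
    have "((\<lambda>t. c / fact (Suc m) * t ^ Suc m) has_real_derivative c / fact (Suc m) * (real (Suc m) * t ^ m)) (at t)"
      by (intro DERIV_cmult) (use DERIV_pow[of "Suc m" t UNIV] in simp)
    moreover have "c / fact (Suc m) * (real (Suc m) * t ^ m) = c / fact m * t ^ m"
      by (simp add: fact_Suc del: of_nat_Suc)
    ultimately show ?thesis using True m m' by simp
  next
    case False
    then consider "j = n" | "j > n" by linarith
    then show ?thesis by cases auto
  qed
  then have "ev_deriv (\<lambda>t. if j \<le> n then c / fact (n - j) * t ^ (n - j) else 0)
     (\<lambda>t. if Suc j \<le> n then c / fact (n - Suc j) * t ^ (n - Suc j) else 0)"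
    unfolding ev_deriv_def by (intro always_eventually allI)
  from ev_deriv_diff[OF D(1) this]
  show "ev_deriv (\<lambda>t. D j t - (if j \<le> n then c / fact (n - j) * t ^ (n - j) else 0))
         (\<lambda>t. D (Suc j) t - (if Suc j \<le> n then c / fact (n - Suc j) * t ^ (n - Suc j) else 0))" .
  show "tpolys (\<lambda>t. D j t - (if j \<le> n then c / fact (n - j) * t ^ (n - j) else 0))"
  proof (cases "j \<le> n")
    case True
    have "(fact (n - j) :: real) \<in> \<rat>" using Rats_of_nat[of "fact (n - j)"] by simp
    then have "c / fact (n - j) \<in> \<rat>" using assms(2) by (intro Rats_divide)
    from tpolys_diff[OF D(2) tpolys_monom[OF this, of "n - j"]] show ?thesis using True by simp
  qed (use D(2) in simp)
qed

end

definition far_from_rat_polys :: "(real \<Rightarrow> real) \<Rightarrow> bool" where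
  "far_from_rat_polys f \<longleftrightarrow> (\<forall>r :: rat poly. (\<lambda>t. (ln t)\<^sup>2) \<prec> (\<lambda>t. \<bar>f t - poly (map_poly of_rat r) t\<bar>))"

lemma map_poly_of_rat_add:
  "map_poly (of_rat :: rat \<Rightarrow> real) (p + q) = map_poly of_rat p + map_poly of_rat q"
  by (intro poly_eqI) (simp add: coeff_map_poly of_rat_add)

lemma far_from_rat_polys_diff:
  assumes "far_from_rat_polys f"
  shows "far_from_rat_polys (\<lambda>t. f t - poly (map_poly of_rat r) t)"
  unfolding far_from_rat_polys_def
proof
  fix r' :: "rat poly"
  have "(\<lambda>t. (ln t)\<^sup>2) \<prec> (\<lambda>t. \<bar>f t - poly (map_poly of_rat (r + r')) t\<bar>)"
    using assms by (simp add: far_from_rat_polys_def)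
  then show "(\<lambda>t. (ln t)\<^sup>2) \<prec> (\<lambda>t. \<bar>f t - poly (map_poly of_rat r) t - poly (map_poly of_rat r') t\<bar>)"
    by (simp add: map_poly_of_rat_add diff_diff_eq)
qed

lemma far_from_rat_polys_dominates:
  assumes "far_from_rat_polys f"
  shows "\<forall>\<^sub>F t in at_top. \<bar>f t\<bar> > C * (ln t)\<^sup>2"
proof -
  have "filterlim (\<lambda>t. \<bar>f t\<bar> / (ln t)\<^sup>2) at_top at_top"
    using assms[unfolded far_from_rat_polys_def grows_slower_def, rule_format, of 0] by simp
  then have "\<forall>\<^sub>F t in at_top. \<bar>f t\<bar> / (ln t)\<^sup>2 > C" by (simp add: filterlim_at_top_dense)
  then show ?thesis using eventually_gt_at_top[of 1]
  proof eventually_elim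
    case (elim t)
    then have "(ln t)\<^sup>2 > 0" by simp
    then show ?case using elim by (simp add: pos_less_divide_eq)
  qed
qed

lemma far_from_rat_polys_no_limit:
  assumes "far_from_rat_polys f"
  shows "\<not> (f \<longlongrightarrow> c) at_top"
proof
  assume "(f \<longlongrightarrow> c) at_top"
  then have "((\<lambda>t. \<bar>f t\<bar>) \<longlongrightarrow> \<bar>c\<bar>) at_top" by (rule tendsto_rabs)
  then have 1: "\<forall>\<^sub>F t in at_top. \<bar>f t\<bar> < \<bar>c\<bar> + 1" by (rule order_tendstoD) simp
  have "\<forall>\<^sub>F t in at_top. \<bar>f t\<bar> > (\<bar>c\<bar> + 1) * (ln t)\<^sup>2"
    by (rule far_from_rat_polys_dominates[OF assms])
  with 1 eventually_ge_at_top[of "exp 1"] have "\<forall>\<^sub>F t::real in at_top. False"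
  proof eventually_elim
    case (elim t)
    have "ln t \<ge> 1" using elim by (simp add: ln_ge_iff less_le_trans[OF exp_gt_zero])
    then have "(\<bar>c\<bar> + 1) * 1 \<le> (\<bar>c\<bar> + 1) * (ln t)\<^sup>2" by (intro mult_left_mono one_le_power) auto
    then show ?case using elim by simp
  qed
  then show False by simp
qed

context hardy
begin

text \<open>Descending induction on the order \<open>n\<close> of a derivative with a finite limit \<open>c\<close>. If \<open>c\<close> is
  irrational, nothing has to be removed. If it is rational, subtracting \<open>c t\<^sup>n / n!\<close> changes
  the limit to \<open>0\<close>; then either the derivative of order \<open>n - 1\<close> is unbounded, or it has a
  finite limit and the induction continues. The descent cannot reach order \<open>0\<close>, because a
  function far from the rational polynomials has no finite limit.\<close>

lemma split_off_rational_polynomial: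
  assumes "tchain D" "D 0 = f" "far_from_rat_polys f" "(D n \<longlongrightarrow> c) at_top"
  shows "\<exists>(r :: rat poly) D' k. tchain D' \<and> D' 0 = (\<lambda>t. f t - poly (map_poly of_rat r) t) \<and> k \<ge> 1 \<and>
     ((\<exists>\<theta>. \<theta> \<notin> \<rat> \<and> (D' k \<longlongrightarrow> \<theta>) at_top) \<or>
      ((D' k \<longlongrightarrow> 0) at_top \<and> (k = 1 \<or> filterlim (\<lambda>t. \<bar>D' (k - 1) t\<bar>) at_top at_top)))"
  using assms
proof (induction n arbitrary: D f c)
  case 0
  then show ?case using far_from_rat_polys_no_limit by blast
next
  case (Suc m)
  show ?case
  proof (cases "c \<in> \<rat>")
    case False
    then show ?thesis using Suc.prems
      by (intro exI[of _ 0] exI[of _ D] exI[of _ "Suc m"]) auto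
  next
    case True
    then obtain cr where cr: "c = of_rat cr" by (rule Rats_cases)
    define r where "r = monom (cr / fact (Suc m)) (Suc m)"
    have r: "poly (map_poly of_rat r) t = c / fact (Suc m) * t ^ Suc m" for t :: real
    proof -
      have "(of_rat (fact (Suc m)) :: real) = fact (Suc m)"
        using of_rat_of_nat_eq[of "fact (Suc m)", where 'a = real] by (simp only: of_nat_fact)
      then show ?thesis by (simp add: r_def map_poly_monom poly_monom of_rat_divide cr del: fact_Suc)
    qed
    define D' where "D' j t = D j t - (if j \<le> Suc m then c / fact (Suc m - j) * t ^ (Suc m - j) else 0)" for j t
    have D': "tchain D'" unfolding D'_def[abs_def] by (rule tchain_diff_monom[OF Suc.prems(1) True])
    have D'0: "D' 0 = (\<lambda>t. f t - poly (map_poly of_rat r) t)"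
      unfolding r using Suc.prems(2) by (simp add: D'_def fun_eq_iff)
    have far: "far_from_rat_polys (\<lambda>t. f t - poly (map_poly of_rat r) t)"
      by (rule far_from_rat_polys_diff[OF Suc.prems(3)])
    have lim: "(D' (Suc m) \<longlongrightarrow> 0) at_top"
      using tendsto_diff[OF Suc.prems(4) tendsto_const[of c]] by (simp add: D'_def[abs_def])
    show ?thesis
    proof (cases "m = 0 \<or> filterlim (\<lambda>t. \<bar>D' m t\<bar>) at_top at_top")
      case True
      then show ?thesis using D' D'0 lim
        by (intro exI[of _ r] exI[of _ D'] exI[of _ "Suc m"]) auto
    next
      case False
      then obtain c' where "(D' m \<longlongrightarrow> c') at_top" using tchain_limit_cases[OF D'] by blast
      from Suc.IH[OF D' D'0 far this] obtain r' D'' k where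
        IH: "tchain D''" "D'' 0 = (\<lambda>t. f t - poly (map_poly of_rat r) t - poly (map_poly of_rat r') t)"
        "k \<ge> 1" "(\<exists>\<theta>. \<theta> \<notin> \<rat> \<and> (D'' k \<longlongrightarrow> \<theta>) at_top) \<or>
         ((D'' k \<longlongrightarrow> 0) at_top \<and> (k = 1 \<or> filterlim (\<lambda>t. \<bar>D'' (k - 1) t\<bar>) at_top at_top))"
        by blast
      have "D'' 0 = (\<lambda>t. f t - poly (map_poly of_rat (r + r')) t)"
        unfolding IH(2) by (simp add: map_poly_of_rat_add diff_diff_eq)
      then show ?thesis using IH(1,3,4) by blast
    qed
  qed
qed

text \<open>If \<open>f\<close> is at most \<open>t\<^sup>K\<close> and its derivative of order \<open>K + 1\<close> were unbounded, then \<open>f\<close> would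
  grow at least like \<open>t\<^bsup>K+1\<^esup>\<close>.\<close>

lemma polynomial_growth_imp_finite_derivative_limit:
  assumes "tchain D" "polynomial_growth (D 0)"
  obtains n c where "(D n \<longlongrightarrow> c) at_top"
proof -
  obtain K where K: "(\<lambda>t. \<bar>D 0 t\<bar>) \<prec> (\<lambda>t. t ^ K)" using assms(2) by (auto simp: polynomial_growth_def)
  then have "\<forall>\<^sub>F t in at_top. t ^ K / \<bar>D 0 t\<bar> \<ge> 1" by (simp add: grows_slower_def filterlim_at_top)
  then have up: "\<forall>\<^sub>F t in at_top. \<bar>D 0 t\<bar> \<le> t ^ K"
  proof eventually_elim
    case (elim t)
    then show ?case by (cases "D 0 t = 0") (auto simp: field_simps)
  qed
  have "\<exists>c. (D (Suc K) \<longlongrightarrow> c) at_top"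
  proof (rule ccontr)
    assume "\<nexists>c. (D (Suc K) \<longlongrightarrow> c) at_top"
    then have inf: "filterlim (\<lambda>t. \<bar>D (Suc K) t\<bar>) at_top at_top" using tchain_limit_cases[OF assms(1)] by blast
    have "deriv_chain D" using assms(1) by (simp add: tchain_def)
    then obtain c where c: "c > 0" "\<forall>\<^sub>F t in at_top. \<bar>D 0 t\<bar> \<ge> c * t ^ Suc K"
      by (rule deriv_chain_infinite_lower_power[of D "Suc K", OF _ inf tchain_sign[OF assms(1)]])
    from c(2) up eventually_gt_at_top[of 0] eventually_gt_at_top[of "1 / c"] have "\<forall>\<^sub>F t::real in at_top. False"
    proof eventually_elim
      case (elim t)
      have "c * t * t ^ K = c * t ^ Suc K" by simp
      then have "c * t * t ^ K \<le> 1 * t ^ K" using elim by linarith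
      then have "c * t \<le> 1" by (rule mult_right_le_imp_le) (use elim(3) in simp)
      then show ?case using elim c(1) by (simp add: field_simps)
    qed
    then show False by simp
  qed
  then show ?thesis using that by blast
qed

end

section \<open>Finite differences of differentiable functions\<close>

lemma filterlim_mult_at_top:
  assumes "p > (0::real)"
  shows "filterlim (\<lambda>t. p * t) at_top at_top"
  by (rule filterlim_tendsto_pos_mult_at_top[OF tendsto_const assms filterlim_ident])

lemma deriv_chain_dilation:
  assumes "deriv_chain D" "p > 0"
  shows "deriv_chain (\<lambda>j t. p ^ j * D j (p * t))"
  unfolding deriv_chain_def ev_deriv_def
proof
  fix j
  have "\<forall>\<^sub>F t in at_top. (D j has_real_derivative D (Suc j) t) (at t)"
    using assms(1) by (simp add: deriv_chain_def ev_deriv_def)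
  then have "\<forall>\<^sub>F t in at_top. (D j has_real_derivative D (Suc j) (p * t)) (at (p * t))"
    using filterlim_mult_at_top[OF assms(2)] by (rule eventually_compose_filterlim)
  then show "\<forall>\<^sub>F t in at_top. ((\<lambda>t. p ^ j * D j (p * t)) has_real_derivative p ^ Suc j * D (Suc j) (p * t)) (at t)"
  proof eventually_elim
    case (elim t)
    have "((\<lambda>t. p * t) has_real_derivative p) (at t)" by (auto intro!: derivative_eq_intros)
    from DERIV_chain2[OF elim this] have "((\<lambda>t. D j (p * t)) has_real_derivative D (Suc j) (p * t) * p) (at t)" .
    from DERIV_cmult[OF this, of "p ^ j"] show ?case by (simp add: mult_ac)
  qed
qed

lemma deriv_chain_diff:
  "deriv_chain D \<Longrightarrow> deriv_chain D' \<Longrightarrow> deriv_chain (\<lambda>j t. D j t - D' j t)"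
  unfolding deriv_chain_def using ev_deriv_diff by blast

text \<open>Apply the induction hypothesis to \<open>t \<mapsto> G(t + 1) - G(t)\<close> and the mean value theorem to the
  outcome.\<close>

lemma fwd_diff_mean_value:
  assumes "\<And>j t. j < k \<Longrightarrow> t \<ge> T \<Longrightarrow> (G j has_real_derivative G (Suc j) t) (at t)" "real n \<ge> T"
  shows "\<exists>\<xi>. real n \<le> \<xi> \<and> \<xi> \<le> real n + real k \<and> (fwd_diff ^^ k) (\<lambda>n. G 0 (real n)) n = G k \<xi>"
  using assms
proof (induction k arbitrary: G)
  case 0
  then show ?case by auto
next
  case (Suc k)
  define G' where "G' j t = G j (t + 1) - G j t" for j t
  have fd: "fwd_diff (\<lambda>n. G 0 (real n)) = (\<lambda>n. G' 0 (real n))"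
    by (simp add: fwd_diff_def G'_def fun_eq_iff add.commute)
  have "(G' j has_real_derivative G' (Suc j) t) (at t)" if "j < k" "t \<ge> T" for j t
  proof -
    have "((\<lambda>t. G j (t + 1)) has_real_derivative G (Suc j) (t + 1)) (at t)"
      using Suc.prems(1)[of j "t + 1"] that by (simp add: DERIV_shift)
    moreover have "(G j has_real_derivative G (Suc j) t) (at t)" using Suc.prems(1)[of j t] that by simp
    ultimately show ?thesis unfolding G'_def[abs_def] by (rule DERIV_diff)
  qed
  from Suc.IH[of G', OF this Suc.prems(2)] obtain \<xi> where
    \<xi>: "real n \<le> \<xi>" "\<xi> \<le> real n + real k" "(fwd_diff ^^ k) (\<lambda>n. G' 0 (real n)) n = G' k \<xi>" by blast
  have "\<exists>z. \<xi> < z \<and> z < \<xi> + 1 \<and> G k (\<xi> + 1) - G k \<xi> = (\<xi> + 1 - \<xi>) * G (Suc k) z"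
    by (rule MVT2) (use Suc.prems \<xi> in auto)
  then obtain z where z: "\<xi> < z" "z < \<xi> + 1" "G k (\<xi> + 1) - G k \<xi> = G (Suc k) z" by auto
  have "(fwd_diff ^^ Suc k) (\<lambda>n. G 0 (real n)) n = G (Suc k) z"
    unfolding funpow_Suc_right o_def fd \<xi>(3) using z(3) by (simp add: G'_def)
  then show ?case using \<xi> z by (intro exI[of _ z]) auto
qed

lemma deriv_chain_uniform:
  assumes "deriv_chain G"
  obtains T where "T \<ge> 1" "\<And>j t. j < k \<Longrightarrow> t \<ge> T \<Longrightarrow> (G j has_real_derivative G (Suc j) t) (at t)"
proof -
  have "\<forall>\<^sub>F t in at_top. \<forall>j\<in>{..<k}. (G j has_real_derivative G (Suc j) t) (at t)"
    using assms by (intro eventually_ball_finite) (auto simp: deriv_chain_def ev_deriv_def)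
  from eventually_at_top_obtain[OF this, where lo = 1]
  obtain T where T: "T \<ge> 1" "\<And>t. t \<ge> T \<Longrightarrow> \<forall>j\<in>{..<k}. (G j has_real_derivative G (Suc j) t) (at t)"
    by blast
  show ?thesis by (rule that[OF T(1)]) (use T(2) in simp)
qed

lemma fwd_diff_tendsto:
  assumes "deriv_chain G" "(G k \<longlongrightarrow> c) at_top"
  shows "(fwd_diff ^^ k) (\<lambda>n. G 0 (real n)) \<longlonglongrightarrow> c"
proof -
  obtain T where T: "T \<ge> 1" "\<And>j t. j < k \<Longrightarrow> t \<ge> T \<Longrightarrow> (G j has_real_derivative G (Suc j) t) (at t)"
    using deriv_chain_uniform[OF assms(1)] by blast
  show ?thesis
  proof (rule tendstoI)
    fix e :: real assume "e > 0"
    then obtain S where S: "\<And>t. t \<ge> S \<Longrightarrow> dist (G k t) c < e"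
      using tendstoD[OF assms(2)] by (auto simp: eventually_at_top_linorder)
    have "\<forall>\<^sub>F n in sequentially. real n \<ge> max S T"
      using filterlim_real_sequentially unfolding filterlim_at_top by blast
    then show "\<forall>\<^sub>F n in sequentially. dist ((fwd_diff ^^ k) (\<lambda>n. G 0 (real n)) n) c < e"
    proof eventually_elim
      case (elim n)
      then have "real n \<ge> T" by simp
      from fwd_diff_mean_value[of k T G n, OF T(2) this] obtain \<xi> where
        "real n \<le> \<xi>" "(fwd_diff ^^ k) (\<lambda>n. G 0 (real n)) n = G k \<xi>" by blast
      then show ?case using S[of \<xi>] elim by simp
    qed
  qed
qed

text \<open>The \<open>k\<close>-th difference at \<open>n\<close> is a value of \<open>G\<^bsup>(k)\<^esup>\<close> between \<open>n\<close> and \<open>n + k\<close>, and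
  \<open>(n + k)\<^sup>2 \<le> (k + 1)\<^sup>2 n\<^sup>2\<close>; this accounts for the constant \<open>(k + 1)\<^sup>2\<close>.\<close>

lemma slowly_decaying_of_derivative:
  assumes G: "deriv_chain G" and lim: "(G k \<longlongrightarrow> 0) at_top"
    and neg: "\<forall>\<^sub>F t in at_top. G (Suc k) t \<le> 0"
    and W: "filterlim (\<lambda>t. t\<^sup>2 * G k t) at_top at_top"
    and W_mono: "\<And>s t. T0 \<le> s \<Longrightarrow> s \<le> t \<Longrightarrow> s\<^sup>2 * G k s \<le> t\<^sup>2 * G k t"
  shows "slowly_decaying ((fwd_diff ^^ k) (\<lambda>n. G 0 (real n)))"
proof -
  define y where "y = (fwd_diff ^^ k) (\<lambda>n. G 0 (real n))"
  obtain T1 where T1: "T1 \<ge> 1" "\<And>j t. j < Suc k \<Longrightarrow> t \<ge> T1 \<Longrightarrow> (G j has_real_derivative G (Suc j) t) (at t)"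
    using deriv_chain_uniform[OF G, of "Suc k"] by blast
  from eventually_at_top_obtain[OF neg, where lo = T1] obtain T2 where
    T2: "T2 \<ge> T1" "\<And>t. t \<ge> T2 \<Longrightarrow> G (Suc k) t \<le> 0" by blast
  define T where "T = max T2 T0"
  have T: "T \<ge> 1" "T \<ge> T1" "T \<ge> T2" "T \<ge> T0" using T1 T2 by (auto simp: T_def)
  have anti: "G k t \<le> G k s" if "T \<le> s" "s \<le> t" for s t
    by (rule DERIV_nonpos_imp_nonincreasing[OF that(2)])
       (use T1(2)[of k] T2(2) T that in \<open>meson lessI order_trans\<close>)
  have G_nonneg: "G k s \<ge> 0" if "s \<ge> T" for s
  proof (rule tendsto_upperbound[OF lim])
    show "\<forall>\<^sub>F t in at_top. G k t \<le> G k s"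
      using eventually_ge_at_top[of s] by eventually_elim (use anti that in auto)
  qed simp
  have y: "\<exists>\<xi>. real n \<le> \<xi> \<and> \<xi> \<le> real n + real k \<and> y n = G k \<xi>" if "real n \<ge> T" for n
    unfolding y_def by (rule fwd_diff_mean_value) (use T1 T that in auto)
  have y_upper: "y n \<le> G k (real n)" and y_lower: "y n \<ge> G k (real n + real k)" if "real n \<ge> T" for n
    using y[OF that] anti that by (metis order_trans)+
  have y_nonneg: "y n \<ge> 0" if "real n \<ge> T" for n
    using y_lower[OF that] G_nonneg[of "real n + real k"] that by simp
  have y_anti: "y (Suc n) \<le> y n" if "real n \<ge> T" for n
  proof -
    have "\<exists>\<xi>. real n \<le> \<xi> \<and> \<xi> \<le> real n + real (Suc k) \<and> (fwd_diff ^^ Suc k) (\<lambda>n. G 0 (real n)) n = G (Suc k) \<xi>"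
      by (rule fwd_diff_mean_value[of "Suc k" T1]) (use T1 T that in auto)
    then have "(fwd_diff ^^ Suc k) (\<lambda>n. G 0 (real n)) n \<le> 0" using T2(2) T that by (metis order_trans)
    then show ?thesis by (simp add: fwd_diff_def y_def)
  qed
  have shift: "(real n + real k)\<^sup>2 * y n \<le> (real k + 1)\<^sup>2 * ((real n)\<^sup>2 * y n)" if "real n \<ge> T" for n
  proof -
    have "real k * 1 \<le> real k * real n" using that T by (intro mult_left_mono) auto
    then have "real n + real k \<le> (real k + 1) * real n" by (simp add: algebra_simps)
    then have "(real n + real k)\<^sup>2 \<le> ((real k + 1) * real n)\<^sup>2" by (intro power_mono) auto
    then have "(real n + real k)\<^sup>2 * y n \<le> ((real k + 1) * real n)\<^sup>2 * y n"
      using y_nonneg[OF that] by (rule mult_right_mono)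
    then show ?thesis by (simp only: power_mult_distrib mult.assoc)
  qed
  have W_le: "(real m)\<^sup>2 * G k (real m) \<le> (real k + 1)\<^sup>2 * ((real n)\<^sup>2 * y n)"
    if "real m \<ge> T" "m \<le> n" for m n
  proof -
    have n: "real n \<ge> T" using that by simp
    have "(real m)\<^sup>2 * G k (real m) \<le> (real n + real k)\<^sup>2 * G k (real n + real k)"
      using W_mono[of "real m" "real n + real k"] that T by simp
    also have "\<dots> \<le> (real n + real k)\<^sup>2 * y n" using y_lower[OF n] by (intro mult_left_mono) auto
    also have "\<dots> \<le> (real k + 1)\<^sup>2 * ((real n)\<^sup>2 * y n)" by (rule shift[OF n])
    finally show ?thesis .
  qed
  have large: "\<forall>\<^sub>F n in sequentially. real n \<ge> T"
    using filterlim_real_sequentially unfolding filterlim_at_top by blast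
  have top: "filterlim (\<lambda>n. (real n)\<^sup>2 * y n) at_top sequentially"
    unfolding filterlim_at_top
  proof
    fix Z
    have "\<forall>\<^sub>F t in at_top. t\<^sup>2 * G k t \<ge> (real k + 1)\<^sup>2 * Z" using W unfolding filterlim_at_top by blast
    from eventually_compose_filterlim[OF this filterlim_real_sequentially] large
    show "\<forall>\<^sub>F n in sequentially. Z \<le> (real n)\<^sup>2 * y n"
    proof eventually_elim
      case (elim n)
      have "(real k + 1)\<^sup>2 * Z \<le> (real k + 1)\<^sup>2 * ((real n)\<^sup>2 * y n)"
        using W_le[of n n] elim by linarith
      then show ?case by (rule mult_left_le_imp_le) simp
    qed
  qed
  have reg: "(real m)\<^sup>2 * y m \<le> (real k + 1)\<^sup>2 * ((real n)\<^sup>2 * y n)" if "nat \<lceil>T\<rceil> \<le> m" "m \<le> n" for m n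
  proof -
    have m: "real m \<ge> T" using that by linarith
    have "(real m)\<^sup>2 * y m \<le> (real m)\<^sup>2 * G k (real m)" using y_upper[OF m] by (intro mult_left_mono) auto
    also have "\<dots> \<le> (real k + 1)\<^sup>2 * ((real n)\<^sup>2 * y n)" by (rule W_le[OF m that(2)])
    finally show ?thesis .
  qed
  have anti': "y (Suc n) \<le> y n" if "nat \<lceil>T\<rceil> \<le> n" for n using y_anti[of n] that by linarith
  have "(1::real) \<le> (real k + 1)\<^sup>2" by (intro one_le_power) simp
  moreover have "y \<longlonglongrightarrow> 0" unfolding y_def by (rule fwd_diff_tendsto[OF G lim])
  ultimately have "slowly_decaying y"
    unfolding slowly_decaying_def using top reg anti' by blast
  then show ?thesis by (simp add: y_def)
qed

lemma ev_deriv_nonneg_of_at_top: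
  assumes "filterlim f at_top at_top" "ev_deriv f f'" "ev_sign f'"
  shows "\<forall>\<^sub>F t in at_top. f' t \<ge> 0"
  using assms(3) unfolding ev_sign_def
proof (elim disjE)
  assume "\<forall>\<^sub>F t in at_top. f' t < 0"
  then have "\<forall>\<^sub>F t in at_top. - f' t \<ge> 0" by (rule eventually_mono) simp
  from ev_deriv_imp_mono[OF ev_deriv_uminus[OF assms(2)] this, where lo = 0]
  obtain T where T: "T \<ge> 0" "\<And>s t. T \<le> s \<Longrightarrow> s \<le> t \<Longrightarrow> - f s \<le> - f t" by blast
  have "\<forall>\<^sub>F t in at_top. f t \<ge> f T + 1" using assms(1) unfolding filterlim_at_top by blast
  then have "\<forall>\<^sub>F t::real in at_top. False" using eventually_ge_at_top[of T]
    by eventually_elim (use T(2)[of T] in force)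
  then show ?thesis by simp
qed (auto elim: eventually_mono)

lemma ev_deriv_nonpos_of_null:
  assumes "(f \<longlongrightarrow> 0) at_top" "\<forall>\<^sub>F t in at_top. f t > 0" "ev_deriv f f'" "ev_sign f'"
  shows "\<forall>\<^sub>F t in at_top. f' t \<le> 0"
  using assms(4) unfolding ev_sign_def
proof (elim disjE)
  assume "\<forall>\<^sub>F t in at_top. f' t > 0"
  then have "\<forall>\<^sub>F t in at_top. f' t \<ge> 0" by (rule eventually_mono) simp
  from ev_deriv_imp_mono[OF assms(3) this, where lo = 0]
  obtain T where T: "T \<ge> 0" "\<And>s t. T \<le> s \<Longrightarrow> s \<le> t \<Longrightarrow> f s \<le> f t" by blast
  from eventually_at_top_obtain[OF assms(2), where lo = T]
  obtain S where S: "S \<ge> T" "\<And>t. t \<ge> S \<Longrightarrow> f t > 0" by blast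
  have "\<forall>\<^sub>F t in at_top. f t < f S" using assms(1) S(2)[of S] by (intro order_tendstoD(2)) auto
  then have "\<forall>\<^sub>F t::real in at_top. False" using eventually_ge_at_top[of S]
    by eventually_elim (use T(2)[of S] S(1) in force)
  then show ?thesis by simp
qed (auto elim: eventually_mono)

lemma ev_deriv_imp_mono_ex:
  assumes "ev_deriv f f'" "\<forall>\<^sub>F t in at_top. f' t \<ge> 0"
  shows "\<exists>T. \<forall>s t. T \<le> s \<longrightarrow> s \<le> t \<longrightarrow> f s \<le> f t"
  by (rule ev_deriv_imp_mono[OF assms, where lo = 0]) metis

lemma ev_deriv_square_mult:
  assumes "ev_deriv f f'"
  shows "ev_deriv (\<lambda>t. t\<^sup>2 * f t) (\<lambda>t. 2 * t * f t + t\<^sup>2 * f' t)"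
  using assms unfolding ev_deriv_def
proof (rule eventually_mono)
  fix t assume "(f has_real_derivative f' t) (at t)"
  from DERIV_mult[OF DERIV_pow[of 2 t UNIV] this]
  show "((\<lambda>t. t\<^sup>2 * f t) has_real_derivative 2 * t * f t + t\<^sup>2 * f' t) (at t)"
    by (simp add: mult_ac)
qed

lemma null_mean0_of_derivative_pos:
  assumes G: "deriv_chain G" and k: "k \<ge> 2" and lim: "(G k \<longlongrightarrow> 0) at_top" and sg: "ev_sign (G (Suc k))"
    and W: "filterlim (\<lambda>t. t\<^sup>2 * G k t) at_top at_top"
    and W': "ev_sign (\<lambda>t. 2 * t * G k t + t\<^sup>2 * G (Suc k) t)"
  shows "null_mean0 (\<lambda>n. circ (G 0 (real n)))"
proof -
  have Gk: "ev_deriv (G k) (G (Suc k))" using G by (simp add: deriv_chain_def)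
  have dW: "ev_deriv (\<lambda>t. t\<^sup>2 * G k t) (\<lambda>t. 2 * t * G k t + t\<^sup>2 * G (Suc k) t)"
    by (rule ev_deriv_square_mult[OF Gk])
  have "\<forall>\<^sub>F t in at_top. t\<^sup>2 * G k t \<ge> 1" using W unfolding filterlim_at_top by blast
  then have pos: "\<forall>\<^sub>F t in at_top. G k t > 0"
  proof (rule eventually_mono)
    fix t assume "t\<^sup>2 * G k t \<ge> 1"
    then have "0 < t\<^sup>2 * G k t" by (rule less_le_trans[OF zero_less_one])
    then have "\<not> G k t \<le> 0" using mult_nonneg_nonpos[of "t\<^sup>2" "G k t"] by (metis not_le zero_le_power2)
    then show "G k t > 0" by (simp only: not_le)
  qed
  obtain T where T: "\<forall>s t. T \<le> s \<longrightarrow> s \<le> t \<longrightarrow> s\<^sup>2 * G k s \<le> t\<^sup>2 * G k t"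
    using ev_deriv_imp_mono_ex[OF dW ev_deriv_nonneg_of_at_top[OF W dW W']] by (elim exE)
  have "slowly_decaying ((fwd_diff ^^ k) (\<lambda>n. G 0 (real n)))"
    by (rule slowly_decaying_of_derivative[of G k, OF G lim ev_deriv_nonpos_of_null[of "G k" "G (Suc k)", OF lim pos Gk sg] W T[rule_format]])
  moreover have "k = k - 2 + 2" using k by simp
  ultimately have "slowly_decaying ((fwd_diff ^^ (k - 2 + 2)) (\<lambda>n. G 0 (real n)))" by metis
  then show ?thesis by (rule null_mean_slowly_decaying_difference)
qed

lemma null_mean0_cnj: "null_mean0 (\<lambda>n. cnj (z n)) \<longleftrightarrow> null_mean0 z"
proof -
  have "norm (\<Sum>n<N. cnj (z n)) = norm (\<Sum>n<N. z n)" for N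
    by (simp only: complex_mod_cnj flip: cnj_sum)
  then show ?thesis by (simp only: null_mean0_iff_norm)
qed

text \<open>The statement is invariant under \<open>G \<mapsto> - G\<close>, which conjugates the exponentials; so
  \<open>t\<^sup>2 G\<^bsup>(k)\<^esup>\<close> may be assumed to tend to \<open>+\<infinity>\<close>. The two sign conditions make \<open>G\<^bsup>(k)\<^esup>\<close> and
  \<open>t\<^sup>2 G\<^bsup>(k)\<^esup>\<close> monotone.\<close>

lemma null_mean0_of_derivative:
  assumes G: "deriv_chain G" and k: "k \<ge> 2" and lim: "(G k \<longlongrightarrow> 0) at_top" and sg: "ev_sign (G (Suc k))"
    and W: "filterlim (\<lambda>t. \<bar>t\<^sup>2 * G k t\<bar>) at_top at_top"
    and W': "ev_sign (\<lambda>t. 2 * t * G k t + t\<^sup>2 * G (Suc k) t)"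
  shows "null_mean0 (\<lambda>n. circ (G 0 (real n)))"
proof -
  have Gk: "ev_deriv (G k) (G (Suc k))" using G by (simp add: deriv_chain_def)
  have dW: "ev_deriv (\<lambda>t. t\<^sup>2 * G k t) (\<lambda>t. 2 * t * G k t + t\<^sup>2 * G (Suc k) t)"
    by (rule ev_deriv_square_mult[OF Gk])
  from filterlim_at_top_const_sign[OF W ev_sign_of_deriv[OF dW W']] show ?thesis
  proof
    assume "filterlim (\<lambda>t. t\<^sup>2 * G k t) at_top at_top"
    from null_mean0_of_derivative_pos[of G k, OF G k lim sg this W'] show ?thesis .
  next
    assume neg: "filterlim (\<lambda>t. - (t\<^sup>2 * G k t)) at_top at_top"
    have "null_mean0 (\<lambda>n. circ (- G 0 (real n)))"
    proof (rule null_mean0_of_derivative_pos[of "\<lambda>j t. - G j t" k, OF deriv_chain_uminus[OF G] k])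
      show "((\<lambda>t. - G k t) \<longlongrightarrow> 0) at_top" using tendsto_minus[OF lim] by simp
      show "ev_sign (\<lambda>t. - G (Suc k) t)" using sg by (simp only: ev_sign_uminus)
      show "filterlim (\<lambda>t. t\<^sup>2 * - G k t) at_top at_top" using neg by simp
      have "(\<lambda>t. 2 * t * - G k t + t\<^sup>2 * - G (Suc k) t) = (\<lambda>t. - (2 * t * G k t + t\<^sup>2 * G (Suc k) t))"
        by (simp add: fun_eq_iff)
      then show "ev_sign (\<lambda>t. 2 * t * - G k t + t\<^sup>2 * - G (Suc k) t)"
        using W' by (simp only: ev_sign_uminus)
    qed
    then show ?thesis by (simp only: circ_minus null_mean0_cnj)
  qed
qed

section \<open>Correlations of dilations\<close>

lemma ev_deriv_ln_plus_1_over_t: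
  "ev_deriv (\<lambda>t. - M * ((ln t + 1) / t)) (\<lambda>t. M * (ln t / t\<^sup>2))"
  unfolding ev_deriv_def using eventually_gt_at_top[of 0]
proof eventually_elim
  case (elim t)
  have "((\<lambda>t. (ln t + 1) / t) has_real_derivative ((1 / t) * t - (ln t + 1) * 1) / (t * t)) (at t)"
    using elim by (auto intro!: derivative_eq_intros)
  from DERIV_cmult[OF this, of "- M"] show ?case
    using elim by (simp add: power2_eq_square field_simps)
qed

lemma ev_deriv_ln_square:
  "ev_deriv (\<lambda>t. M * ((ln t)\<^sup>2 / 2 + ln t)) (\<lambda>t. M * ((ln t + 1) / t))"
  unfolding ev_deriv_def using eventually_gt_at_top[of 0]
proof eventually_elim
  case (elim t)
  have "((\<lambda>t. (ln t)\<^sup>2 / 2 + ln t) has_real_derivative (2 * ln t * (1 / t)) / 2 + 1 / t) (at t)"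
    using elim by (auto intro!: derivative_eq_intros)
  from DERIV_cmult[OF this, of M] show ?case
    using elim by (simp add: add_divide_distrib)
qed

lemma ev_deriv_power_ln:
  "ev_deriv (\<lambda>t. C * (t ^ m * ln t)) (\<lambda>t. C * (real m * t ^ (m - 1) * ln t + t ^ m / t))"
  unfolding ev_deriv_def using eventually_gt_at_top[of 0]
proof eventually_elim
  case (elim t)
  have "((\<lambda>t. t ^ m * ln t) has_real_derivative (real m * t ^ (m - 1)) * ln t + 1 / t * t ^ m) (at t)"
    using elim DERIV_pow[of m t UNIV] by (intro DERIV_mult) (auto intro!: derivative_eq_intros)
  from DERIV_cmult[OF this, of C] show ?case by simp
qed

text \<open>The function \<open>log t / t\<^sup>2\<close> is integrable at infinity, with antiderivative
  \<open>- (log t + 1) / t\<close>.\<close>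

lemma small_derivative_bounded_antiderivative:
  assumes "ev_deriv f f'" "\<forall>\<^sub>F t in at_top. \<bar>f' t\<bar> \<le> M * (ln t / t\<^sup>2)" "M \<ge> 0"
  shows "\<not> filterlim (\<lambda>t. \<bar>f t\<bar>) at_top at_top"
proof
  assume inf: "filterlim (\<lambda>t. \<bar>f t\<bar>) at_top at_top"
  obtain K where K: "K \<ge> 0" "\<forall>\<^sub>F t in at_top. \<bar>f t\<bar> \<le> - M * ((ln t + 1) / t) + K"
    by (rule ev_deriv_bound[OF assms(1) ev_deriv_ln_plus_1_over_t assms(2)])
  have "\<forall>\<^sub>F t in at_top. \<bar>f t\<bar> \<ge> K + 1" using inf unfolding filterlim_at_top by blast
  with K(2) eventually_ge_at_top[of 1] have "\<forall>\<^sub>F t::real in at_top. False"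
  proof eventually_elim
    case (elim t)
    have "M * ((ln t + 1) / t) \<ge> 0" using assms(3) elim by (intro mult_nonneg_nonneg divide_nonneg_nonneg) auto
    then show ?case using elim by simp
  qed
  then show False by simp
qed

text \<open>As \<open>f'\<close> tends to \<open>0\<close>, it is bounded by the tail integral \<open>M (log t + 1) / t\<close> of the bound
  for \<open>f''\<close>; integrating once more gives \<open>log\<^sup>2 t\<close>. This is the source of the squared
  logarithm in the growth condition.\<close>

lemma small_second_derivative_log_square:
  assumes "ev_deriv f f'" "ev_deriv f' f''" "\<forall>\<^sub>F t in at_top. \<bar>f'' t\<bar> \<le> M * (ln t / t\<^sup>2)" "M \<ge> 0"
    and lim: "(f' \<longlongrightarrow> 0) at_top"
  obtains C where "\<forall>\<^sub>F t in at_top. \<bar>f t\<bar> \<le> C * (ln t)\<^sup>2"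
proof -
  define b where "b t = M * ((ln t + 1) / t)" for t
  have db: "ev_deriv (\<lambda>t. - b t) (\<lambda>t. M * (ln t / t\<^sup>2))"
    using ev_deriv_ln_plus_1_over_t[of M] by (simp add: b_def)
  have b0: "(b \<longlongrightarrow> 0) at_top"
  proof -
    have "((\<lambda>t. M * (ln t / t + inverse t)) \<longlongrightarrow> M * (0 + 0)) at_top"
      by (rule tendsto_mult[OF tendsto_const tendsto_add[OF ln_x_over_x_tendsto_0 tendsto_inverse_0_at_top[OF filterlim_ident]]])
    then show ?thesis unfolding b_def[abs_def] by (simp add: add_divide_distrib inverse_eq_divide)
  qed
  have bound: "\<forall>\<^sub>F t in at_top. g t \<le> b t"
    if g: "ev_deriv g g'" "\<forall>\<^sub>F t in at_top. \<bar>g' t\<bar> \<le> M * (ln t / t\<^sup>2)" "(g \<longlongrightarrow> 0) at_top" for g g'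
  proof -
    have "\<forall>\<^sub>F t in at_top. g' t + M * (ln t / t\<^sup>2) \<ge> 0" by (rule eventually_mono[OF g(2)]) linarith
    from ev_deriv_imp_mono_ex[OF ev_deriv_add[OF g(1) db] this]
    obtain T where T: "\<forall>s t. T \<le> s \<longrightarrow> s \<le> t \<longrightarrow> g s + - b s \<le> g t + - b t" by (elim exE)
    have l0: "((\<lambda>t. g t + - b t) \<longlongrightarrow> 0) at_top" using tendsto_diff[OF g(3) b0] by simp
    show ?thesis
    proof (rule eventually_at_top_I[of T])
      fix s assume s: "s \<ge> T"
      have "g s + - b s \<le> 0"
      proof (rule tendsto_lowerbound[OF l0])
        show "\<forall>\<^sub>F t in at_top. g s + - b s \<le> g t + - b t"
          using eventually_ge_at_top[of s] by eventually_elim (use T s in blast)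
      qed simp
      then show "g s \<le> b s" by simp
    qed
  qed
  have "\<forall>\<^sub>F t in at_top. \<bar>f' t\<bar> \<le> b t"
  proof -
    have 1: "\<forall>\<^sub>F t in at_top. f' t \<le> b t" by (rule bound[OF assms(2,3) lim])
    have "\<forall>\<^sub>F t in at_top. - f' t \<le> b t"
      by (rule bound[OF ev_deriv_uminus[OF assms(2)]]) (use assms(3) tendsto_minus[OF lim] in simp_all)
    with 1 show ?thesis by eventually_elim (rule abs_leI)
  qed
  then obtain K where K: "K \<ge> 0" "\<forall>\<^sub>F t in at_top. \<bar>f t\<bar> \<le> M * ((ln t)\<^sup>2 / 2 + ln t) + K"
    unfolding b_def by (rule ev_deriv_bound[OF assms(1) ev_deriv_ln_square])
  show ?thesis
  proof (rule that[of "2 * M + K"])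
    show "\<forall>\<^sub>F t in at_top. \<bar>f t\<bar> \<le> (2 * M + K) * (ln t)\<^sup>2"
      using K(2) eventually_ge_at_top[of "exp 1"]
    proof eventually_elim
      case (elim t)
      have l: "ln t \<ge> 1" using elim by (simp add: ln_ge_iff less_le_trans[OF exp_gt_zero])
      then have "ln t * 1 \<le> ln t * ln t" by (intro mult_left_mono) auto
      then have l2: "ln t \<le> (ln t)\<^sup>2" by (simp add: power2_eq_square)
      have "M * ((ln t)\<^sup>2 / 2 + ln t) \<le> M * (2 * (ln t)\<^sup>2)"
        using l2 assms(4) zero_le_power2[of "ln t"] by (intro mult_left_mono) linarith+
      moreover have "K * 1 \<le> K * (ln t)\<^sup>2" using l K(1) by (intro mult_left_mono one_le_power) auto
      ultimately show ?case using elim by (simp add: distrib_right)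
    qed
  qed
qed

context hardy
begin

text \<open>Here \<open>k t\<^sup>2 f\<^bsup>(k)\<^esup> + t\<^sup>3 f\<^bsup>(k+1)\<^esup> = t\<^bsup>3-k\<^esup> (t\<^sup>k f\<^bsup>(k)\<^esup>)'\<close> is the quantity that controls
  the difference of two dilations of \<open>t\<^sup>k f\<^bsup>(k)\<^esup>\<close>. Being a polynomial in \<open>t\<close> over the Hardy
  field, it is either bounded or tends to infinity in absolute value. If it were bounded,
  integration would give \<open>t\<^sup>k f\<^bsup>(k)\<^esup> = O(t\<^bsup>k-2\<^esup> log t)\<close>, that is \<open>f\<^bsup>(k)\<^esup> = O(log t / t\<^sup>2)\<close>,
  which is incompatible with each alternative of \<open>big\<close>.\<close>

lemma twisted_derivative_at_top:
  assumes D: "tchain D" and k: "k \<ge> 2"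
    and big: "filterlim (\<lambda>t. \<bar>D (k - 1) t\<bar>) at_top at_top \<or>
       (k = 2 \<and> (D 1 \<longlongrightarrow> 0) at_top \<and> far_from_rat_polys (D 0))"
  shows "filterlim (\<lambda>t. \<bar>real k * t\<^sup>2 * D k t + t ^ 3 * D (Suc k) t\<bar>) at_top at_top"
proof (rule ccontr)
  define \<zeta> where "\<zeta> t = real k * t\<^sup>2 * D k t + t ^ 3 * D (Suc k) t" for t
  assume neg: "\<not> ?thesis"
  have chain: "ev_deriv (D j) (D (Suc j))" for j using D by (simp add: tchain_def deriv_chain_def)
  have tp: "tpolys (D j)" for j using D by (simp add: tchain_def)
  have "tpolys (\<lambda>t. real k * (t\<^sup>2 * D k t) + t ^ 3 * D (Suc k) t)"
    by (intro tpolys_add tpolys_Rats_mult tpolys_mult_power tp) auto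
  then have "tpolys \<zeta>" by (simp add: \<zeta>_def[abs_def] mult.assoc)
  then obtain c where c: "(\<zeta> \<longlongrightarrow> c) at_top"
    using tpolys_limit_cases[of \<zeta>] neg unfolding \<zeta>_def[abs_def] by blast
  define C where "C = \<bar>c\<bar> + 1"
  have C: "C > 0" by (simp add: C_def)
  have bd: "\<forall>\<^sub>F t in at_top. \<bar>\<zeta> t\<bar> < C"
    using order_tendstoD(2)[OF tendsto_rabs[OF c], of C] by (simp add: C_def)
  define m where "m = k - 2"
  have k_eq: "k = Suc (Suc m)" using k by (simp add: m_def)
  define \<psi> where "\<psi> t = t ^ k * D k t" for t
  define \<psi>' where "\<psi>' t = real k * t ^ (k - 1) * D k t + t ^ k * D (Suc k) t" for t
  have d\<psi>: "ev_deriv \<psi> \<psi>'"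
    using chain[of k] unfolding ev_deriv_def
  proof (rule eventually_mono)
    fix t assume "(D k has_real_derivative D (Suc k) t) (at t)"
    from DERIV_mult[OF DERIV_pow[of k t UNIV] this]
    show "(\<psi> has_real_derivative \<psi>' t) (at t)" by (simp add: \<psi>_def[abs_def] \<psi>'_def mult_ac)
  qed
  have "\<forall>\<^sub>F t in at_top. \<bar>\<psi>' t\<bar> \<le> C * (real m * t ^ (m - 1) * ln t + t ^ m / t)"
    using bd eventually_ge_at_top[of 1]
  proof eventually_elim
    case (elim t)
    have "\<psi>' t = t ^ m / t * \<zeta> t"
      using elim by (simp add: \<psi>'_def \<zeta>_def k_eq field_simps power2_eq_square power3_eq_cube)
    then have "\<bar>\<psi>' t\<bar> = t ^ m / t * \<bar>\<zeta> t\<bar>" using elim by (simp add: abs_mult)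
    also have "\<dots> \<le> t ^ m / t * C" using elim by (intro mult_left_mono) auto
    also have "\<dots> \<le> C * (real m * t ^ (m - 1) * ln t + t ^ m / t)"
      using elim C by (simp add: distrib_left mult.commute)
    finally show ?case .
  qed
  then obtain K where K: "K \<ge> 0" "\<forall>\<^sub>F t in at_top. \<bar>\<psi> t\<bar> \<le> C * (t ^ m * ln t) + K"
    by (rule ev_deriv_bound[OF d\<psi> ev_deriv_power_ln])
  define M where "M = C + K"
  have M: "M \<ge> 0" using C K by (simp add: M_def)
  have Dk: "\<forall>\<^sub>F t in at_top. \<bar>D k t\<bar> \<le> M * (ln t / t\<^sup>2)"
    using K(2) eventually_ge_at_top[of "exp 1"]
  proof eventually_elim
    case (elim t)
    have t: "t \<ge> 1" using elim exp_ge_add_one_self[of 1] by linarith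
    have l: "ln t \<ge> 1" using elim t by (simp add: ln_ge_iff)
    have "1 * 1 \<le> t ^ m * ln t" using t l by (intro mult_mono one_le_power) auto
    then have "K * 1 \<le> K * (t ^ m * ln t)" using K(1) by (intro mult_left_mono) auto
    then have "\<bar>\<psi> t\<bar> \<le> M * (t ^ m * ln t)" using elim by (simp add: M_def distrib_right)
    moreover have "\<bar>\<psi> t\<bar> = t ^ m * (t\<^sup>2 * \<bar>D k t\<bar>)"
      using t by (simp add: \<psi>_def k_eq abs_mult power2_eq_square mult_ac)
    ultimately have "t ^ m * (t\<^sup>2 * \<bar>D k t\<bar>) \<le> t ^ m * (M * ln t)" by (simp add: mult_ac)
    then have "t\<^sup>2 * \<bar>D k t\<bar> \<le> M * ln t" by (rule mult_left_le_imp_le) (use t in simp)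
    then show ?case using t by (simp add: pos_le_divide_eq mult.commute)
  qed
  from big show False
  proof (elim disjE conjE)
    assume inf: "filterlim (\<lambda>t. \<bar>D (k - 1) t\<bar>) at_top at_top"
    have "ev_deriv (D (k - 1)) (D k)" using chain[of "k - 1"] k by simp
    from small_derivative_bounded_antiderivative[OF this Dk M] inf show False by blast
  next
    assume k2: "k = 2" and lim: "(D 1 \<longlongrightarrow> 0) at_top" and far: "far_from_rat_polys (D 0)"
    have ch: "ev_deriv (D 0) (D 1)" "ev_deriv (D 1) (D k)"
      using chain[of 0] chain[of 1] by (simp_all add: k2 numeral_2_eq_2)
    obtain C' where "\<forall>\<^sub>F t in at_top. \<bar>D 0 t\<bar> \<le> C' * (ln t)\<^sup>2"
      by (rule small_second_derivative_log_square[OF ch Dk M lim])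
    with far_from_rat_polys_dominates[OF far, of C'] have "\<forall>\<^sub>F t::real in at_top. False"
      by eventually_elim simp
    then show False by simp
  qed
qed

end

lemma null_mean_of_null_mean0:
  assumes "null_mean0 w" "\<And>n. norm (w n) \<le> 1"
  shows "null_mean w"
  unfolding null_mean_def
proof -
  have eq: "avg w N = (\<Sum>n<N. w n) / of_nat N + (w N - w 0) / of_nat N" for N
  proof -
    have "(\<Sum>n=1..N. w n) = (\<Sum>n<N. w (Suc n))"
      by (rule sum.reindex_bij_witness[of _ Suc "\<lambda>n. n - 1"]) auto
    also have "\<dots> = (\<Sum>n<N. w n) + (\<Sum>n<N. w (Suc n) - w n)"
      by (simp add: sum_subtractf)
    also have "(\<Sum>n<N. w (Suc n) - w n) = w N - w 0" by (rule sum_lessThan_telescope)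
    finally show ?thesis by (simp add: avg_def add_divide_distrib)
  qed
  have "(\<lambda>N. (w N - w 0) / of_nat N) \<longlonglongrightarrow> 0"
  proof (rule Lim_null_comparison)
    show "\<forall>\<^sub>F N in sequentially. norm ((w N - w 0) / of_nat N) \<le> 2 / real N"
    proof (intro always_eventually allI)
      fix N
      have "norm (w N - w 0) \<le> 2"
        using norm_triangle_ineq4[of "w N" "w 0"] assms(2)[of N] assms(2)[of 0] by linarith
      then show "norm ((w N - w 0) / of_nat N) \<le> 2 / real N"
        unfolding norm_divide norm_of_nat by (rule divide_right_mono) simp
    qed
  qed (rule lim_const_over_n)
  from tendsto_add[OF assms(1)[unfolded null_mean0_def] this]
  show "avg w \<longlonglongrightarrow> 0" unfolding eq[abs_def] by simp
qed

context hardy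
begin

text \<open>With \<open>G(t) = f(pt) - f(qt)\<close> one has \<open>t\<^sup>j G\<^bsup>(j)\<^esup>(t) = \<psi>(pt) - \<psi>(qt)\<close> for
  \<open>\<psi>(t) = t\<^sup>j f\<^bsup>(j)\<^esup>(t)\<close>, a polynomial in \<open>t\<close> over the Hardy field. This gives the signs
  that \<open>null_mean0_of_derivative\<close> requires, and the mean value theorem for \<open>\<psi>\<close> together with
  \<open>twisted_derivative_at_top\<close> gives \<open>t\<^sup>2 G\<^bsup>(k)\<^esup> \<rightarrow> \<infinity>\<close>.\<close>

lemma dilation_differences_null_mean:
  assumes D: "tchain D" and k: "k \<ge> 1" and pq: "1 \<le> q" "q < p"
    and alt: "(\<exists>\<theta>. \<theta> \<notin> \<rat> \<and> (D k \<longlongrightarrow> \<theta>) at_top) \<or>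
      ((D k \<longlongrightarrow> 0) at_top \<and> (k = 1 \<or> filterlim (\<lambda>t. \<bar>D (k - 1) t\<bar>) at_top at_top))"
    and far: "far_from_rat_polys (D 0)"
  shows "null_mean0 (\<lambda>n. circ (D 0 (real p * real n) - D 0 (real q * real n)))"
proof -
  define G where "G j t = real p ^ j * D j (real p * t) - real q ^ j * D j (real q * t)" for j t
  have chain: "deriv_chain D" and chainj: "\<And>j. ev_deriv (D j) (D (Suc j))" and tp: "\<And>j. tpolys (D j)"
    using D by (auto simp: tchain_def deriv_chain_def)
  have ppos: "real p > 0" "real q > 0" using pq by auto
  have G: "deriv_chain G" unfolding G_def[abs_def]
    by (intro deriv_chain_diff deriv_chain_dilation chain ppos)
  have limG: "(G j \<longlongrightarrow> (real p ^ j - real q ^ j) * c) at_top" if "(D j \<longlongrightarrow> c) at_top" for j c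
  proof -
    have "((\<lambda>t. D j (real r * t)) \<longlongrightarrow> c) at_top" if "real r > 0" for r
      by (rule filterlim_compose[OF \<open>(D j \<longlongrightarrow> c) at_top\<close> filterlim_mult_at_top[OF that]])
    then have "(G j \<longlongrightarrow> real p ^ j * c - real q ^ j * c) at_top"
      unfolding G_def[abs_def] using ppos by (intro tendsto_diff tendsto_mult tendsto_const) auto
    then show ?thesis by (simp add: left_diff_distrib)
  qed
  have G0: "circ (D 0 (real p * real n) - D 0 (real q * real n)) = circ (G 0 (real n))" for n
    by (simp add: G_def)
  from alt consider (irrational) \<theta> where "\<theta> \<notin> \<rat>" "(D k \<longlongrightarrow> \<theta>) at_top"
    | (decay) "(D k \<longlongrightarrow> 0) at_top" "k = 1 \<or> filterlim (\<lambda>t. \<bar>D (k - 1) t\<bar>) at_top at_top" by blast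
  then show ?thesis
  proof cases
    case \<theta>: irrational
    obtain k' where k': "k = Suc k'" using k by (cases k) auto
    have "(fwd_diff ^^ Suc k') (\<lambda>n. G 0 (real n)) \<longlonglongrightarrow> (real p ^ k - real q ^ k) * \<theta>"
      unfolding k'[symmetric] by (rule fwd_diff_tendsto[OF G limG[OF \<theta>(2)]])
    moreover have "(real p ^ k - real q ^ k) * \<theta> \<notin> \<rat>"
    proof
      assume R: "(real p ^ k - real q ^ k) * \<theta> \<in> \<rat>"
      have "real q ^ k < real p ^ k" using pq k by (intro power_strict_mono) auto
      then have ne: "real p ^ k - real q ^ k \<noteq> 0" by simp
      have "real p ^ k - real q ^ k \<in> \<rat>" by (intro Rats_diff Rats_power Rats_of_nat)
      from Rats_divide[OF R this] show False using ne \<theta>(1) by simp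
    qed
    ultimately have "null_mean0 (\<lambda>n. circ (G 0 (real n)))" by (rule null_mean_irrational_difference)
    then show ?thesis by (simp only: G0)
  next
    case decay
    note lim = decay(1) and big = decay(2)
    \<comment> \<open>the difference test needs order at least 2; for \<open>k = 1\<close> the second derivative also tends to 0\<close>
    define K where "K = max k 2"
    have K2: "K \<ge> 2" by (simp add: K_def)
    have K: "(D K \<longlongrightarrow> 0) at_top \<and> (filterlim (\<lambda>t. \<bar>D (K - 1) t\<bar>) at_top at_top \<or>
       (K = 2 \<and> (D 1 \<longlongrightarrow> 0) at_top \<and> far_from_rat_polys (D 0)))"
    proof (cases "k = 1")
      case True
      have "(D 2 \<longlongrightarrow> 0) at_top"
      proof -
        have ch: "deriv_chain (\<lambda>j. D (Suc j))" by (rule deriv_chain_Suc[OF chain])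
        have D1: "\<forall>\<^sub>F t in at_top. \<bar>D 1 t\<bar> < 1"
          using order_tendstoD(2)[OF tendsto_rabs[OF lim], of 1] True by simp
        have no_lower: False if c: "c > 0" "\<forall>\<^sub>F t in at_top. s * D 2 t \<ge> c" and s: "s = 1 \<or> s = - 1" for c s
        proof -
          have sc: "deriv_chain (\<lambda>j t. s * D (Suc j) t)"
            using s ch deriv_chain_uminus[OF ch] by auto
          have "\<forall>\<^sub>F t in at_top. s * D (Suc 1) t \<ge> c" using c(2) by (simp add: numeral_2_eq_2)
          then obtain c' where c': "c' > 0" "\<forall>\<^sub>F t in at_top. s * D (Suc 0) t \<ge> c' * t ^ 1"
            by (rule deriv_chain_lower_power[OF sc c(1)])
          from c'(2) D1 eventually_ge_at_top[of "1 / c'"] have "\<forall>\<^sub>F t::real in at_top. False"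
          proof eventually_elim
            case (elim t)
            have "1 \<le> c' * t" using elim(3) c'(1) by (simp add: field_simps)
            then have "1 \<le> s * D 1 t" using elim(1) by simp
            then show ?case using s elim(2) by auto
          qed
          then show False by simp
        qed
        have no_inf: "\<not> filterlim (\<lambda>t. s * D 2 t) at_top at_top" if "s = 1 \<or> s = - 1" for s
        proof
          assume "filterlim (\<lambda>t. s * D 2 t) at_top at_top"
          then have "\<forall>\<^sub>F t in at_top. s * D 2 t \<ge> 1" unfolding filterlim_at_top by blast
          from no_lower[OF zero_less_one this that] show False .
        qed
        have "\<not> filterlim (\<lambda>t. \<bar>D 2 t\<bar>) at_top at_top"
        proof
          assume "filterlim (\<lambda>t. \<bar>D 2 t\<bar>) at_top at_top"
          from filterlim_at_top_const_sign[OF this tchain_sign[OF D]] no_inf[of 1] no_inf[of "- 1"]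
          show False by simp
        qed
        then obtain c where c: "(D 2 \<longlongrightarrow> c) at_top" using tchain_limit_cases[OF D] by blast
        have "c = 0"
        proof (rule ccontr)
          assume "c \<noteq> 0"
          define s where "s = sgn c"
          have s: "s = 1 \<or> s = - 1" "s * c > 0" using \<open>c \<noteq> 0\<close> by (auto simp: s_def sgn_if)
          have "\<forall>\<^sub>F t in at_top. s * D 2 t > s * c / 2"
            by (rule order_tendstoD(1)[OF tendsto_mult[OF tendsto_const c]]) (use s(2) in linarith)
          then have "\<forall>\<^sub>F t in at_top. s * D 2 t \<ge> s * c / 2" by (rule eventually_mono) simp
          from no_lower[OF _ this s(1)] s(2) show False by simp
        qed
        with c show ?thesis by simp
      qed
      moreover have "K = 2" using True by (simp add: K_def)
      ultimately show ?thesis using True lim far by (simp only: simp_thms)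
    next
      case False
      then have "K = k" using k by (simp add: K_def)
      then show ?thesis using lim big False by simp
    qed
    define \<zeta> where "\<zeta> t = real K * t\<^sup>2 * D K t + t ^ 3 * D (Suc K) t" for t
    have \<zeta>: "filterlim (\<lambda>t. \<bar>\<zeta> t\<bar>) at_top at_top"
      unfolding \<zeta>_def by (rule twisted_derivative_at_top[OF D K2]) (use K in blast)
    have dil: "ev_sign (\<lambda>t. \<psi> (real p * t) - \<psi> (real q * t))" if \<psi>: "tpolys \<psi>" for \<psi>
    proof -
      obtain \<psi>' where "tpolys \<psi>'" "ev_deriv \<psi> \<psi>'" by (rule tpolys_deriv[OF \<psi>])
      then show ?thesis using ev_sign_dilation_diff[OF _ _ ppos] tpolys_sign by blast
    qed
    have divide: "ev_sign f" if "ev_sign (\<lambda>t. t ^ j * f t)" for f :: "real \<Rightarrow> real" and j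
    proof -
      have "\<forall>\<^sub>F t in at_top. (1 / t ^ j) > (0::real)" using eventually_gt_at_top[of 0] by eventually_elim simp
      then have "ev_sign (\<lambda>t. 1 / t ^ j)" by (simp add: ev_sign_def)
      from ev_sign_mult[OF this that] have "ev_sign (\<lambda>t. 1 / t ^ j * (t ^ j * f t))" .
      moreover have "\<forall>\<^sub>F t in at_top. 1 / t ^ j * (t ^ j * f t) = f t"
        using eventually_gt_at_top[of 0] by eventually_elim simp
      from ev_sign_cong[OF this] calculation show ?thesis by (simp only:)
    qed
    have sg: "ev_sign (G (Suc K))"
    proof (rule divide[of "Suc K"])
      have "(\<lambda>t. t ^ Suc K * G (Suc K) t) = (\<lambda>t. (\<lambda>s. s ^ Suc K * D (Suc K) s) (real p * t) - (\<lambda>s. s ^ Suc K * D (Suc K) s) (real q * t))"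
        by (simp only: G_def power_mult_distrib right_diff_distrib mult_ac)
      then show "ev_sign (\<lambda>t. t ^ Suc K * G (Suc K) t)" using dil[OF tpolys_mult_power[OF tp]] by (simp only:)
    qed
    have W': "ev_sign (\<lambda>t. 2 * t * G K t + t\<^sup>2 * G (Suc K) t)"
    proof (rule divide[of "K - 1"])
      define \<Theta> where "\<Theta> s = 2 * (s ^ K * D K s) + s ^ Suc K * D (Suc K) s" for s
      have "tpolys \<Theta>" unfolding \<Theta>_def[abs_def]
        by (intro tpolys_add tpolys_Rats_mult tpolys_mult_power tp) auto
      moreover have "(\<lambda>t. t ^ (K - 1) * (2 * t * G K t + t\<^sup>2 * G (Suc K) t)) = (\<lambda>t. \<Theta> (real p * t) - \<Theta> (real q * t))"
      proof
        fix t :: real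
        have e: "t ^ K = t ^ (K - 1) * t" "t ^ Suc K = t ^ (K - 1) * t\<^sup>2"
          using K2 by (simp_all add: power_Suc2[symmetric] power_add[symmetric])
        have "t ^ (K - 1) * (2 * t * G K t + t\<^sup>2 * G (Suc K) t) = 2 * (t ^ K * G K t) + t ^ Suc K * G (Suc K) t"
          unfolding e by (simp add: algebra_simps)
        also have "\<dots> = \<Theta> (real p * t) - \<Theta> (real q * t)"
          by (simp only: \<Theta>_def G_def power_mult_distrib) (simp add: algebra_simps)
        finally show "t ^ (K - 1) * (2 * t * G K t + t\<^sup>2 * G (Suc K) t) = \<Theta> (real p * t) - \<Theta> (real q * t)" .
      qed
      ultimately show "ev_sign (\<lambda>t. t ^ (K - 1) * (2 * t * G K t + t\<^sup>2 * G (Suc K) t))"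
        using dil[of \<Theta>] by (simp only:)
    qed
    have W: "filterlim (\<lambda>t. \<bar>t\<^sup>2 * G K t\<bar>) at_top at_top"
      unfolding filterlim_at_top
    proof
      fix Z
      define m where "m = K - 2"
      have K_eq: "K = Suc (Suc m)" using K2 by (simp add: m_def)
      define \<psi>' where "\<psi>' t = real K * t ^ (K - 1) * D K t + t ^ K * D (Suc K) t" for t
      have d\<psi>: "\<forall>\<^sub>F t in at_top. ((\<lambda>t. t ^ K * D K t) has_real_derivative \<psi>' t) (at t)"
        using chainj[of K] unfolding ev_deriv_def
      proof (rule eventually_mono)
        fix t assume "(D K has_real_derivative D (Suc K) t) (at t)"
        from DERIV_mult[OF DERIV_pow[of K t UNIV] this]
        show "((\<lambda>t. t ^ K * D K t) has_real_derivative \<psi>' t) (at t)" by (simp add: \<psi>'_def mult_ac)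
      qed
      have "\<forall>\<^sub>F t in at_top. \<bar>\<zeta> t\<bar> \<ge> real p * \<bar>Z\<bar>" using \<zeta> unfolding filterlim_at_top by blast
      with d\<psi> have "\<forall>\<^sub>F t in at_top. ((\<lambda>t. t ^ K * D K t) has_real_derivative \<psi>' t) (at t) \<and> \<bar>\<zeta> t\<bar> \<ge> real p * \<bar>Z\<bar>"
        by (rule eventually_conj)
      then obtain T where T: "\<And>t. t \<ge> T \<Longrightarrow> ((\<lambda>t. t ^ K * D K t) has_real_derivative \<psi>' t) (at t) \<and> \<bar>\<zeta> t\<bar> \<ge> real p * \<bar>Z\<bar>"
        by (auto simp: eventually_at_top_linorder)
      show "\<forall>\<^sub>F t in at_top. Z \<le> \<bar>t\<^sup>2 * G K t\<bar>"
      proof (rule eventually_at_top_I[of "max T 1"])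
        fix t assume t: "t \<ge> max T 1"
        have lt: "real q * t < real p * t" using t pq by simp
        have qt: "real q * t \<ge> t" using t pq by simp
        obtain \<xi> where \<xi>: "real q * t < \<xi>" "\<xi> < real p * t"
          "(real p * t) ^ K * D K (real p * t) - (real q * t) ^ K * D K (real q * t) = (real p * t - real q * t) * \<psi>' \<xi>"
          using MVT2[OF lt, of "\<lambda>t. t ^ K * D K t" \<psi>'] T t qt by (meson max.boundedE order_trans)
        have tT: "t \<ge> T" "t \<ge> 1" using t by auto
        have x: "\<xi> > 0" "\<xi> \<ge> t" "\<xi> \<ge> T" using \<xi>(1) qt tT by linarith+
        have "t ^ m * (t\<^sup>2 * G K t) = (real p * t - real q * t) * \<psi>' \<xi>"
          unfolding \<xi>(3)[symmetric] G_def K_eq by (simp add: power_mult_distrib power2_eq_square algebra_simps)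
        also have "\<psi>' \<xi> = \<xi> ^ m / \<xi> * \<zeta> \<xi>"
          using x by (simp add: \<psi>'_def \<zeta>_def K_eq field_simps power2_eq_square power3_eq_cube)
        finally have e: "t ^ m * (t\<^sup>2 * G K t) = ((real p - real q) * t * (\<xi> ^ m / \<xi>)) * \<zeta> \<xi>"
          by (simp add: algebra_simps)
        have "0 \<le> (real p - real q) * t * (\<xi> ^ m / \<xi>)" using x tT pq by simp
        with e have "\<bar>t ^ m * (t\<^sup>2 * G K t)\<bar> = (real p - real q) * t * (\<xi> ^ m / \<xi>) * \<bar>\<zeta> \<xi>\<bar>"
          by (simp only: abs_mult[of _ "\<zeta> \<xi>"] abs_of_nonneg)
        moreover have "\<bar>t ^ m * (t\<^sup>2 * G K t)\<bar> = t ^ m * \<bar>t\<^sup>2 * G K t\<bar>"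
          using tT abs_mult[of "t ^ m" "t\<^sup>2 * G K t"] by (simp only: power_abs abs_of_nonneg)
        ultimately have "t ^ m * \<bar>t\<^sup>2 * G K t\<bar> = (real p - real q) * t * (\<xi> ^ m / \<xi>) * \<bar>\<zeta> \<xi>\<bar>"
          by simp
        also have "\<dots> \<ge> (1 * t * (\<xi> ^ m / (real p * t))) * (real p * \<bar>Z\<bar>)"
        proof (intro mult_mono)
          show "(1::real) \<le> real p - real q" using pq by linarith
          show "\<xi> ^ m / (real p * t) \<le> \<xi> ^ m / \<xi>" using \<xi> x by (intro divide_left_mono) auto
          show "real p * \<bar>Z\<bar> \<le> \<bar>\<zeta> \<xi>\<bar>" using T x by blast
        qed (use t x pq in auto)
        also have "(1 * t * (\<xi> ^ m / (real p * t))) * (real p * \<bar>Z\<bar>) = \<xi> ^ m * \<bar>Z\<bar>"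
          using t ppos by simp
        finally have "\<xi> ^ m * \<bar>Z\<bar> \<le> t ^ m * \<bar>t\<^sup>2 * G K t\<bar>" by simp
        moreover have "t ^ m * \<bar>Z\<bar> \<le> \<xi> ^ m * \<bar>Z\<bar>" using x t by (intro mult_right_mono power_mono) auto
        ultimately have "t ^ m * \<bar>Z\<bar> \<le> t ^ m * \<bar>t\<^sup>2 * G K t\<bar>" by linarith
        then have "\<bar>Z\<bar> \<le> \<bar>t\<^sup>2 * G K t\<bar>" by (rule mult_left_le_imp_le) (use t in simp)
        then show "Z \<le> \<bar>t\<^sup>2 * G K t\<bar>" by linarith
      qed
    qed
    have "(G K \<longlongrightarrow> 0) at_top" using limG[of K 0] K by simp
    from null_mean0_of_derivative[of G K, OF G K2 this sg W W'] show ?thesis by (simp only: G0)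
  qed
qed

text \<open>Dividing the phase \<open>h\<close> into \<open>r\<close> and \<open>f\<close> is necessary: for a rational polynomial such as
  \<open>h(t) = t / 2\<close> the dilations of \<open>e(h(n))\<close> by two odd primes are perfectly correlated.\<close>

theorem hardy_dilation_correlations:
  assumes "hfun h" "polynomial_growth h" "far_from_rat_polys h"
  obtains r :: "rat poly" and f where "\<And>t. h t = poly (map_poly of_rat r) t + f t"
    "\<And>p q. 1 \<le> p \<Longrightarrow> 1 \<le> q \<Longrightarrow> p \<noteq> q \<Longrightarrow>
       null_mean (\<lambda>n. circ (f (real (p * n))) * cnj (circ (f (real (q * n)))))"
proof -
  obtain D where D: "D 0 = h" "tchain D" by (rule tchain_exists[OF tpolys_hfun[OF assms(1)]])
  obtain n c where "(D n \<longlongrightarrow> c) at_top"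
    using polynomial_growth_imp_finite_derivative_limit[OF D(2)] assms(2) D(1) by blast
  from split_off_rational_polynomial[OF D(2,1) assms(3) this] obtain r D' k where
    D': "tchain D'" "D' 0 = (\<lambda>t. h t - poly (map_poly of_rat r) t)" "k \<ge> 1"
     "(\<exists>\<theta>. \<theta> \<notin> \<rat> \<and> (D' k \<longlongrightarrow> \<theta>) at_top) \<or>
      ((D' k \<longlongrightarrow> 0) at_top \<and> (k = 1 \<or> filterlim (\<lambda>t. \<bar>D' (k - 1) t\<bar>) at_top at_top))"
    by blast
  have far: "far_from_rat_polys (D' 0)" unfolding D'(2) by (rule far_from_rat_polys_diff[OF assms(3)])
  have lt: "null_mean0 (\<lambda>n. circ (D' 0 (real (p * n))) * cnj (circ (D' 0 (real (q * n)))))"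
    if "1 \<le> q" "q < p" for p q
    using dilation_differences_null_mean[OF D'(1,3) that D'(4) far] by (simp only: circ_diff of_nat_mult)
  have "null_mean0 (\<lambda>n. circ (D' 0 (real (p * n))) * cnj (circ (D' 0 (real (q * n)))))"
    if pq: "1 \<le> p" "1 \<le> q" "p \<noteq> q" for p q
  proof (cases "q < p")
    case False
    then have "null_mean0 (\<lambda>n. circ (D' 0 (real (q * n))) * cnj (circ (D' 0 (real (p * n)))))"
      using lt[of p q] pq by simp
    then have "null_mean0 (\<lambda>n. cnj (circ (D' 0 (real (q * n))) * cnj (circ (D' 0 (real (p * n))))))"
      by (simp only: null_mean0_cnj)
    then show ?thesis by (simp only: complex_cnj_mult complex_cnj_cnj mult.commute)
  qed (use lt pq in blast)
  then have "null_mean (\<lambda>n. circ (D' 0 (real (p * n))) * cnj (circ (D' 0 (real (q * n)))))"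
    if "1 \<le> p" "1 \<le> q" "p \<noteq> q" for p q
    by (rule null_mean_of_null_mean0) (use that in \<open>simp_all add: norm_mult\<close>)
  then show ?thesis by (intro that[of r "D' 0"]) (simp_all add: D'(2))
qed

end

section \<open>The sum of the reciprocals of the primes\<close>

lemma finite_subset_large_sum:
  assumes "\<not> f summable_on S" "\<And>x. x \<in> S \<Longrightarrow> f x \<ge> (0::real)"
  obtains P where "finite P" "P \<subseteq> S" "sum f P \<ge> R"
proof -
  have "\<not> bdd_above (sum f ` {P. P \<subseteq> S \<and> finite P})"
    using nonneg_bdd_above_summable_on[of S f] assms by blast
  then obtain P where "P \<subseteq> S" "finite P" "sum f P > R"
    unfolding bdd_above_def by (auto simp: not_le)
  then show ?thesis using that[of P] by simp
qed

lemma finite_set_with_small_quotient: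
  assumes S: "\<not> (\<lambda>p. 1 / real p) summable_on S" and C: "C > 0" and e: "e > 0"
  obtains P where "finite P" "P \<subseteq> S" "(\<Sum>p\<in>P. 1 / real p) \<ge> 1" "C / sqrt (\<Sum>p\<in>P. 1 / real p) \<le> e"
proof -
  obtain P where P: "finite P" "P \<subseteq> S" "(\<Sum>p\<in>P. 1 / real p) \<ge> max 1 ((C / e)\<^sup>2)"
    by (rule finite_subset_large_sum[of "\<lambda>p. 1 / real p" S "max 1 ((C / e)\<^sup>2)", OF S]) auto
  have "C / e = sqrt ((C / e)\<^sup>2)" using C e by simp
  also have "\<dots> \<le> sqrt (\<Sum>p\<in>P. 1 / real p)" using P(3) by (intro real_sqrt_le_mono) simp
  finally have le: "C / e \<le> sqrt (\<Sum>p\<in>P. 1 / real p)" .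
  moreover have "C / e > 0" using C e by simp
  ultimately have pos: "sqrt (\<Sum>p\<in>P. 1 / real p) > 0" by linarith
  have "C \<le> sqrt (\<Sum>p\<in>P. 1 / real p) * e" using le e by (simp only: pos_divide_le_eq)
  then have "C / sqrt (\<Sum>p\<in>P. 1 / real p) \<le> e" using pos by (simp only: pos_divide_le_eq mult.commute)
  then show ?thesis using that P by simp
qed

lemma squarefree_eq_prod_prime_factors:
  assumes "squarefree (n :: nat)"
  shows "n = \<Prod>(prime_factors n)"
proof -
  have n0: "n \<noteq> 0" using assms by (metis not_squarefree_0)
  have n: "n \<noteq> 0" "\<And>p. p \<in> prime_factors n \<Longrightarrow> multiplicity p n = 1"
    using assms n0 squarefree_factorial_semiring'[OF n0] by blast+
  have "n = (\<Prod>p\<in>prime_factors n. p ^ multiplicity p n)"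
    using prod_prime_factors[OF n(1)] by simp
  also have "\<dots> = \<Prod>(prime_factors n)" using n(2) by (intro prod.cong) auto
  finally show ?thesis .
qed

lemma smooth_numbers_card_le:
  assumes F: "finite F"
  shows "card {n\<in>{1..M\<^sup>2}. prime_factors n \<subseteq> F} \<le> 2 ^ card F * M"
proof -
  have "{n\<in>{1..M\<^sup>2}. prime_factors n \<subseteq> F} \<subseteq> (\<lambda>(S, m). \<Prod>S * m\<^sup>2) ` (Pow F \<times> {1..M})"
  proof
    fix n assume n: "n \<in> {n\<in>{1..M\<^sup>2}. prime_factors n \<subseteq> F}"
    define s m where "s = squarefree_part n" and "m = square_part n"
    have dec: "n = s * m\<^sup>2" unfolding s_def m_def by (rule squarefree_decompose)
    have m0: "m \<noteq> 0" "s \<noteq> 0" using n dec by (auto intro!: Nat.gr0I)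
    have "s \<ge> 1" using m0 by simp
    then have "m\<^sup>2 \<le> n" using dec by simp
    also have "n \<le> M\<^sup>2" using n by simp
    finally have "m \<le> M" by (simp add: power2_nat_le_eq_le)
    moreover have "s dvd n" using dec by simp
    then have "prime_factors s \<subseteq> F" using n dvd_prime_factors[of n s] by auto
    moreover have "s = \<Prod>(prime_factors s)"
      by (rule squarefree_eq_prod_prime_factors) (simp add: s_def)
    ultimately show "n \<in> (\<lambda>(S, m). \<Prod>S * m\<^sup>2) ` (Pow F \<times> {1..M})"
      using dec m0 by (intro image_eqI[of _ _ "(prime_factors s, m)"]) auto
  qed
  then have "card {n\<in>{1..M\<^sup>2}. prime_factors n \<subseteq> F} \<le> card ((\<lambda>(S, m). \<Prod>S * m\<^sup>2) ` (Pow F \<times> {1..M}))"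
    using F by (intro card_mono finite_imageI finite_cartesian_product) auto
  also have "\<dots> \<le> card (Pow F \<times> {1..M})" using F by (intro card_image_le) auto
  also have "\<dots> = 2 ^ card F * M" using F by (simp add: card_cartesian_product card_Pow)
  finally show ?thesis .
qed

text \<open>Erdos's argument: if the reciprocals of the primes outside a finite set \<open>F\<close> add up to at
  most \<open>1/2\<close>, then at least half of the integers up to \<open>N = M\<^sup>2\<close> have all their prime
  factors in \<open>F\<close>. But such an integer is a square times a product of distinct elements of
  \<open>F\<close>, so that there are at most \<open>2\<^bsup>|F|\<^esup> M\<close> of them; the choice of \<open>M\<close> makes this \<open>N / 4\<close>.\<close>

theorem prime_reciprocals_not_summable: "\<not> (\<lambda>p. 1 / real p) summable_on {p. prime p}"
proof
  assume summ: "(\<lambda>p. 1 / real p) summable_on {p. prime p}"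
  define f where "f p = 1 / real p" for p :: nat
  define X where "X = sum f ` {P. P \<subseteq> {p. prime p} \<and> finite P}"
  have bdd: "bdd_above X"
  proof (rule bdd_aboveI)
    fix s assume "s \<in> X"
    then obtain P where P: "P \<subseteq> {p. prime p}" "finite P" "s = sum f P" by (auto simp: X_def)
    show "s \<le> infsum f {p. prime p}"
      unfolding P(3) using P summ by (intro finite_sum_le_infsum) (auto simp: f_def[abs_def])
  qed
  have "sum f {} \<in> X" unfolding X_def by (rule imageI) simp
  then have ne: "X \<noteq> {}" by blast
  obtain F where F: "F \<subseteq> {p. prime p}" "finite F" "sum f F > Sup X - 1 / 2"
  proof -
    have "Sup X - 1 / 2 < Sup X" by simp
    then obtain s where "s \<in> X" "s > Sup X - 1 / 2" using less_cSup_iff[OF ne bdd] by blast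
    then show ?thesis using that by (auto simp: X_def)
  qed
  have tail: "sum f P \<le> 1 / 2" if P: "P \<subseteq> {p. prime p} - F" "finite P" for P
  proof -
    have "sum f (F \<union> P) = sum f F + sum f P" using P F by (intro sum.union_disjoint) auto
    moreover have "sum f (F \<union> P) \<le> Sup X"
      using P F by (intro cSup_upper bdd) (auto simp: X_def)
    ultimately show ?thesis using F(3) by linarith
  qed
  define M :: nat where "M = 2 ^ (card F + 2)"
  define N where "N = M\<^sup>2"
  have M: "M > 0" by (simp add: M_def)
  define P where "P = {p. prime p \<and> p \<le> N} - F"
  have finP: "finite P" unfolding P_def by (rule finite_Diff, rule finite_subset[of _ "{..N}"]) auto
  have cover: "{1..N} \<subseteq> {n\<in>{1..M\<^sup>2}. prime_factors n \<subseteq> F} \<union> (\<Union>p\<in>P. {n\<in>{1..N}. p dvd n})"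
  proof
    fix n assume n: "n \<in> {1..N}"
    show "n \<in> {n\<in>{1..M\<^sup>2}. prime_factors n \<subseteq> F} \<union> (\<Union>p\<in>P. {n\<in>{1..N}. p dvd n})"
    proof (cases "prime_factors n \<subseteq> F")
      case False
      then obtain p where p: "prime p" "p dvd n" "p \<notin> F" by (auto simp: prime_factors_dvd)
      then have "p \<le> N" using n dvd_imp_le[of p n] by auto
      then show ?thesis using p n by (auto simp: P_def)
    qed (use n in \<open>simp add: N_def\<close>)
  qed
  have card_mult: "real (card {n\<in>{1..N}. p dvd n}) \<le> real N * f p" if "p \<in> P" for p
  proof -
    have "p > 0" using that by (simp add: P_def prime_gt_0_nat)
    then have "card {n\<in>{1..N}. p dvd n} = N div p"
      unfolding multiples_upto[OF \<open>p > 0\<close>] by (subst card_image) (auto simp: inj_on_def)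
    then show ?thesis using of_nat_div_le_of_nat[of N p, where 'a = real] by (simp add: f_def)
  qed
  have "N = card {1..N}" by simp
  also have "\<dots> \<le> card ({n\<in>{1..M\<^sup>2}. prime_factors n \<subseteq> F} \<union> (\<Union>p\<in>P. {n\<in>{1..N}. p dvd n}))"
    using finP by (intro card_mono cover) auto
  also have "\<dots> \<le> card {n\<in>{1..M\<^sup>2}. prime_factors n \<subseteq> F} + card (\<Union>p\<in>P. {n\<in>{1..N}. p dvd n})"
    by (rule card_Un_le)
  also have "\<dots> \<le> 2 ^ card F * M + (\<Sum>p\<in>P. card {n\<in>{1..N}. p dvd n})"
    by (intro add_mono smooth_numbers_card_le F(2) card_UN_le finP)
  finally have "real N \<le> real (2 ^ card F * M) + (\<Sum>p\<in>P. real (card {n\<in>{1..N}. p dvd n}))"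
    by (metis of_nat_add of_nat_le_iff of_nat_sum)
  also have "(\<Sum>p\<in>P. real (card {n\<in>{1..N}. p dvd n})) \<le> (\<Sum>p\<in>P. real N * f p)"
    by (intro sum_mono card_mult)
  also have "\<dots> = real N * sum f P" by (simp add: sum_distrib_left)
  also have "\<dots> \<le> real N * (1 / 2)"
    using finP by (intro mult_left_mono tail) (auto simp: P_def)
  finally have le: "real N \<le> real (2 ^ card F * M) + real N * (1 / 2)" by simp
  have "real (2 ^ card F * M) = real N / 4"
    by (simp add: N_def M_def power2_eq_square)
  moreover have "real N > 0" using M by (simp add: N_def)
  ultimately show False using le by linarith
qed

section \<open>Orthogonality of level sets to a phase\<close>

lemma periodic_mod:
  assumes "\<And>n. v (n + Q) = v (n :: nat)"
  shows "v n = v (n mod Q)"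
proof -
  have "v (m + k * Q) = v m" for m k
  proof (induction k)
    case (Suc k)
    have "v (m + Suc k * Q) = v (m + k * Q + Q)" by (simp add: add_ac)
    also have "\<dots> = v m" using assms Suc by simp
    finally show ?case .
  qed simp
  from this[of "n mod Q" "n div Q"] show ?thesis by simp
qed

text \<open>The phase \<open>e(h(n))\<close> is the product of a periodic factor \<open>v\<close> and a sequence \<open>a\<close> whose
  dilations by distinct primes are uncorrelated.\<close>

locale decorrelated_phase =
  fixes a v :: "nat \<Rightarrow> complex" and Q :: nat
  assumes norm_a: "norm (a n) \<le> 1" and norm_v: "norm (v n) \<le> 1"
    and Q: "Q > 0" and periodic: "v (n + Q) = v n"
    and corr: "\<lbrakk>prime p; prime q; p \<noteq> q\<rbrakk> \<Longrightarrow> null_mean (\<lambda>n. a (p * n) * cnj (a (q * n)))"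
begin

definition orthogonal :: "(nat \<Rightarrow> complex) \<Rightarrow> bool" where
  "orthogonal u \<longleftrightarrow> null_mean (\<lambda>n. u n * (v n * a n))"

text \<open>The classes are refined by the residue of \<open>p\<close> modulo \<open>Q\<close>, because \<open>v (p * m)\<close> depends on
  \<open>p\<close> only through it. This multiplies the bound \<open>B\<close> by \<open>Q\<close>.\<close>

lemma correlation_bound:
  fixes u :: "nat \<Rightarrow> complex" and P :: "nat set" and c :: "nat \<Rightarrow> complex"
    and x :: "'k \<Rightarrow> nat \<Rightarrow> complex" and \<kappa> :: "nat \<Rightarrow> 'k"
  assumes P: "finite P" "\<And>p. p \<in> P \<Longrightarrow> prime p"
    and u: "\<And>n. n \<ge> 1 \<Longrightarrow> norm (u n) \<le> 1"
    and c: "\<And>p. p \<in> P \<Longrightarrow> norm (c p) \<le> 1"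
    and x: "\<And>m. m \<ge> 1 \<Longrightarrow> (\<Sum>k\<in>\<kappa> ` P. (norm (x k m))\<^sup>2) \<le> B" and B: "B \<ge> 1"
    and u_eq: "\<And>p m. p \<in> P \<Longrightarrow> m \<ge> 1 \<Longrightarrow> \<not> p dvd m \<Longrightarrow> u (p * m) = c p * x (\<kappa> p) m"
    and A: "(\<Sum>p\<in>P. 1 / real p) \<ge> 1"
  shows "\<forall>\<^sub>F N in sequentially. norm (avg (\<lambda>n. u n * (v n * a n)) N)
     \<le> 5 * sqrt (B * Q) / sqrt (\<Sum>p\<in>P. 1 / real p)"
proof -
  define \<kappa>' where "\<kappa>' p = (\<kappa> p, p mod Q)" for p
  define x' where "x' k m = x (fst k) m * v (snd k * m)" for k m
  have v_mod: "v n = v (n mod Q)" for n by (rule periodic_mod[of v Q, OF periodic])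
  have "\<forall>\<^sub>F N in sequentially. norm (avg (\<lambda>n. (u n * v n) * a n) N)
     \<le> 5 * sqrt (B * Q) / sqrt (\<Sum>p\<in>P. 1 / real p)"
  proof (rule katai_bound[where c = c and x = x' and \<kappa> = \<kappa>'])
    show "norm (u n * v n) \<le> 1" if "n \<ge> 1" for n
      unfolding norm_mult using u[OF that] norm_v[of n] by (intro mult_le_one) auto
    show "(\<Sum>k\<in>\<kappa>' ` P. (norm (x' k m))\<^sup>2) \<le> B * real Q" if "m \<ge> 1" for m
    proof -
      have fin: "finite (\<kappa> ` P)" using P(1) by simp
      have "(\<Sum>k\<in>\<kappa>' ` P. (norm (x' k m))\<^sup>2) \<le> (\<Sum>k\<in>\<kappa> ` P \<times> {..<Q}. (norm (x' k m))\<^sup>2)"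
        using fin Q by (intro sum_mono2) (auto simp: \<kappa>'_def)
      also have "\<dots> \<le> (\<Sum>k\<in>\<kappa> ` P \<times> {..<Q}. (norm (x (fst k) m))\<^sup>2)"
        unfolding x'_def norm_mult using norm_v
        by (intro sum_mono power_mono) (auto simp: mult_left_le)
      also have "\<dots> = (\<Sum>k\<in>\<kappa> ` P. \<Sum>\<rho><Q. (norm (x k m))\<^sup>2)"
        by (subst sum.cartesian_product) (simp only: case_prod_unfold)
      also have "\<dots> = (\<Sum>k\<in>\<kappa> ` P. (norm (x k m))\<^sup>2) * real Q"
        by (simp add: mult.commute flip: sum_distrib_left)
      also have "\<dots> \<le> B * real Q" using x[OF that] by (intro mult_right_mono) auto
      finally show ?thesis .
    qed
    have "real Q \<ge> 1" using Q by simp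
    then show "1 \<le> B * real Q" using B mult_mono[of 1 B 1 "real Q"] by simp
    show "u (p * m) * v (p * m) = c p * x' (\<kappa>' p) m" if "p \<in> P" "m \<ge> 1" "\<not> p dvd m" for p m
    proof -
      have "v (p * m) = v (p mod Q * m)"
        using v_mod[of "p * m"] v_mod[of "p mod Q * m"] by (simp add: mod_mult_left_eq)
      then show ?thesis using u_eq[OF that] by (simp add: x'_def \<kappa>'_def)
    qed
  qed (use P norm_a c corr A in auto)
  then show ?thesis by (simp only: mult.assoc)
qed

text \<open>The finite set \<open>P\<close> of primes in \<open>S\<close> is arbitrary as long as its reciprocals have a large
  sum, whereas \<open>B\<close> does not depend on it.\<close>

lemma orthogonal_of_classes:
  fixes u :: "nat \<Rightarrow> complex" and S :: "nat set" and c :: "nat \<Rightarrow> complex"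
    and x :: "'k \<Rightarrow> nat \<Rightarrow> complex" and \<kappa> :: "nat \<Rightarrow> 'k"
  assumes S: "\<And>p. p \<in> S \<Longrightarrow> prime p" "\<not> (\<lambda>p. 1 / real p) summable_on S"
    and u: "\<And>n. n \<ge> 1 \<Longrightarrow> norm (u n) \<le> 1"
    and c: "\<And>p. p \<in> S \<Longrightarrow> norm (c p) \<le> 1"
    and x: "\<And>P m. finite P \<Longrightarrow> P \<subseteq> S \<Longrightarrow> m \<ge> 1 \<Longrightarrow> (\<Sum>k\<in>\<kappa> ` P. (norm (x k m))\<^sup>2) \<le> B"
    and B: "B \<ge> 1"
    and u_eq: "\<And>p m. p \<in> S \<Longrightarrow> m \<ge> 1 \<Longrightarrow> \<not> p dvd m \<Longrightarrow> u (p * m) = c p * x (\<kappa> p) m"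
  shows "orthogonal u"
  unfolding orthogonal_def
proof (rule null_mean_approx)
  fix e :: real assume e: "e > 0"
  define C where "C = 5 * sqrt (B * real Q)"
  have C: "C > 0" using B Q by (simp add: C_def)
  obtain P where P: "finite P" "P \<subseteq> S" "(\<Sum>p\<in>P. 1 / real p) \<ge> 1" "C / sqrt (\<Sum>p\<in>P. 1 / real p) \<le> e"
    by (rule finite_set_with_small_quotient[OF S(2) C e])
  have "\<forall>\<^sub>F N in sequentially. norm (avg (\<lambda>n. u n * (v n * a n)) N) \<le> C / sqrt (\<Sum>p\<in>P. 1 / real p)"
    unfolding C_def
    by (rule correlation_bound[where c = c and x = x and \<kappa> = \<kappa>]) (use P S(1) u c x B u_eq in auto)
  moreover note P(4)
  ultimately have "\<forall>\<^sub>F N in sequentially. norm (avg (\<lambda>n. u n * (v n * a n)) N) \<le> e"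
    by (auto elim: eventually_mono)
  then show "\<exists>g. null_mean g \<and> (\<forall>\<^sub>F N in sequentially. norm (avg (\<lambda>n. u n * (v n * a n) - g n) N) \<le> e)"
    by (intro exI[of _ "\<lambda>_. 0"]) (simp add: null_mean_zero)
qed

lemma orthogonal_multiplicative:
  assumes "multiplicative f" "\<And>n. n \<ge> 1 \<Longrightarrow> norm (f n) \<le> 1"
  shows "orthogonal f"
proof (rule orthogonal_of_classes[where S = "{p. prime p}" and c = f and x = "\<lambda>_. f" and \<kappa> = "\<lambda>_. ()" and B = 1])
  fix P :: "nat set" and m :: nat assume "m \<ge> 1"
  have "(\<Sum>k\<in>(\<lambda>_. ()) ` P. (norm (f m))\<^sup>2) \<le> (\<Sum>k\<in>{()}. (norm (f m))\<^sup>2)" by (intro sum_mono2) auto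
  also have "\<dots> \<le> 1" using assms(2)[OF \<open>m \<ge> 1\<close>] by (simp add: power_le_one)
  finally show "(\<Sum>k\<in>(\<lambda>_. ()) ` P. (norm (f m))\<^sup>2) \<le> 1" .
next
  fix p m :: nat assume p: "p \<in> {p. prime p}" and m: "m \<ge> 1" "\<not> p dvd m"
  then have "coprime p m" by (simp add: prime_imp_coprime)
  then show "f (p * m) = f p * f m" using assms(1) p m prime_ge_1_nat[of p] unfolding multiplicative_def by auto
next
  show "norm (f p) \<le> 1" if "p \<in> {p. prime p}" for p
    by (rule assms(2)) (use that prime_ge_1_nat in blast)
qed (use assms prime_reciprocals_not_summable in auto)

text \<open>For primes with \<open>f p = z\<close> the value \<open>f (p * m) = z * f m\<close> does not depend on \<open>p\<close>, so one
  class suffices; and these primes are numerous by the definition of a concentration point.\<close>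

lemma orthogonal_E_cpt:
  assumes "E \<in> E_cpt"
  shows "orthogonal (\<lambda>n. of_bool (n \<in> E))"
proof -
  obtain f K z where E: "E = {n. n \<ge> 1 \<and> f n \<in> K}" "multiplicative f" "concentration_point f z"
    using assms by (auto simp: E_cpt_def)
  show ?thesis
  proof (rule orthogonal_of_classes[where S = "{p. prime p \<and> f p = z}" and c = "\<lambda>_. 1"
        and x = "\<lambda>_ m. of_bool (z * f m \<in> K)" and \<kappa> = "\<lambda>_. ()" and B = 1])
    fix P :: "nat set" and m :: nat
    have "(\<Sum>k\<in>(\<lambda>_. ()) ` P. (norm (of_bool (z * f m \<in> K) :: complex))\<^sup>2)
      \<le> (\<Sum>k\<in>{()}. (norm (of_bool (z * f m \<in> K) :: complex))\<^sup>2)" by (intro sum_mono2) auto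
    also have "\<dots> \<le> 1" by simp
    finally show "(\<Sum>k\<in>(\<lambda>_. ()) ` P. (norm (of_bool (z * f m \<in> K) :: complex))\<^sup>2) \<le> 1" .
  next
    fix p m :: nat assume p: "p \<in> {p. prime p \<and> f p = z}" and m: "m \<ge> 1" "\<not> p dvd m"
    then have "coprime p m" by (simp add: prime_imp_coprime)
    then have "f (p * m) = z * f m" using E(2) p m prime_ge_1_nat[of p] unfolding multiplicative_def by auto
    moreover have "p * m \<ge> 1" using p m prime_ge_1_nat[of p] by simp
    ultimately show "(of_bool (p * m \<in> E) :: complex) = 1 * of_bool (z * f m \<in> K)" by (simp add: E(1))
  qed (use E(3) in \<open>auto simp: concentration_point_def\<close>)
qed

text \<open>The class of a prime is the vector of its values \<open>f i p\<close>, where only the vanishing is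
  recorded if \<open>z i = 0\<close>. Given \<open>m\<close>, the classes \<open>k\<close> with \<open>x k m \<noteq> 0\<close> lie in a product of \<open>r\<close>
  sets with at most two elements: \<open>{0, 1}\<close> if \<open>z i = 0\<close>, and \<open>{z i / f i m}\<close> otherwise.\<close>

lemma orthogonal_D_class:
  assumes "E \<in> D_class r"
  shows "orthogonal (\<lambda>n. of_bool (n \<in> E))"
proof -
  obtain f z where E: "E = {n. n \<ge> 1 \<and> (\<forall>i\<in>{1..r}. f i n = z i)}" "\<And>i. i \<in> {1..r} \<Longrightarrow> multiplicative (f i)"
    using assms by (auto simp: D_class_def)
  define \<kappa> where "\<kappa> p = restrict (\<lambda>i. if z i = 0 then of_bool (f i p \<noteq> 0) else f i p) {1..r}" for p
  define x :: "(nat \<Rightarrow> complex) \<Rightarrow> nat \<Rightarrow> complex" where "x k m = of_bool (\<forall>i\<in>{1..r}. k i * f i m = z i)" for k m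
  show ?thesis
  proof (rule orthogonal_of_classes[where S = "{p. prime p}" and c = "\<lambda>_. 1" and x = x and \<kappa> = \<kappa> and B = "2 ^ r"])
    fix P :: "nat set" and m :: nat assume P: "finite P"
    define T where "T = PiE {1..r} (\<lambda>i. if z i = 0 then {0, 1} else {z i / f i m})"
    have finT: "finite T" unfolding T_def by (intro finite_PiE) auto
    have "(\<Sum>k\<in>\<kappa> ` P. (norm (x k m))\<^sup>2) = (\<Sum>k\<in>\<kappa> ` P \<inter> T. (norm (x k m))\<^sup>2)"
    proof (rule sum.mono_neutral_right)
      show "\<forall>k\<in>\<kappa> ` P - \<kappa> ` P \<inter> T. (norm (x k m))\<^sup>2 = 0"
      proof
        fix k assume k: "k \<in> \<kappa> ` P - \<kappa> ` P \<inter> T"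
        then obtain p where p: "k = \<kappa> p" "k \<notin> T" by blast
        have "\<not> (\<forall>i\<in>{1..r}. k i * f i m = z i)"
        proof
          assume eq: "\<forall>i\<in>{1..r}. k i * f i m = z i"
          have "k \<in> T" unfolding T_def
          proof (rule PiE_I)
            fix i assume i: "i \<in> {1..r}"
            show "k i \<in> (if z i = 0 then {0, 1} else {z i / f i m})"
            proof (cases "z i = 0")
              case True
              then show ?thesis using i by (simp add: p \<kappa>_def)
            next
              case False
              have "k i * f i m = z i" using eq i by blast
              then have "f i m \<noteq> 0" using False by auto
              then have "k i = z i / f i m" using \<open>k i * f i m = z i\<close> by (simp add: nonzero_eq_divide_eq)
              then show ?thesis using False by simp
            qed
          next
            fix i assume "i \<notin> {1..r}"
            then show "k i = undefined" unfolding p(1) \<kappa>_def by (rule restrict_apply[THEN trans, OF if_not_P])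
          qed
          then show False using p by simp
        qed
        then show "(norm (x k m))\<^sup>2 = 0" by (simp add: x_def)
      qed
    qed (use P in auto)
    also have "\<dots> \<le> (\<Sum>k\<in>\<kappa> ` P \<inter> T. 1)" by (intro sum_mono) (auto simp: x_def)
    also have "\<dots> = real (card (\<kappa> ` P \<inter> T))" by simp
    also have "\<dots> \<le> real (card T)" using finT by (intro of_nat_mono card_mono) auto
    also have "card T = (\<Prod>i\<in>{1..r}. card (if z i = 0 then {0, 1 :: complex} else {z i / f i m}))"
      unfolding T_def by (rule card_PiE) simp
    also have "real \<dots> \<le> (\<Prod>i\<in>{1..r}. 2)"
      unfolding of_nat_prod by (intro prod_mono) auto
    finally show "(\<Sum>k\<in>\<kappa> ` P. (norm (x k m))\<^sup>2) \<le> 2 ^ r" by simp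
  next
    fix p m :: nat assume p: "p \<in> {p. prime p}" and m: "m \<ge> 1" "\<not> p dvd m"
    then have cop: "coprime p m" by (simp add: prime_imp_coprime)
    have "f i (p * m) = z i \<longleftrightarrow> \<kappa> p i * f i m = z i" if i: "i \<in> {1..r}" for i
    proof -
      have "f i (p * m) = f i p * f i m"
        using E(2)[OF i] cop p m prime_ge_1_nat[of p] unfolding multiplicative_def by auto
      then show ?thesis using i by (simp add: \<kappa>_def)
    qed
    moreover have "p * m \<ge> 1" using p m prime_ge_1_nat[of p] by simp
    ultimately show "(of_bool (p * m \<in> E) :: complex) = 1 * x (\<kappa> p) m" by (simp add: E(1) x_def)
  qed (use prime_reciprocals_not_summable in auto)
qed

end

section \<open>Sets with finitely many boundary points\<close>

text \<open>Within \<open>S\<close>, membership in \<open>A\<close> is locally constant except at the points of \<open>F\<close>. These must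
  be nonzero, as products with the values of a multiplicative function will be separated
  near them. That \<open>F\<close> is nonempty is for the sake of \<open>infdist\<close>, which is \<open>0\<close> by convention
  for the empty set.\<close>

definition tame :: "complex set \<Rightarrow> complex set \<Rightarrow> complex set \<Rightarrow> bool" where
  "tame S F A \<longleftrightarrow> finite F \<and> F \<noteq> {} \<and> 0 \<notin> F \<and>
     (\<forall>x\<in>S-F. \<exists>d>0. \<forall>y\<in>S. dist y x < d \<longrightarrow> (y \<in> A \<longleftrightarrow> x \<in> A))"

text \<open>A continuous approximation of the indicator function of \<open>A\<close> from below that vanishes on
  \<open>F\<close> and is exact at distance \<open>e\<close> from \<open>F\<close>.\<close>

definition cutoff :: "complex set \<Rightarrow> real \<Rightarrow> complex set \<Rightarrow> complex \<Rightarrow> real" where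
  "cutoff F e A x = of_bool (x \<in> A) * min 1 (infdist x F / e)"

lemma cutoff_bounds: "e > 0 \<Longrightarrow> 0 \<le> cutoff F e A x" "cutoff F e A x \<le> of_bool (x \<in> A)"
  by (auto simp: cutoff_def infdist_nonneg)

lemma cutoff_neq_near:
  assumes "cutoff F e A x \<noteq> of_bool (x \<in> A)" "e > 0" "finite F" "F \<noteq> {}"
  shows "\<exists>y\<in>F. dist x y < e"
proof -
  have "infdist x F < e" using assms(1,2) by (auto simp: cutoff_def min_def split: if_splits)
  moreover obtain y where "y \<in> F" "infdist x F = dist x y"
    using infdist_attains_inf[of F x] assms(3,4) finite_imp_closed by blast
  ultimately show ?thesis by auto
qed

lemma continuous_on_cutoff:
  assumes "tame S F A" "e > 0"
  shows "continuous_on S (cutoff F e A)"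
  unfolding continuous_on_def
proof
  fix x assume x: "x \<in> S"
  have F: "finite F" "F \<noteq> {}" using assms(1) by (auto simp: tame_def)
  have lim: "((\<lambda>y. min 1 (infdist y F / e)) \<longlongrightarrow> min 1 (infdist x F / e)) (at x within S)"
    using assms(2) by (intro tendsto_intros tendsto_infdist) auto
  show "(cutoff F e A \<longlongrightarrow> cutoff F e A x) (at x within S)"
  proof (cases "x \<in> F")
    case True
    then have 0: "infdist x F = 0" by simp
    have "(cutoff F e A \<longlongrightarrow> 0) (at x within S)"
    proof (rule Lim_null_comparison)
      show "((\<lambda>y. min 1 (infdist y F / e)) \<longlongrightarrow> 0) (at x within S)" using lim 0 by simp
      have "norm (cutoff F e A y) \<le> min 1 (infdist y F / e)" for y
        using assms(2) by (auto simp: cutoff_def infdist_nonneg)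
      then show "\<forall>\<^sub>F y in at x within S. norm (cutoff F e A y) \<le> min 1 (infdist y F / e)"
        by (intro always_eventually allI)
    qed
    then show ?thesis using 0 by (simp add: cutoff_def)
  next
    case False
    then obtain d where d: "d > 0" "\<forall>y\<in>S. dist y x < d \<longrightarrow> (y \<in> A \<longleftrightarrow> x \<in> A)"
      using assms(1) x by (auto simp: tame_def)
    have "((\<lambda>y. of_bool (x \<in> A) * min 1 (infdist y F / e)) \<longlongrightarrow> cutoff F e A x) (at x within S)"
      unfolding cutoff_def by (intro tendsto_mult tendsto_const lim)
    moreover have "\<forall>\<^sub>F y in at x within S. of_bool (x \<in> A) * min 1 (infdist y F / e) = cutoff F e A y"
      unfolding eventually_at using d by (intro exI[of _ d]) (auto simp: cutoff_def)
    ultimately show ?thesis by (rule Lim_transform_eventually)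
  qed
qed

lemma tame_Int:
  assumes "tame S F A" "tame S F' A'"
  shows "tame S (F \<union> F') (A \<inter> A')"
  unfolding tame_def
proof (intro conjI ballI)
  fix x assume x: "x \<in> S - (F \<union> F')"
  then obtain d d' where d: "d > 0" "\<forall>y\<in>S. dist y x < d \<longrightarrow> (y \<in> A \<longleftrightarrow> x \<in> A)"
    "d' > 0" "\<forall>y\<in>S. dist y x < d' \<longrightarrow> (y \<in> A' \<longleftrightarrow> x \<in> A')"
    using assms unfolding tame_def by (metis DiffD1 DiffD2 DiffI UnCI)
  show "\<exists>d>0. \<forall>y\<in>S. dist y x < d \<longrightarrow> (y \<in> A \<inter> A' \<longleftrightarrow> x \<in> A \<inter> A')"
    using d by (intro exI[of _ "min d d'"]) auto
qed (use assms in \<open>auto simp: tame_def\<close>)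

text \<open>Intervals of all kinds, bounded or not, are treated alike: membership of \<open>x\<close> depends only
  on its position relative to two real numbers \<open>a\<close> and \<open>b\<close>.\<close>

lemma interval_order_type:
  assumes "is_interval (I :: real set)"
  obtains a b where "\<And>x y. (x < a \<longleftrightarrow> y < a) \<Longrightarrow> (x > a \<longleftrightarrow> y > a) \<Longrightarrow> (x < b \<longleftrightarrow> y < b) \<Longrightarrow> (x > b \<longleftrightarrow> y > b)
     \<Longrightarrow> x \<in> I \<longleftrightarrow> y \<in> I"
proof -
  obtain a b where "I = {} \<or> I = UNIV \<or> I = {..<b} \<or> I = {..b} \<or> I = {a<..} \<or> I = {a..} \<or>
      I = {a<..<b} \<or> I = {a<..b} \<or> I = {a..<b} \<or> I = {a..b}"
    using is_real_interval[OF assms] by blast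
  then have "x \<in> I \<longleftrightarrow> y \<in> I" if "(x < a \<longleftrightarrow> y < a)" "(x > a \<longleftrightarrow> y > a)" "(x < b \<longleftrightarrow> y < b)" "(x > b \<longleftrightarrow> y > b)" for x y
    using that by (elim disjE) (auto simp: not_less[symmetric])
  then show ?thesis using that by blast
qed

lemma interval_locally_constant:
  assumes ab: "\<And>x y. (x < a \<longleftrightarrow> y < a) \<Longrightarrow> (x > a \<longleftrightarrow> y > a) \<Longrightarrow> (x < b \<longleftrightarrow> y < b) \<Longrightarrow> (x > b \<longleftrightarrow> y > b)
     \<Longrightarrow> x \<in> I \<longleftrightarrow> y \<in> I"
    and d: "\<bar>x - a\<bar> \<ge> d" "\<bar>x - b\<bar> \<ge> d" "\<bar>y - x\<bar> < (d::real)"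
  shows "x \<in> I \<longleftrightarrow> y \<in> I"
  by (rule ab) (use d in linarith)+

text \<open>The value \<open>0\<close> cannot be an exceptional point, so membership of \<open>0\<close> is redefined to agree
  with that of small positive numbers. The point \<open>1\<close> is added to \<open>F\<close> to make it nonempty.\<close>

lemma tame_radial:
  assumes "is_interval (I :: real set)"
  obtains F A where "tame (of_real ` {0..1}) F A" "\<And>r. r > 0 \<Longrightarrow> of_real r \<in> A \<longleftrightarrow> r \<in> I"
proof -
  obtain a b where ab: "\<And>x y. (x < a \<longleftrightarrow> y < a) \<Longrightarrow> (x > a \<longleftrightarrow> y > a) \<Longrightarrow> (x < b \<longleftrightarrow> y < b) \<Longrightarrow> (x > b \<longleftrightarrow> y > b)
     \<Longrightarrow> x \<in> I \<longleftrightarrow> y \<in> I"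
    using interval_order_type[OF assms] by blast
  \<comment> \<open>near 0 the interval either contains all small positive numbers or none\<close>
  define c where "c = (if a > 0 then if b > 0 then min a b else a else if b > 0 then b else 1)"
  have c: "c > 0" by (auto simp: c_def)
  have near0: "x \<in> I \<longleftrightarrow> c / 2 \<in> I" if "0 < x" "x < c" for x
    by (rule ab) (use that in \<open>auto simp: c_def split: if_splits\<close>)
  define J where "J = {r. if r > 0 then r \<in> I else c / 2 \<in> I}"
  have J: "\<exists>d>0. \<forall>y\<ge>0. \<bar>y - x\<bar> < d \<longrightarrow> (y \<in> J \<longleftrightarrow> x \<in> J)" if x: "x \<ge> 0" "x \<notin> {a, b} - {0}" for x
  proof (cases "x = 0")
    case True
    have "y \<in> J \<longleftrightarrow> x \<in> J" if "y \<ge> 0" "\<bar>y - x\<bar> < c" for y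
    proof (cases "y = 0")
      case False
      then have "y \<in> I \<longleftrightarrow> c / 2 \<in> I" using that True by (intro near0) auto
      then show ?thesis using True False that by (simp add: J_def)
    qed (simp add: True)
    then show ?thesis using c by blast
  next
    case False
    define d where "d = Min {x, \<bar>x - a\<bar>, \<bar>x - b\<bar>}"
    have d: "d > 0" "d \<le> x" "d \<le> \<bar>x - a\<bar>" "d \<le> \<bar>x - b\<bar>" using False x by (auto simp: d_def)
    have "y \<in> J \<longleftrightarrow> x \<in> J" if "\<bar>y - x\<bar> < d" for y
    proof -
      have "x \<in> I \<longleftrightarrow> y \<in> I" by (rule interval_locally_constant[OF ab d(3,4) that])
      moreover have "y > 0" "x > 0" using that d by linarith+
      ultimately show ?thesis by (simp add: J_def)
    qed
    then show ?thesis using d(1) by blast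
  qed
  have "tame (of_real ` {0..1}) (insert 1 (of_real ` ({a, b} - {0}))) (of_real ` J)"
    unfolding tame_def
  proof (intro conjI ballI)
    fix x :: complex assume x: "x \<in> of_real ` {0..1} - insert 1 (of_real ` ({a, b} - {0}))"
    then obtain r where r: "x = of_real r" "r \<ge> 0" by auto
    have r': "r \<notin> {a, b} - {0}"
    proof
      assume "r \<in> {a, b} - {0}"
      then have "x \<in> of_real ` ({a, b} - {0})" unfolding r(1) by (rule imageI)
      with x show False by blast
    qed
    from J[OF r(2) r'] obtain d where d: "d > 0" "\<forall>y\<ge>0. \<bar>y - r\<bar> < d \<longrightarrow> (y \<in> J \<longleftrightarrow> r \<in> J)" by blast
    show "\<exists>d>0. \<forall>y\<in>of_real ` {0..1}. dist y x < d \<longrightarrow> (y \<in> of_real ` J \<longleftrightarrow> x \<in> of_real ` J)"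
    proof (intro exI conjI ballI impI)
      fix y :: complex assume y: "y \<in> of_real ` {0..1}" "dist y x < d"
      then obtain t where t: "y = of_real t" "t \<ge> 0" by auto
      have "\<bar>t - r\<bar> < d" using y(2) by (simp add: t(1) r(1) dist_of_real dist_real_def)
      then have "t \<in> J \<longleftrightarrow> r \<in> J" using d(2) t(2) by blast
      then show "y \<in> of_real ` J \<longleftrightarrow> x \<in> of_real ` J" by (simp add: t(1) r(1) inj_image_mem_iff inj_of_real)
    qed (rule d(1))
  qed auto
  moreover have "of_real r \<in> (of_real ` J :: complex set) \<longleftrightarrow> r \<in> I" if "r > 0" for r
    using that by (simp add: inj_image_mem_iff inj_of_real J_def)
  ultimately show ?thesis using that by blast
qed

text \<open>Continuity of the argument at \<open>1\<close>, transported by a rotation; hence \<open>d\<close> is uniform in \<open>\<theta>\<close>.\<close>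

lemma circ_local_lift:
  assumes "\<eta> > 0"
  obtains d where "d > 0" "\<And>\<theta> y. norm y = 1 \<Longrightarrow> dist y (circ \<theta>) < d \<Longrightarrow> \<exists>\<tau>. \<bar>\<tau>\<bar> < \<eta> \<and> y = circ (\<theta> + \<tau>)"
proof -
  have "isCont Arg 1" by (rule continuous_at_Arg) simp
  moreover have "2 * pi * \<eta> > 0" using assms by simp
  ultimately have "\<exists>d>0. \<forall>w. dist w 1 < d \<longrightarrow> dist (Arg w) (Arg 1) < 2 * pi * \<eta>"
    unfolding continuous_at_eps_delta by (drule_tac spec[of _ "2 * pi * \<eta>"]) (rule mp)
  then obtain d where d: "d > 0" "\<And>w. dist w 1 < d \<Longrightarrow> dist (Arg w) (Arg 1) < 2 * pi * \<eta>"
    by blast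
  show ?thesis
  proof (rule that[OF d(1)])
    fix \<theta> y assume y: "norm y = 1" "dist y (circ \<theta>) < d"
    define w where "w = y / circ \<theta>"
    have nw: "norm w = 1" using y by (simp add: w_def norm_divide)
    have "w - 1 = (y - circ \<theta>) / circ \<theta>" by (simp add: w_def diff_divide_distrib)
    then have "dist w 1 = dist y (circ \<theta>)" by (simp add: dist_norm norm_divide)
    then have "dist (Arg w) (Arg 1) < 2 * pi * \<eta>" using d(2)[of w] y(2) by simp
    then have "\<bar>Arg w\<bar> < \<eta> * (2 * pi)" by (simp add: dist_real_def mult_ac)
    then have "\<bar>Arg w\<bar> / (2 * pi) < \<eta>" by (subst pos_divide_less_eq) auto
    then have "\<bar>Arg w / (2 * pi)\<bar> < \<eta>" by simp
    moreover have "w \<noteq> 0" using nw by auto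
    then have "circ (Arg w / (2 * pi)) = w" using nw by (simp add: circ_def cis_Arg sgn_div_norm)
    ultimately have "\<bar>Arg w / (2 * pi)\<bar> < \<eta>" "circ (Arg w / (2 * pi)) = w" by auto
    then show "\<exists>\<tau>. \<bar>\<tau>\<bar> < \<eta> \<and> y = circ (\<theta> + \<tau>)"
      by (intro exI[of _ "Arg w / (2 * pi)"]) (simp add: circ_add w_def)
  qed
qed

lemma not_Ints_distance:
  assumes "(x::real) \<notin> \<int>"
  obtains d where "d > 0" "\<And>k :: int. \<bar>x - of_int k\<bar> \<ge> d"
proof (rule that[of "min (frac x) (1 - frac x)"])
  show "min (frac x) (1 - frac x) > 0" using assms frac_gt_0_iff[of x] frac_lt_1[of x] by simp
  fix k :: int
  have "x = of_int \<lfloor>x\<rfloor> + frac x" by (simp add: frac_def)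
  moreover have "k \<le> \<lfloor>x\<rfloor> \<or> k \<ge> \<lfloor>x\<rfloor> + 1" by linarith
  ultimately show "min (frac x) (1 - frac x) \<le> \<bar>x - of_int k\<bar>"
    using frac_ge_0[of x] frac_lt_1[of x]
    by (smt (verit) of_int_add of_int_le_iff of_int_1)
qed

lemma circ_eq_iff: "circ x = circ y \<longleftrightarrow> x - y \<in> \<int>"
proof
  assume "circ x = circ y"
  then have "circ (x - y) = 1" using circ_diff[of x y] by (simp add: complex_norm_square[symmetric])
  then show "x - y \<in> \<int>" by (rule circ_eq_1_imp_Ints)
next
  assume "x - y \<in> \<int>"
  then obtain k where "x - y = of_int k" by (rule Ints_cases)
  then have "x = y + of_int k" by simp
  then show "circ x = circ y" by (simp add: circ_add)
qed

lemma norm_1_eq_circ: "norm z = 1 \<Longrightarrow> \<exists>\<theta>. z = circ \<theta>"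
  by (rule exI[of _ "Arg z / (2 * pi)"]) (cases "z = 0"; simp add: circ_def cis_Arg sgn_div_norm)

text \<open>Away from the two end points, an arc of the circle is open and closed, also if it comes
  from an interval longer than the period.\<close>

lemma tame_angular:
  assumes "is_interval (I :: real set)"
  obtains F where "tame (sphere 0 1) F (circ ` I)"
proof -
  obtain a b where ab: "\<And>x y. (x < a \<longleftrightarrow> y < a) \<Longrightarrow> (x > a \<longleftrightarrow> y > a) \<Longrightarrow> (x < b \<longleftrightarrow> y < b) \<Longrightarrow> (x > b \<longleftrightarrow> y > b)
     \<Longrightarrow> x \<in> I \<longleftrightarrow> y \<in> I"
    using interval_order_type[OF assms] by blast
  have mem: "circ \<theta> \<in> circ ` I \<longleftrightarrow> (\<exists>k::int. \<theta> + of_int k \<in> I)" for \<theta>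
  proof
    assume "circ \<theta> \<in> circ ` I"
    then obtain x where x: "x \<in> I" "circ x = circ \<theta>" by auto
    then obtain k where "x - \<theta> = of_int k" unfolding circ_eq_iff by (rule_tac Ints_cases)
    then have "x = \<theta> + of_int k" by simp
    then show "\<exists>k::int. \<theta> + of_int k \<in> I" using x(1) by blast
  next
    assume "\<exists>k::int. \<theta> + of_int k \<in> I"
    then obtain k :: int where "\<theta> + of_int k \<in> I" by blast
    then have "circ (\<theta> + of_int k) \<in> circ ` I" by (rule imageI)
    then show "circ \<theta> \<in> circ ` I" by (simp add: circ_add)
  qed
  have "tame (sphere 0 1) {circ a, circ b} (circ ` I)"
    unfolding tame_def
  proof (intro conjI ballI)
    fix x :: complex assume x: "x \<in> sphere 0 1 - {circ a, circ b}"
    then obtain \<theta> where \<theta>: "x = circ \<theta>" using norm_1_eq_circ[of x] by auto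
    have "a - \<theta> \<notin> \<int>" "b - \<theta> \<notin> \<int>" using x unfolding \<theta> circ_eq_iff[symmetric] by auto
    then obtain d1 d2 where d12: "d1 > 0" "\<And>k :: int. \<bar>a - \<theta> - of_int k\<bar> \<ge> d1"
      "d2 > 0" "\<And>k :: int. \<bar>b - \<theta> - of_int k\<bar> \<ge> d2"
      using not_Ints_distance by metis
    define \<eta> where "\<eta> = min d1 d2"
    have \<eta>: "\<eta> > 0" using d12 by (simp add: \<eta>_def)
    obtain d where d: "d > 0" "\<And>\<theta> y. norm y = 1 \<Longrightarrow> dist y (circ \<theta>) < d \<Longrightarrow> \<exists>\<tau>. \<bar>\<tau>\<bar> < \<eta> \<and> y = circ (\<theta> + \<tau>)"
      using circ_local_lift[OF \<eta>] by blast
    show "\<exists>d>0. \<forall>y\<in>sphere 0 1. dist y x < d \<longrightarrow> (y \<in> circ ` I \<longleftrightarrow> x \<in> circ ` I)"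
    proof (intro exI conjI ballI impI)
      fix y :: complex assume y: "y \<in> sphere 0 1" "dist y x < d"
      then obtain \<tau> where \<tau>: "\<bar>\<tau>\<bar> < \<eta>" "y = circ (\<theta> + \<tau>)" using d(2)[of y \<theta>] by (auto simp: \<theta>)
      have "\<theta> + of_int k \<in> I \<longleftrightarrow> \<theta> + \<tau> + of_int k \<in> I" for k :: int
      proof (rule interval_locally_constant[OF ab])
        show "\<bar>\<theta> + of_int k - a\<bar> \<ge> \<eta>" using d12(2)[of k] by (simp add: \<eta>_def abs_le_iff)
        show "\<bar>\<theta> + of_int k - b\<bar> \<ge> \<eta>" using d12(4)[of k] by (simp add: \<eta>_def abs_le_iff)
        show "\<bar>\<theta> + \<tau> + of_int k - (\<theta> + of_int k)\<bar> < \<eta>" using \<tau>(1) by simp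
      qed
      then show "y \<in> circ ` I \<longleftrightarrow> x \<in> circ ` I" unfolding \<theta> \<tau>(2) mem by blast
    qed (rule d(1))
  qed auto
  then show ?thesis using that by blast
qed

lemma tame_uminus:
  assumes "tame (sphere 0 1) F A"
  shows "tame (sphere 0 1) (uminus ` F) (uminus ` A)"
  unfolding tame_def
proof (intro conjI ballI)
  fix x :: complex assume x: "x \<in> sphere 0 1 - uminus ` F"
  then have "- x \<in> sphere 0 1 - F" by (auto simp: image_iff)
  then obtain d where d: "d > 0" "\<forall>y\<in>sphere 0 1. dist y (- x) < d \<longrightarrow> (y \<in> A \<longleftrightarrow> - x \<in> A)"
    using assms unfolding tame_def by blast
  have mem: "w \<in> uminus ` A \<longleftrightarrow> - w \<in> A" for w by (metis imageE image_eqI minus_minus)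
  show "\<exists>d>0. \<forall>y\<in>sphere 0 1. dist y x < d \<longrightarrow> (y \<in> uminus ` A \<longleftrightarrow> x \<in> uminus ` A)"
  proof (intro exI conjI ballI impI)
    fix y :: complex assume y: "y \<in> sphere 0 1" "dist y x < d"
    have "dist (- y) (- x) < d" "- y \<in> sphere 0 1" using y by (simp_all add: dist_minus)
    then show "y \<in> uminus ` A \<longleftrightarrow> x \<in> uminus ` A" unfolding mem using d(2) by blast
  qed (rule d(1))
qed (use assms in \<open>auto simp: tame_def\<close>)

section \<open>Level sets of polar boxes\<close>

context decorrelated_phase
begin

lemma orthogonal_cong: "(\<And>n. n \<ge> 1 \<Longrightarrow> u n = w n) \<Longrightarrow> orthogonal u \<longleftrightarrow> orthogonal w"
  unfolding orthogonal_def by (rule null_mean_cong) simp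

lemma orthogonal_add: "orthogonal u \<Longrightarrow> orthogonal w \<Longrightarrow> orthogonal (\<lambda>n. u n + w n)"
  unfolding orthogonal_def distrib_right by (rule null_mean_add)

lemma orthogonal_diff: "orthogonal u \<Longrightarrow> orthogonal w \<Longrightarrow> orthogonal (\<lambda>n. u n - w n)"
  unfolding orthogonal_def left_diff_distrib by (rule null_mean_diff)

lemma orthogonal_cmult: "orthogonal u \<Longrightarrow> orthogonal (\<lambda>n. c * u n)"
  unfolding orthogonal_def mult.assoc by (rule null_mean_cmult)

lemma orthogonal_sum: "(\<And>i. i \<in> I \<Longrightarrow> orthogonal (u i)) \<Longrightarrow> orthogonal (\<lambda>n. \<Sum>i\<in>I. u i n)"
  unfolding orthogonal_def sum_distrib_right by (rule null_mean_sum)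

lemma orthogonal_uniform_approx:
  assumes "\<And>e. e > 0 \<Longrightarrow> \<exists>w. orthogonal w \<and> (\<forall>n\<ge>1. norm (u n - w n) \<le> e)"
  shows "orthogonal u"
  unfolding orthogonal_def
proof (rule null_mean_uniform_approx)
  fix e :: real assume "e > 0"
  from assms[OF this] obtain w where w: "orthogonal w" "\<forall>n\<ge>1. norm (u n - w n) \<le> e" by blast
  have "norm (u n * (v n * a n) - w n * (v n * a n)) \<le> e" if "n \<ge> 1" for n
  proof -
    have "norm (v n * a n) \<le> 1" unfolding norm_mult using norm_v norm_a by (intro mult_le_one) auto
    then have "norm (u n - w n) * norm (v n * a n) \<le> norm (u n - w n) * 1" by (intro mult_left_mono) auto
    then show ?thesis using w(2) that by (simp add: norm_mult flip: left_diff_distrib) (meson order_trans)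
  qed
  then show "\<exists>g. null_mean g \<and> (\<forall>n\<ge>1. norm (u n * (v n * a n) - g n) \<le> e)"
    using w(1) unfolding orthogonal_def by blast
qed

text \<open>Let \<open>T\<close> be supported near \<open>F\<close> and take \<open>\<phi> p\<close> as the class of \<open>p\<close>. For given \<open>m\<close>, a class
  \<open>w\<close> contributes to \<open>T (\<phi> n)\<close> only if \<open>w * \<phi> m\<close> is close to a point \<open>y \<in> F\<close>. As \<open>y\<close> is not
  \<open>0\<close>, the modulus of \<open>\<phi> m\<close> is bounded below, so that the points \<open>w * \<phi> m\<close> for the finitely
  many values \<open>w\<close> are apart, and at most one of them is close to \<open>y\<close>. Thus at most \<open>|F|\<close>
  classes contribute. The size of the neighbourhoods depends on the set of primes, which is
  chosen first; this is why the approximation must be available for every \<open>e\<close>.\<close>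

lemma orthogonal_up_to_small_neighbourhoods:
  fixes \<phi> \<chi>' :: "nat \<Rightarrow> complex"
  assumes \<phi>: "multiplicative \<phi>" and \<chi>: "multiplicative \<chi>'" "\<And>n. n \<ge> 1 \<Longrightarrow> norm (\<chi>' n) \<le> 1"
    and F: "finite F" "0 \<notin> F"
    and approx: "\<And>e. e > 0 \<Longrightarrow> \<exists>T. (\<forall>z. norm (T z) \<le> 1) \<and> (\<forall>z. T z \<noteq> 0 \<longrightarrow> (\<exists>y\<in>F. dist z y < e)) \<and>
       orthogonal (\<lambda>n. (\<Psi> (\<phi> n) - T (\<phi> n)) * \<chi>' n)"
  shows "orthogonal (\<lambda>n. \<Psi> (\<phi> n) * \<chi>' n)"
  unfolding orthogonal_def
proof (rule null_mean_approx)
  fix e :: real assume e: "e > 0"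
  define B where "B = real (card F) + 1"
  define C where "C = 5 * sqrt (B * real Q)"
  have B: "B \<ge> 1" by (simp add: B_def)
  have C: "C > 0" using B Q by (simp add: C_def)
  obtain P where P: "finite P" "P \<subseteq> {p. prime p}" "(\<Sum>p\<in>P. 1 / real p) \<ge> 1" "C / sqrt (\<Sum>p\<in>P. 1 / real p) \<le> e"
    by (rule finite_set_with_small_quotient[OF prime_reciprocals_not_summable C e])
  define W where "W = \<phi> ` P"
  have finW: "finite W" using P by (simp add: W_def)
  define \<delta> where "\<delta> = Min (insert 1 (norm ` F)) / 2"
  have \<delta>: "\<delta> > 0" "\<And>y. y \<in> F \<Longrightarrow> norm y \<ge> 2 * \<delta>"
    using F by (auto simp: \<delta>_def)
  define s where "s = Min (insert 1 ((\<lambda>(w, w'). norm (w - w')) ` {(w, w') \<in> W \<times> W. w \<noteq> w'}))"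
  have finWW: "finite {(w, w') \<in> W \<times> W. w \<noteq> w'}"
    by (rule finite_subset[of _ "W \<times> W"]) (use finW in auto)
  have s: "s > 0" "\<And>w w'. w \<in> W \<Longrightarrow> w' \<in> W \<Longrightarrow> w \<noteq> w' \<Longrightarrow> norm (w - w') \<ge> s"
  proof -
    show "s > 0" unfolding s_def using finWW by (subst Min_gr_iff) auto
    fix w w' assume "w \<in> W" "w' \<in> W" "w \<noteq> w'"
    then show "norm (w - w') \<ge> s" unfolding s_def
      using finWW by (intro Min_le) (auto intro!: image_eqI[of _ _ "(w, w')"])
  qed
  define R where "R = Max (insert 1 (norm ` W))"
  have R: "R > 0" "\<And>w. w \<in> W \<Longrightarrow> norm w \<le> R"
  proof -
    have "1 \<le> R" unfolding R_def using finW by (intro Max_ge) auto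
    then show "R > 0" by simp
    show "norm w \<le> R" if "w \<in> W" for w unfolding R_def using finW that by (intro Max_ge) auto
  qed
  define \<epsilon> where "\<epsilon> = min \<delta> (s * \<delta> / (2 * R))"
  have \<epsilon>: "\<epsilon> > 0" "\<epsilon> \<le> \<delta>" "2 * \<epsilon> \<le> s * \<delta> / R"
    using \<delta> s R by (auto simp: \<epsilon>_def min_def field_simps)
  obtain T where T: "\<And>z. norm (T z) \<le> 1" "\<And>z. T z \<noteq> 0 \<Longrightarrow> \<exists>y\<in>F. dist z y < \<epsilon>"
    "orthogonal (\<lambda>n. (\<Psi> (\<phi> n) - T (\<phi> n)) * \<chi>' n)"
    using approx[OF \<epsilon>(1)] by blast
  \<comment> \<open>two different dilations of \<open>T\<close> cannot see the same point of \<open>F\<close>\<close>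
  have separated: "w = w'" if w: "w \<in> W" "w' \<in> W" and y: "y \<in> F" "dist (w * t) y < \<epsilon>" "dist (w' * t) y < \<epsilon>" for w w' t y
  proof (rule ccontr)
    assume "w \<noteq> w'"
    have "norm y \<le> norm (w * t) + dist (w * t) y" unfolding dist_norm by norm
    then have "norm w * norm t \<ge> \<delta>" using \<delta>(2)[OF y(1)] y(2) \<epsilon>(2) by (simp add: norm_mult)
    moreover have "norm w * norm t \<le> R * norm t" using R(2)[OF w(1)] by (intro mult_right_mono) auto
    ultimately have t: "norm t \<ge> \<delta> / R" using R(1) by (simp add: pos_divide_le_eq mult.commute)
    have "dist (w * t) (w' * t) < \<epsilon> + \<epsilon>" by (rule dist_triangle_less_add[OF y(2,3)])
    then have "norm (w - w') * norm t < 2 * \<epsilon>"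
      by (simp add: dist_norm norm_mult flip: left_diff_distrib)
    moreover have "s * (\<delta> / R) \<le> norm (w - w') * norm t"
      using t s(1) s(2)[OF w \<open>w \<noteq> w'\<close>] \<delta>(1) R(1) by (intro mult_mono) auto
    ultimately show False using \<epsilon>(3) by simp
  qed
  define x where "x w m = T (w * \<phi> m) * \<chi>' m" for w m
  have "\<forall>\<^sub>F N in sequentially. norm (avg (\<lambda>n. T (\<phi> n) * \<chi>' n * (v n * a n)) N)
     \<le> 5 * sqrt (B * real Q) / sqrt (\<Sum>p\<in>P. 1 / real p)"
  proof (rule correlation_bound[where c = \<chi>' and x = x and \<kappa> = \<phi>])
    show "norm (T (\<phi> n) * \<chi>' n) \<le> 1" if "n \<ge> 1" for n
      unfolding norm_mult using T(1) \<chi>(2)[OF that] by (intro mult_le_one) auto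
    show "norm (\<chi>' p) \<le> 1" if "p \<in> P" for p
      using \<chi>(2) P(2) that prime_ge_1_nat by blast
    show "(\<Sum>k\<in>\<phi> ` P. (norm (x k m))\<^sup>2) \<le> B" if m: "m \<ge> 1" for m
    proof -
      have "(\<Sum>k\<in>W. (norm (x k m))\<^sup>2) = (\<Sum>k\<in>{w\<in>W. T (w * \<phi> m) \<noteq> 0}. (norm (x k m))\<^sup>2)"
        using finW by (intro sum.mono_neutral_right) (auto simp: x_def)
      also have "\<dots> \<le> (\<Sum>k\<in>{w\<in>W. T (w * \<phi> m) \<noteq> 0}. 1)"
      proof (intro sum_mono)
        fix k
        have "norm (x k m) \<le> 1" unfolding x_def norm_mult using T(1) \<chi>(2)[OF m] by (intro mult_le_one) auto
        then show "(norm (x k m))\<^sup>2 \<le> 1" by (simp add: power_le_one)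
      qed
      also have "\<dots> = real (card {w\<in>W. T (w * \<phi> m) \<noteq> 0})" by simp
      also have "card {w\<in>W. T (w * \<phi> m) \<noteq> 0} \<le> card F"
      proof -
        have "\<forall>w\<in>{w\<in>W. T (w * \<phi> m) \<noteq> 0}. \<exists>y. y \<in> F \<and> dist (w * \<phi> m) y < \<epsilon>" using T(2) by blast
        then obtain g where g: "\<And>w. w \<in> W \<Longrightarrow> T (w * \<phi> m) \<noteq> 0 \<Longrightarrow> g w \<in> F \<and> dist (w * \<phi> m) (g w) < \<epsilon>"
          by (metis (mono_tags, lifting) mem_Collect_eq)
        have "inj_on g {w\<in>W. T (w * \<phi> m) \<noteq> 0}"
        proof (rule inj_onI)
          fix w w' assume w: "w \<in> {w\<in>W. T (w * \<phi> m) \<noteq> 0}" "w' \<in> {w\<in>W. T (w * \<phi> m) \<noteq> 0}" "g w = g w'"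
          then show "w = w'" using separated[of w w' "g w" "\<phi> m"] g[of w] g[of w'] by auto
        qed
        then show ?thesis using F(1) g by (intro card_inj_on_le[of g]) auto
      qed
      finally show ?thesis by (simp add: W_def B_def)
    qed
    show "T (\<phi> (p * m)) * \<chi>' (p * m) = \<chi>' p * x (\<phi> p) m" if pm: "p \<in> P" "m \<ge> 1" "\<not> p dvd m" for p m
    proof -
      have "prime p" using pm(1) P(2) by auto
      then have "coprime p m" "p \<ge> 1" using pm prime_ge_1_nat by (auto intro: prime_imp_coprime)
      then have "\<phi> (p * m) = \<phi> p * \<phi> m" "\<chi>' (p * m) = \<chi>' p * \<chi>' m"
        using \<phi> \<chi>(1) pm(2) unfolding multiplicative_def by blast+
      then show ?thesis by (simp add: x_def mult_ac)
    qed
  qed (use P B in auto)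
  moreover note P(4)
  ultimately have "\<forall>\<^sub>F N in sequentially. norm (avg (\<lambda>n. T (\<phi> n) * \<chi>' n * (v n * a n)) N) \<le> e"
    unfolding C_def by (auto elim: eventually_mono)
  moreover have "(\<lambda>n. T (\<phi> n) * \<chi>' n * (v n * a n))
     = (\<lambda>n. \<Psi> (\<phi> n) * \<chi>' n * (v n * a n) - (\<Psi> (\<phi> n) - T (\<phi> n)) * \<chi>' n * (v n * a n))"
    by (simp add: algebra_simps)
  ultimately show "\<exists>g. null_mean g \<and> (\<forall>\<^sub>F N in sequentially. norm (avg (\<lambda>n. \<Psi> (\<phi> n) * \<chi>' n * (v n * a n) - g n) N) \<le> e)"
    using T(3) unfolding orthogonal_def
    by (intro exI[of _ "\<lambda>n. (\<Psi> (\<phi> n) - T (\<phi> n)) * \<chi>' n * (v n * a n)"]) simp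
qed

end

text \<open>On a compact set these are dense among the continuous functions, and at the values of a
  multiplicative function each monomial is multiplicative.\<close>

definition conj_poly :: "(complex \<Rightarrow> complex) \<Rightarrow> bool" where
  "conj_poly g \<longleftrightarrow> (\<exists>(I :: (nat \<times> nat) set) c. finite I \<and> (\<forall>z. g z = (\<Sum>(i, j)\<in>I. c (i, j) * (z ^ i * cnj z ^ j))))"

lemma conj_poly_monom: "conj_poly (\<lambda>z. c * (z ^ i * cnj z ^ j))"
  unfolding conj_poly_def by (intro exI[of _ "{(i, j)}"] exI[of _ "\<lambda>_. c"]) simp

lemma conj_poly_add:
  assumes "conj_poly f" "conj_poly g"
  shows "conj_poly (\<lambda>z. f z + g z)"
proof -
  obtain I c J d where I: "finite I" "\<And>z. f z = (\<Sum>(i, j)\<in>I. c (i, j) * (z ^ i * cnj z ^ j))"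
    and J: "finite J" "\<And>z. g z = (\<Sum>(i, j)\<in>J. d (i, j) * (z ^ i * cnj z ^ j))"
    using assms unfolding conj_poly_def by blast
  define c' where "c' x = (if x \<in> I then c x else 0)" for x
  define d' where "d' x = (if x \<in> J then d x else 0)" for x
  have "f z + g z = (\<Sum>(i, j)\<in>I \<union> J. (c' (i, j) + d' (i, j)) * (z ^ i * cnj z ^ j))" for z
  proof -
    have "f z = (\<Sum>(i, j)\<in>I \<union> J. c' (i, j) * (z ^ i * cnj z ^ j))"
      unfolding I(2) using I(1) J(1) by (intro sum.mono_neutral_cong_left) (auto simp: c'_def)
    moreover have "g z = (\<Sum>(i, j)\<in>I \<union> J. d' (i, j) * (z ^ i * cnj z ^ j))"
      unfolding J(2) using I(1) J(1) by (intro sum.mono_neutral_cong_left) (auto simp: d'_def)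
    ultimately show ?thesis by (simp add: case_prod_unfold sum.distrib distrib_right)
  qed
  then show ?thesis unfolding conj_poly_def using I(1) J(1)
    by (intro exI[of _ "I \<union> J"] exI[of _ "\<lambda>x. c' x + d' x"]) simp
qed

lemma conj_poly_sum: "finite I \<Longrightarrow> (\<And>i. i \<in> I \<Longrightarrow> conj_poly (f i)) \<Longrightarrow> conj_poly (\<lambda>z. \<Sum>i\<in>I. f i z)"
proof (induction I rule: finite_induct)
  case empty
  then show ?case using conj_poly_monom[of 0] by simp
qed (simp add: conj_poly_add)

lemma conj_poly_mult:
  assumes "conj_poly f" "conj_poly g"
  shows "conj_poly (\<lambda>z. f z * g z)"
proof -
  obtain I c J d where I: "finite I" "\<And>z. f z = (\<Sum>(i, j)\<in>I. c (i, j) * (z ^ i * cnj z ^ j))"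
    and J: "finite J" "\<And>z. g z = (\<Sum>(i, j)\<in>J. d (i, j) * (z ^ i * cnj z ^ j))"
    using assms unfolding conj_poly_def by blast
  have "f z * g z = (\<Sum>x\<in>I. \<Sum>y\<in>J. (c x * d y) * (z ^ (fst x + fst y) * cnj z ^ (snd x + snd y)))" for z
    unfolding I(2) J(2) sum_product by (simp add: case_prod_unfold power_add mult_ac)
  moreover have "conj_poly (\<lambda>z. \<Sum>x\<in>I. \<Sum>y\<in>J. (c x * d y) * (z ^ (fst x + fst y) * cnj z ^ (snd x + snd y)))"
    using I(1) J(1) by (intro conj_poly_sum conj_poly_monom)
  ultimately show ?thesis by (simp only:)
qed

lemma conj_poly_of_real_polynomial:
  assumes "real_polynomial_function p"
  shows "conj_poly (\<lambda>z. complex_of_real (p z))"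
  using assms
proof (induction p rule: real_polynomial_function.induct)
  case (linear f)
  interpret bounded_linear f by fact
  have lin: "f z = Re z * f 1 + Im z * f \<i>" for z
  proof -
    have "f z = f (Re z *\<^sub>R 1 + Im z *\<^sub>R \<i>)" by (rule arg_cong[of _ _ f]) (simp add: complex_eq_iff)
    then show ?thesis by (simp add: add scaleR)
  qed
  have eq: "complex_of_real (f z) = of_real (Re z) * of_real (f 1) + of_real (Im z) * of_real (f \<i>)" for z
    unfolding of_real_mult[symmetric] of_real_add[symmetric] by (rule arg_cong[OF lin])
  have "conj_poly (\<lambda>z. of_real (Re z))"
  proof -
    have "complex_of_real (Re z) = (1 / 2) * (z ^ 1 * cnj z ^ 0) + (1 / 2) * (z ^ 0 * cnj z ^ 1)" for z
      by (simp add: complex_eq_iff)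
    then show ?thesis by (simp only: conj_poly_add conj_poly_monom)
  qed
  moreover have "conj_poly (\<lambda>z. of_real (Im z))"
  proof -
    have "complex_of_real (Im z) = (- \<i> / 2) * (z ^ 1 * cnj z ^ 0) + (\<i> / 2) * (z ^ 0 * cnj z ^ 1)" for z
      by (simp add: complex_eq_iff)
    then show ?thesis by (simp only: conj_poly_add conj_poly_monom)
  qed
  moreover have "conj_poly (\<lambda>z. c)" for c using conj_poly_monom[of c 0 0] by simp
  moreover have "(\<lambda>z. complex_of_real (f z)) = (\<lambda>z. of_real (Re z) * of_real (f 1) + of_real (Im z) * of_real (f \<i>))"
    by (rule ext) (rule eq)
  ultimately show ?case by (simp only: conj_poly_add conj_poly_mult)
next
  case (const c)
  then show ?case using conj_poly_monom[of "of_real c" 0 0] by simp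
next
  case (add f g)
  then show ?case by (simp add: conj_poly_add)
next
  case (mult f g)
  then show ?case by (simp add: conj_poly_mult)
qed

lemma conj_poly_approximation:
  fixes \<beta> :: "complex \<Rightarrow> real"
  assumes "compact S" "continuous_on S \<beta>" "e > 0"
  obtains g where "conj_poly g" "\<And>z. z \<in> S \<Longrightarrow> norm (of_real (\<beta> z) - g z) < e"
proof -
  obtain p where p: "real_polynomial_function p" "\<And>x. x \<in> S \<Longrightarrow> \<bar>\<beta> x - p x\<bar> < e"
    using Stone_Weierstrass_real_polynomial_function[OF assms] by blast
  have "norm (complex_of_real (\<beta> z) - of_real (p z)) < e" if "z \<in> S" for z
    using p(2)[OF that] by (metis norm_of_real of_real_diff)
  then show ?thesis using that[OF conj_poly_of_real_polynomial[OF p(1)]] by blast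
qed

lemma multiplicative_hom:
  assumes "multiplicative f" "h 1 = 1" "\<And>x y. h (x * y) = h x * h y"
  shows "multiplicative (\<lambda>n. h (f n))"
  using assms unfolding multiplicative_def by simp

lemma of_bool_diff_cutoff:
  assumes "e > 0"
  shows "norm (of_bool (z \<in> A) - complex_of_real (cutoff F e A z)) \<le> 1"
proof -
  have "\<bar>of_bool (z \<in> A) - cutoff F e A z\<bar> \<le> 1"
    using cutoff_bounds(1)[OF assms, of F A z] cutoff_bounds(2)[of F e A z] by (simp add: abs_le_iff split: if_splits)
  moreover have "of_bool (z \<in> A) - complex_of_real (cutoff F e A z) = of_real (of_bool (z \<in> A) - cutoff F e A z)"
    by simp
  ultimately show ?thesis by (simp only: norm_of_real)
qed

context decorrelated_phase
begin

text \<open>The factor \<open>\<chi>'\<close> serves two purposes: it restricts to the integers at which \<open>\<phi>\<close> takes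
  values in \<open>S\<close>, and it lets further multiplicative conditions be carried along.\<close>

lemma orthogonal_continuous:
  fixes \<phi> \<chi>' :: "nat \<Rightarrow> complex" and \<beta> :: "complex \<Rightarrow> real"
  assumes S: "compact S" "\<And>n. n \<ge> 1 \<Longrightarrow> \<chi>' n \<noteq> 0 \<Longrightarrow> \<phi> n \<in> S" and \<chi>: "\<And>n. n \<ge> 1 \<Longrightarrow> norm (\<chi>' n) \<le> 1"
    and mono: "\<And>i j. orthogonal (\<lambda>n. \<phi> n ^ i * cnj (\<phi> n) ^ j * \<chi>' n)"
    and \<beta>: "continuous_on S \<beta>"
  shows "orthogonal (\<lambda>n. of_real (\<beta> (\<phi> n)) * \<chi>' n)"
proof (rule orthogonal_uniform_approx)
  fix e :: real assume e: "e > 0"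
  obtain g where g: "conj_poly g" "\<And>z. z \<in> S \<Longrightarrow> norm (of_real (\<beta> z) - g z) < e"
    using conj_poly_approximation[OF S(1) \<beta> e] by blast
  obtain I c where I: "finite I" "\<And>z. g z = (\<Sum>(i, j)\<in>I. c (i, j) * (z ^ i * cnj z ^ j))"
    using g(1) unfolding conj_poly_def by blast
  have "orthogonal (\<lambda>n. \<Sum>x\<in>I. c x * (\<phi> n ^ fst x * cnj (\<phi> n) ^ snd x * \<chi>' n))"
    by (intro orthogonal_sum orthogonal_cmult mono)
  then have "orthogonal (\<lambda>n. g (\<phi> n) * \<chi>' n)"
    unfolding I(2) sum_distrib_right by (simp add: case_prod_unfold mult.assoc)
  moreover have "norm (of_real (\<beta> (\<phi> n)) * \<chi>' n - g (\<phi> n) * \<chi>' n) \<le> e" if "n \<ge> 1" for n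
  proof (cases "\<chi>' n = 0")
    case False
    then have "norm (of_real (\<beta> (\<phi> n)) - g (\<phi> n)) * norm (\<chi>' n) \<le> e * 1"
      using g(2)[OF S(2)[OF that False]] \<chi>[OF that] e by (intro mult_mono) auto
    then show ?thesis by (simp add: norm_mult flip: left_diff_distrib)
  qed (use e in simp)
  ultimately show "\<exists>w. orthogonal w \<and> (\<forall>n\<ge>1. norm (of_real (\<beta> (\<phi> n)) * \<chi>' n - w n) \<le> e)"
    by blast
qed

lemma orthogonal_tame:
  fixes \<phi> \<chi>' :: "nat \<Rightarrow> complex"
  assumes \<phi>: "multiplicative \<phi>" and \<chi>: "multiplicative \<chi>'" "\<And>n. n \<ge> 1 \<Longrightarrow> norm (\<chi>' n) \<le> 1"
    and S: "compact S" "\<And>n. n \<ge> 1 \<Longrightarrow> \<chi>' n \<noteq> 0 \<Longrightarrow> \<phi> n \<in> S"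
    and mono: "\<And>i j. orthogonal (\<lambda>n. \<phi> n ^ i * cnj (\<phi> n) ^ j * \<chi>' n)"
    and tame: "tame S F A"
  shows "orthogonal (\<lambda>n. of_bool (\<phi> n \<in> A) * \<chi>' n)"
proof (rule orthogonal_up_to_small_neighbourhoods[where \<Psi> = "\<lambda>z. of_bool (z \<in> A)", OF \<phi> \<chi>])
  show F: "finite F" "0 \<notin> F" using tame by (auto simp: tame_def)
  have F0: "F \<noteq> {}" using tame by (simp add: tame_def)
  fix e :: real assume e: "e > 0"
  define T where "T z = of_bool (z \<in> A) - complex_of_real (cutoff F e A z)" for z
  have "orthogonal (\<lambda>n. of_real (cutoff F e A (\<phi> n)) * \<chi>' n)"
    by (rule orthogonal_continuous[OF S \<chi>(2) mono continuous_on_cutoff[OF tame e]])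
  then have "orthogonal (\<lambda>n. (of_bool (\<phi> n \<in> A) - T (\<phi> n)) * \<chi>' n)" by (simp add: T_def)
  moreover have "\<exists>y\<in>F. dist z y < e" if "T z \<noteq> 0" for z
  proof (rule cutoff_neq_near[OF _ e F(1) F0])
    show "cutoff F e A z \<noteq> of_bool (z \<in> A)" using that by (auto simp: T_def)
  qed
  moreover have "norm (T z) \<le> 1" for z unfolding T_def by (rule of_bool_diff_cutoff[OF e])
  ultimately show "\<exists>T. (\<forall>z. norm (T z) \<le> 1) \<and> (\<forall>z. T z \<noteq> 0 \<longrightarrow> (\<exists>y\<in>F. dist z y < e)) \<and>
       orthogonal (\<lambda>n. (of_bool (\<phi> n \<in> A) - T (\<phi> n)) * \<chi>' n)" by blast
qed

text \<open>Let \<open>t\<^sub>A = 1\<^sub>A - c\<^sub>A\<close> and \<open>t\<^sub>B = 1\<^sub>B - c\<^sub>B\<close> be the errors of the cut-off functions in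
  modulus and argument. Then \<open>1\<^sub>A 1\<^sub>B - t\<^sub>A t\<^sub>B = 1\<^sub>A c\<^sub>B + c\<^sub>A 1\<^sub>B - c\<^sub>A c\<^sub>B\<close>, and in each
  term on the right one of the factors is continuous, so that approximation by monomials
  reduces it to \<open>orthogonal_tame\<close> in a single variable. The remaining product \<open>t\<^sub>A t\<^sub>B\<close> is
  supported near the finitely many points \<open>y y'\<close> with exceptional modulus \<open>y\<close> and
  exceptional direction \<open>y'\<close>.\<close>

lemma orthogonal_polar_box:
  assumes f: "multiplicative f" "\<And>n. n \<ge> 1 \<Longrightarrow> norm (f n) \<le> 1"
    and A: "tame (of_real ` {0..1}) F A" and B: "tame (sphere 0 1) F' B"
  shows "orthogonal (\<lambda>n. of_bool (of_real (norm (f n)) \<in> A \<and> sgn (f n) \<in> B) * of_bool (f n \<noteq> 0))"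
proof -
  define \<rho> where "\<rho> n = complex_of_real (norm (f n))" for n
  define g where "g n = sgn (f n)" for n
  define N where "N n = (of_bool (f n \<noteq> 0) :: complex)" for n
  define M where "M i j k l n = \<rho> n ^ i * cnj (\<rho> n) ^ j * (g n ^ k * cnj (g n) ^ l) * N n" for i j k l n
  have M_mult: "multiplicative (M i j k l)" for i j k l
    unfolding M_def[abs_def] \<rho>_def g_def N_def
    by (rule multiplicative_hom[where h = "\<lambda>z. of_real (norm z) ^ i * cnj (of_real (norm z)) ^ j *
         (sgn z ^ k * cnj (sgn z) ^ l) * of_bool (z \<noteq> 0)", OF f(1)])
       (simp_all add: norm_mult sgn_mult power_mult_distrib)
  have le1: "norm (\<rho> n) \<le> 1" "norm (g n) \<le> 1" "norm (N n) \<le> 1" if "n \<ge> 1" for n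
    using f(2)[OF that] by (auto simp: \<rho>_def g_def N_def norm_sgn)
  have M_le: "norm (M i j k l n) \<le> 1" if "n \<ge> 1" for i j k l n
    unfolding M_def norm_mult norm_power complex_mod_cnj using le1[OF that]
    by (intro mult_le_one power_le_one mult_nonneg_nonneg zero_le_power norm_ge_zero)
  have M_orth: "orthogonal (M i j k l)" for i j k l by (rule orthogonal_multiplicative[OF M_mult M_le])
  have S: "compact (of_real ` {0..1} :: complex set)"
    by (intro compact_continuous_image continuous_intros) auto
  have \<rho>S: "\<rho> n \<in> of_real ` {0..1}" if "n \<ge> 1" for n
    unfolding \<rho>_def by (intro imageI) (use f(2)[OF that] in simp)
  have gS: "g n \<in> sphere 0 1" if "N n \<noteq> 0" for n
    using that by (simp add: g_def N_def norm_sgn)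
  have \<rho>_mult: "multiplicative \<rho>" and g_mult: "multiplicative g"
    unfolding \<rho>_def[abs_def] g_def[abs_def]
    by (rule multiplicative_hom[where h = "\<lambda>z. of_real (norm z)", OF f(1)], simp_all add: norm_mult)
       (rule multiplicative_hom[where h = sgn, OF f(1)], simp_all add: sgn_mult)
  have monoA: "orthogonal (\<lambda>n. \<rho> n ^ i * cnj (\<rho> n) ^ j * M 0 0 k l n)" for i j k l
    using M_orth[of i j k l] by (simp add: M_def[abs_def] mult_ac)
  have monoB: "orthogonal (\<lambda>n. g n ^ k * cnj (g n) ^ l * M i j 0 0 n)" for i j k l
    using M_orth[of i j k l] by (simp add: M_def[abs_def] mult_ac)
  have orthA: "orthogonal (\<lambda>n. of_bool (\<rho> n \<in> A) * M 0 0 k l n)" for k l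
    by (rule orthogonal_tame[OF \<rho>_mult M_mult M_le S \<rho>S monoA A])
  have orthAc: "orthogonal (\<lambda>n. of_real (cutoff F e A (\<rho> n)) * M 0 0 k l n)" if "e > 0" for k l e
    by (rule orthogonal_continuous[OF S \<rho>S M_le monoA continuous_on_cutoff[OF A that]])
  have orthB: "orthogonal (\<lambda>n. of_bool (g n \<in> B) * M i j 0 0 n)" for i j
    by (rule orthogonal_tame[OF g_mult M_mult M_le compact_sphere gS monoB B]) (auto simp: M_def)
  have N_M: "N = M 0 0 0 0" by (simp add: M_def fun_eq_iff)
  have FF: "finite F" "F \<noteq> {}" "0 \<notin> F" "finite F'" "F' \<noteq> {}" "0 \<notin> F'"
    using A B by (auto simp: tame_def)
  define R where "R = Max (insert 1 (norm ` F))"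
  have R: "R \<ge> 1" "\<And>y. y \<in> F \<Longrightarrow> norm y \<le> R"
    unfolding R_def using FF by (auto intro: Max_ge simp del: Max_insert)
  have "orthogonal (\<lambda>n. (\<lambda>z. of_bool (of_real (norm z) \<in> A) * of_bool (sgn z \<in> B)) (f n) * N n)"
  proof (rule orthogonal_up_to_small_neighbourhoods[where F = "(\<lambda>(y, y'). y * y') ` (F \<times> F')", OF f(1)])
    show "multiplicative N" "\<And>n. n \<ge> 1 \<Longrightarrow> norm (N n) \<le> 1" unfolding N_M by (rule M_mult, rule M_le)
    show "finite ((\<lambda>(y, y'). y * y') ` (F \<times> F'))" "0 \<notin> (\<lambda>(y, y'). y * y') ` (F \<times> F')" using FF by auto
    fix e :: real assume e: "e > 0"
    define d where "d = e / (1 + R)"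
    have d: "d > 0" using e R by (simp add: d_def)
    define tA where "tA z = of_bool (z \<in> A) - complex_of_real (cutoff F d A z)" for z
    define tB where "tB z = of_bool (z \<in> B) - complex_of_real (cutoff F' d B z)" for z
    define T where "T z = tA (of_real (norm z)) * tB (sgn z) * of_bool (z \<noteq> 0)" for z
    have T1: "norm (T z) \<le> 1" for z
    proof -
      have "norm (tA w) \<le> 1" "norm (tB w) \<le> 1" for w
        unfolding tA_def tB_def using of_bool_diff_cutoff[OF d] by auto
      then show ?thesis unfolding T_def norm_mult by (intro mult_le_one mult_nonneg_nonneg norm_ge_zero) auto
    qed
    have T2: "\<exists>y\<in>(\<lambda>(y, y'). y * y') ` (F \<times> F'). dist z y < e" if "T z \<noteq> 0" for z
    proof -
      have nz: "z \<noteq> 0" "tA (of_real (norm z)) \<noteq> 0" "tB (sgn z) \<noteq> 0" using that by (auto simp: T_def)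
      have "cutoff F d A (of_real (norm z)) \<noteq> of_bool (complex_of_real (norm z) \<in> A)"
        using nz(2) by (auto simp: tA_def)
      from cutoff_neq_near[OF this d FF(1,2)] obtain y where y: "y \<in> F" "dist (of_real (norm z)) y < d" by blast
      have "cutoff F' d B (sgn z) \<noteq> of_bool (sgn z \<in> B)" using nz(3) by (auto simp: tB_def)
      from cutoff_neq_near[OF this d FF(4,5)] obtain y' where y': "y' \<in> F'" "dist (sgn z) y' < d" by blast
      have z: "z = of_real (norm z) * sgn z" using nz(1) by (simp add: sgn_div_norm scaleR_conv_of_real)
      have "z - y * y' = (of_real (norm z) - y) * sgn z + y * (sgn z - y')"
        by (subst z) (simp add: algebra_simps)
      then have "norm (z - y * y') \<le> norm (of_real (norm z) - y) * norm (sgn z) + norm y * norm (sgn z - y')"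
        using norm_triangle_ineq[of "(of_real (norm z) - y) * sgn z" "y * (sgn z - y')"] by (simp add: norm_mult)
      also have "\<dots> < d * 1 + R * d"
        using y y' R(1) R(2)[OF y(1)] nz(1)
        by (intro add_less_le_mono mult_mono) (auto simp: dist_norm norm_sgn)
      also have "\<dots> = (1 + R) * d" by (simp add: algebra_simps)
      also have "\<dots> = e" using R(1) by (simp add: d_def)
      finally have "dist z (y * y') < e" by (simp add: dist_norm)
      then show ?thesis using y(1) y'(1) by auto
    qed
    have o1: "orthogonal (\<lambda>n. of_real (cutoff F' d B (g n)) * (of_bool (\<rho> n \<in> A) * N n))"
    proof (rule orthogonal_continuous[OF compact_sphere _ _ _ continuous_on_cutoff[OF B d]])
      show "orthogonal (\<lambda>n. g n ^ i * cnj (g n) ^ j * (of_bool (\<rho> n \<in> A) * N n))" for i j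
        using orthA[of i j] by (simp add: M_def mult_ac)
    qed (use gS le1 in auto)
    have o2: "orthogonal (\<lambda>n. of_real (cutoff F' d B (g n)) * (of_real (cutoff F d A (\<rho> n)) * N n))"
    proof (rule orthogonal_continuous[OF compact_sphere _ _ _ continuous_on_cutoff[OF B d]])
      show "orthogonal (\<lambda>n. g n ^ i * cnj (g n) ^ j * (of_real (cutoff F d A (\<rho> n)) * N n))" for i j
        using orthAc[OF d, of i j] by (simp add: M_def mult_ac)
      have "\<bar>cutoff F d A w\<bar> \<le> 1" for w
        using cutoff_bounds(1)[OF d, of F A w] cutoff_bounds(2)[of F d A w] by (cases "w \<in> A") simp_all
      then show "norm (of_real (cutoff F d A (\<rho> n)) * N n) \<le> 1" if "n \<ge> 1" for n
        unfolding norm_mult norm_of_real using le1[OF that] by (intro mult_le_one) auto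
    qed (use gS in auto)
    have o3: "orthogonal (\<lambda>n. of_real (cutoff F d A (\<rho> n)) * (of_bool (g n \<in> B) * N n))"
    proof (rule orthogonal_continuous[OF S _ _ _ continuous_on_cutoff[OF A d]])
      show "orthogonal (\<lambda>n. \<rho> n ^ i * cnj (\<rho> n) ^ j * (of_bool (g n \<in> B) * N n))" for i j
        using orthB[of i j] by (simp add: M_def mult_ac)
    qed (use \<rho>S le1 in auto)
    have "orthogonal (\<lambda>n. of_real (cutoff F' d B (g n)) * (of_bool (\<rho> n \<in> A) * N n)
        + of_real (cutoff F d A (\<rho> n)) * (of_bool (g n \<in> B) * N n)
        - of_real (cutoff F' d B (g n)) * (of_real (cutoff F d A (\<rho> n)) * N n))"
      by (intro orthogonal_diff orthogonal_add o1 o2 o3)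
    moreover have "of_real (cutoff F' d B (g n)) * (of_bool (\<rho> n \<in> A) * N n)
        + of_real (cutoff F d A (\<rho> n)) * (of_bool (g n \<in> B) * N n)
        - of_real (cutoff F' d B (g n)) * (of_real (cutoff F d A (\<rho> n)) * N n)
      = (of_bool (of_real (norm (f n)) \<in> A) * of_bool (sgn (f n) \<in> B) - T (f n)) * N n" for n
      by (cases "f n = 0") (simp_all add: T_def tA_def tB_def N_def \<rho>_def g_def algebra_simps)
    ultimately have T3: "orthogonal (\<lambda>n. (of_bool (of_real (norm (f n)) \<in> A) * of_bool (sgn (f n) \<in> B) - T (f n)) * N n)"
      by (simp only:)
    from T1 T2 T3 show "\<exists>T. (\<forall>z. norm (T z) \<le> 1) \<and>
        (\<forall>z. T z \<noteq> 0 \<longrightarrow> (\<exists>y\<in>(\<lambda>(y, y'). y * y') ` (F \<times> F'). dist z y < e)) \<and>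
        orthogonal (\<lambda>n. (of_bool (of_real (norm (f n)) \<in> A) * of_bool (sgn (f n) \<in> B) - T (f n)) * N n)"
      by blast
  qed
  then show ?thesis by (simp only: N_def of_bool_conj)
qed

text \<open>Inclusion and exclusion: the intersection of two boxes is a box.\<close>

lemma orthogonal_polar_boxes:
  assumes f: "multiplicative f" "\<And>n. n \<ge> 1 \<Longrightarrow> norm (f n) \<le> 1"
    and boxes: "\<And>A B. (A, B) \<in> set bs \<Longrightarrow> (\<exists>F. tame (of_real ` {0..1}) F A) \<and> (\<exists>F'. tame (sphere 0 1) F' B)"
  shows "orthogonal (\<lambda>n. of_bool (\<exists>(A, B)\<in>set bs. of_real (norm (f n)) \<in> A \<and> sgn (f n) \<in> B) * of_bool (f n \<noteq> 0))"
  using boxes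
proof (induction "length bs" arbitrary: bs)
  case 0
  then have "(\<lambda>n. of_bool (\<exists>(A, B)\<in>set bs. of_real (norm (f n)) \<in> A \<and> sgn (f n) \<in> B) * of_bool (f n \<noteq> 0)) = (\<lambda>_. 0 :: complex)"
    by simp
  then show ?case by (simp add: orthogonal_def null_mean_zero)
next
  case (Suc k)
  then obtain A0 B0 bs' where bs: "bs = (A0, B0) # bs'" "length bs' = k" by (cases bs) auto
  define in_box where "in_box n = (\<lambda>(A, B). complex_of_real (norm (f n)) \<in> A \<and> sgn (f n) \<in> B)" for n
  define cs where "cs = map (\<lambda>(A, B). (A0 \<inter> A, B0 \<inter> B)) bs'"
  obtain F0 F0' where t0: "tame (of_real ` {0..1}) F0 A0" "tame (sphere 0 1) F0' B0"
    using Suc.prems[of A0 B0] bs by auto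
  have o1: "orthogonal (\<lambda>n. of_bool (in_box n (A0, B0)) * of_bool (f n \<noteq> 0))"
    using orthogonal_polar_box[OF f t0] by (simp add: in_box_def)
  have o2: "orthogonal (\<lambda>n. of_bool (\<exists>b\<in>set bs'. in_box n b) * of_bool (f n \<noteq> 0))"
    unfolding in_box_def by (rule Suc.hyps(1)) (use bs Suc.prems in auto)
  have o3: "orthogonal (\<lambda>n. of_bool (\<exists>b\<in>set cs. in_box n b) * of_bool (f n \<noteq> 0))"
    unfolding in_box_def
  proof (rule Suc.hyps(1))
    show "k = length cs" using bs by (simp add: cs_def)
    fix A B assume "(A, B) \<in> set cs"
    then obtain A1 B1 where AB: "(A1, B1) \<in> set bs'" "A = A0 \<inter> A1" "B = B0 \<inter> B1" by (auto simp: cs_def)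
    then obtain F F' where "tame (of_real ` {0..1}) F A1" "tame (sphere 0 1) F' B1"
      using Suc.prems[of A1 B1] bs by auto
    then show "(\<exists>F. tame (of_real ` {0..1}) F A) \<and> (\<exists>F'. tame (sphere 0 1) F' B)"
      unfolding AB using tame_Int[OF t0(1)] tame_Int[OF t0(2)] by blast
  qed
  have cs_iff: "(\<exists>b\<in>set cs. in_box n b) \<longleftrightarrow> in_box n (A0, B0) \<and> (\<exists>b\<in>set bs'. in_box n b)" for n
  proof -
    have Int_iff: "in_box n (A0 \<inter> fst b, B0 \<inter> snd b) \<longleftrightarrow> in_box n (A0, B0) \<and> in_box n b" for b
      by (cases b) (auto simp: in_box_def)
    have "(\<exists>b\<in>set cs. in_box n b) \<longleftrightarrow> (\<exists>b\<in>set bs'. in_box n (A0 \<inter> fst b, B0 \<inter> snd b))"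
      by (simp add: cs_def case_prod_unfold)
    then show ?thesis unfolding Int_iff by blast
  qed
  have "orthogonal (\<lambda>n. of_bool (in_box n (A0, B0)) * of_bool (f n \<noteq> 0)
       + of_bool (\<exists>b\<in>set bs'. in_box n b) * of_bool (f n \<noteq> 0)
       - of_bool (\<exists>b\<in>set cs. in_box n b) * of_bool (f n \<noteq> 0))"
    by (intro orthogonal_diff orthogonal_add o1 o2 o3)
  moreover have "of_bool (in_box n (A0, B0)) * of_bool (f n \<noteq> 0)
       + of_bool (\<exists>b\<in>set bs'. in_box n b) * of_bool (f n \<noteq> 0)
       - of_bool (\<exists>b\<in>set cs. in_box n b) * of_bool (f n \<noteq> 0)
     = (of_bool (\<exists>b\<in>set bs. in_box n b) * of_bool (f n \<noteq> 0) :: complex)" for n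
  proof -
    have "(\<exists>b\<in>set bs. in_box n b) \<longleftrightarrow> in_box n (A0, B0) \<or> (\<exists>b\<in>set bs'. in_box n b)" by (simp add: bs(1))
    then show ?thesis unfolding cs_iff by (cases "in_box n (A0, B0)") simp_all
  qed
  ultimately show ?case unfolding in_box_def by (simp only:)
qed

text \<open>The radius \<open>r\<close> in a polar box may be negative; then the modulus is \<open>- r\<close> and the direction
  is reversed. Hence two boxes in terms of \<open>|z|\<close> and \<open>sgn z\<close> are needed.\<close>

lemma polar_box_tame_boxes:
  assumes "is_interval I1" "is_interval I2"
  obtains bs where "\<And>A B. (A, B) \<in> set bs \<Longrightarrow> (\<exists>F. tame (of_real ` {0..1}) F A) \<and> (\<exists>F'. tame (sphere 0 1) F' B)"
    "\<And>z. z \<noteq> 0 \<Longrightarrow> z \<in> polar_box I1 I2 \<longleftrightarrow> (\<exists>(A, B)\<in>set bs. of_real (norm z) \<in> A \<and> sgn z \<in> B)"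
proof -
  have "is_interval (uminus ` I1)" using assms(1) by simp
  then obtain F A F' A' where A: "tame (of_real ` {0..1}) F A" "\<And>r. r > 0 \<Longrightarrow> of_real r \<in> A \<longleftrightarrow> r \<in> I1"
    and A': "tame (of_real ` {0..1}) F' A'" "\<And>r. r > 0 \<Longrightarrow> of_real r \<in> A' \<longleftrightarrow> r \<in> uminus ` I1"
    using tame_radial[OF assms(1)] tame_radial[of "uminus ` I1"] by metis
  obtain F2 where B: "tame (sphere 0 1) F2 (circ ` I2)" by (rule tame_angular[OF assms(2)])
  define bs where "bs = [(A, circ ` I2), (A', uminus ` circ ` I2)]"
  have "(\<exists>F. tame (of_real ` {0..1}) F A1) \<and> (\<exists>F'. tame (sphere 0 1) F' B1)" if "(A1, B1) \<in> set bs" for A1 B1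
    using that A(1) A'(1) B tame_uminus[OF B] by (auto simp: bs_def)
  moreover have "z \<in> polar_box I1 I2 \<longleftrightarrow> (\<exists>(A, B)\<in>set bs. of_real (norm z) \<in> A \<and> sgn z \<in> B)" if z: "z \<noteq> 0" for z
  proof -
    have nz: "norm z > 0" using z by simp
    have zz: "z = of_real (norm z) * sgn z" using z by (simp add: sgn_div_norm scaleR_conv_of_real)
    have "z \<in> polar_box I1 I2 \<longleftrightarrow> (\<exists>r\<in>I1. \<exists>\<phi>\<in>I2. z = of_real r * circ \<phi>)"
      by (auto simp: polar_box_def rcis_def circ_def)
    also have "\<dots> \<longleftrightarrow> (norm z \<in> I1 \<and> sgn z \<in> circ ` I2) \<or> (norm z \<in> uminus ` I1 \<and> sgn z \<in> uminus ` circ ` I2)"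
    proof (intro iffI)
      assume "\<exists>r\<in>I1. \<exists>\<phi>\<in>I2. z = of_real r * circ \<phi>"
      then obtain r \<phi> where r: "r \<in> I1" "\<phi> \<in> I2" "z = of_real r * circ \<phi>" by blast
      have nr: "norm z = \<bar>r\<bar>" by (simp add: r norm_mult)
      have r0: "r \<noteq> 0" using z r by auto
      have sg: "sgn z = sgn (of_real r) * circ \<phi>" unfolding r(3) by (simp add: sgn_mult sgn_div_norm[of "circ \<phi>"])
      show "(norm z \<in> I1 \<and> sgn z \<in> circ ` I2) \<or> (norm z \<in> uminus ` I1 \<and> sgn z \<in> uminus ` circ ` I2)"
      proof (cases "r > 0")
        case True
        then have "norm z = r" "sgn z = circ \<phi>" using nr sg by (simp_all add: sgn_of_real)
        then show ?thesis using r by blast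
      next
        case False
        then have "norm z = - r" "sgn z = - circ \<phi>" using nr sg r0 by (simp_all add: sgn_of_real)
        then show ?thesis using r by blast
      qed
    next
      assume "(norm z \<in> I1 \<and> sgn z \<in> circ ` I2) \<or> (norm z \<in> uminus ` I1 \<and> sgn z \<in> uminus ` circ ` I2)"
      then show "\<exists>r\<in>I1. \<exists>\<phi>\<in>I2. z = of_real r * circ \<phi>"
      proof
        assume "norm z \<in> I1 \<and> sgn z \<in> circ ` I2"
        then obtain \<phi> where "norm z \<in> I1" "\<phi> \<in> I2" "sgn z = circ \<phi>" by blast
        then show ?thesis using zz by metis
      next
        assume "norm z \<in> uminus ` I1 \<and> sgn z \<in> uminus ` circ ` I2"
        then obtain r \<phi> where r: "norm z = - r" "r \<in> I1" "\<phi> \<in> I2" "sgn z = - circ \<phi>" by blast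
        have "z = of_real r * circ \<phi>" by (subst zz) (simp add: r(1,4))
        then show ?thesis using r by blast
      qed
    qed
    also have "\<dots> \<longleftrightarrow> (\<exists>(A, B)\<in>set bs. of_real (norm z) \<in> A \<and> sgn z \<in> B)"
      using A(2)[OF nz] A'(2)[OF nz] by (simp add: bs_def)
    finally show ?thesis .
  qed
  ultimately show ?thesis using that by blast
qed

text \<open>The zeros of \<open>f\<close> have no direction; they are treated separately, as \<open>n \<mapsto> 1[f(n) \<noteq> 0]\<close> is
  multiplicative.\<close>

lemma orthogonal_E_pol:
  assumes "E \<in> E_pol"
  shows "orthogonal (\<lambda>n. of_bool (n \<in> E))"
proof -
  obtain f K where E: "E = {n. n \<ge> 1 \<and> f n \<in> K}" and K: "elementary_polar K"
    and f: "multiplicative f" "\<And>n. n \<ge> 1 \<Longrightarrow> norm (f n) \<le> 1"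
    using assms by (auto simp: E_pol_def)
  obtain \<C> where \<C>: "finite \<C>" "K = \<Union>\<C>"
    "\<And>S. S \<in> \<C> \<Longrightarrow> \<exists>I1 I2. is_interval I1 \<and> is_interval I2 \<and> S = polar_box I1 I2"
    using K unfolding elementary_polar_def by blast
  have "\<exists>bs. (\<forall>A B. (A, B) \<in> set bs \<longrightarrow> (\<exists>F. tame (of_real ` {0..1}) F A) \<and> (\<exists>F'. tame (sphere 0 1) F' B)) \<and>
    (\<forall>z. z \<noteq> 0 \<longrightarrow> (z \<in> \<Union>\<C> \<longleftrightarrow> (\<exists>(A, B)\<in>set bs. of_real (norm z) \<in> A \<and> sgn z \<in> B)))"
    using \<C>(1,3)
  proof (induction \<C> rule: finite_induct)
    case empty
    show ?case by (intro exI[of _ "[]"]) simp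
  next
    case (insert S \<C>)
    obtain I1 I2 where I: "is_interval I1" "is_interval I2" "S = polar_box I1 I2" using insert.prems by blast
    obtain bs1 where b1: "\<And>A B. (A, B) \<in> set bs1 \<Longrightarrow> (\<exists>F. tame (of_real ` {0..1}) F A) \<and> (\<exists>F'. tame (sphere 0 1) F' B)"
      "\<And>z. z \<noteq> 0 \<Longrightarrow> z \<in> S \<longleftrightarrow> (\<exists>(A, B)\<in>set bs1. of_real (norm z) \<in> A \<and> sgn z \<in> B)"
      using polar_box_tame_boxes[OF I(1,2)] I(3) by blast
    obtain bs2 where b2: "\<And>A B. (A, B) \<in> set bs2 \<Longrightarrow> (\<exists>F. tame (of_real ` {0..1}) F A) \<and> (\<exists>F'. tame (sphere 0 1) F' B)"
      "\<And>z. z \<noteq> 0 \<Longrightarrow> z \<in> \<Union>\<C> \<longleftrightarrow> (\<exists>(A, B)\<in>set bs2. of_real (norm z) \<in> A \<and> sgn z \<in> B)"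
      using insert.IH insert.prems by blast
    show ?case
    proof (intro exI[of _ "bs1 @ bs2"] conjI allI impI)
      fix A B assume "(A, B) \<in> set (bs1 @ bs2)"
      then show "\<exists>F. tame (of_real ` {0..1}) F A" "\<exists>F'. tame (sphere 0 1) F' B"
        using b1(1) b2(1) by auto
    next
      fix z :: complex assume z: "z \<noteq> 0"
      show "z \<in> \<Union>(insert S \<C>) \<longleftrightarrow> (\<exists>(A, B)\<in>set (bs1 @ bs2). of_real (norm z) \<in> A \<and> sgn z \<in> B)"
        using b1(2)[OF z] b2(2)[OF z] by (simp only: Union_insert Un_iff set_append bex_Un)
    qed
  qed
  then obtain bs where bs: "\<And>A B. (A, B) \<in> set bs \<Longrightarrow> (\<exists>F. tame (of_real ` {0..1}) F A) \<and> (\<exists>F'. tame (sphere 0 1) F' B)"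
    "\<And>z. z \<noteq> 0 \<Longrightarrow> z \<in> K \<longleftrightarrow> (\<exists>(A, B)\<in>set bs. of_real (norm z) \<in> A \<and> sgn z \<in> B)"
    unfolding \<C>(2) by blast
  have o1: "orthogonal (\<lambda>n. of_bool (\<exists>(A, B)\<in>set bs. of_real (norm (f n)) \<in> A \<and> sgn (f n) \<in> B) * of_bool (f n \<noteq> 0))"
    by (rule orthogonal_polar_boxes[OF f bs(1)])
  have o2: "orthogonal (\<lambda>n. 1)"
    by (rule orthogonal_multiplicative) (auto simp: multiplicative_def)
  have o3: "orthogonal (\<lambda>n. of_bool (f n \<noteq> 0))"
  proof (rule orthogonal_multiplicative)
    show "multiplicative (\<lambda>n. of_bool (f n \<noteq> 0))"
      by (rule multiplicative_hom[where h = "\<lambda>z. of_bool (z \<noteq> 0)", OF f(1)]) auto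
  qed simp
  have "orthogonal (\<lambda>n. of_bool (0 \<in> K) * (1 - of_bool (f n \<noteq> 0)) +
     of_bool (\<exists>(A, B)\<in>set bs. of_real (norm (f n)) \<in> A \<and> sgn (f n) \<in> B) * of_bool (f n \<noteq> 0))"
    by (intro orthogonal_add orthogonal_cmult orthogonal_diff o1 o2 o3)
  moreover have "of_bool (0 \<in> K) * (1 - of_bool (f n \<noteq> 0)) +
     of_bool (\<exists>(A, B)\<in>set bs. of_real (norm (f n)) \<in> A \<and> sgn (f n) \<in> B) * of_bool (f n \<noteq> 0)
     = (of_bool (n \<in> E) :: complex)" if "n \<ge> 1" for n
    using that bs(2)[of "f n"] by (cases "f n = 0") (auto simp: E)
  ultimately show ?thesis using orthogonal_cong by (metis (no_types, lifting))
qed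

end

section \<open>Weyl's criterion\<close>

text \<open>Joint bookkeeping of a mean value along the sequence and the corresponding integral over
  the circle, so that both can be computed by the same linear combination.\<close>

definition mean_and_integral :: "(nat \<Rightarrow> real) \<Rightarrow> (complex \<Rightarrow> complex) \<Rightarrow> complex \<Rightarrow> bool" where
  "mean_and_integral x g L \<longleftrightarrow>
     (\<lambda>N. (\<Sum>j<N. g (circ (x j))) / of_nat N) \<longlonglongrightarrow> L \<and> ((\<lambda>t. g (circ t)) has_integral L) {0..1}"

lemma mean_and_integral_add:
  assumes "mean_and_integral x f K" "mean_and_integral x g L"
  shows "mean_and_integral x (\<lambda>z. f z + g z) (K + L)"
  using assms unfolding mean_and_integral_def
  by (auto simp: sum.distrib add_divide_distrib intro!: tendsto_add has_integral_add)

lemma mean_and_integral_cmult: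
  assumes "mean_and_integral x f K"
  shows "mean_and_integral x (\<lambda>z. c * f z) (c * K)"
  using assms unfolding mean_and_integral_def
  by (auto simp: sum_distrib_left[symmetric] times_divide_eq_right[symmetric]
      simp del: times_divide_eq_right intro!: tendsto_mult_left has_integral_mult_right)

lemma mean_and_integral_sum:
  assumes "finite I" "\<And>i. i \<in> I \<Longrightarrow> \<exists>L. mean_and_integral x (f i) L"
  shows "\<exists>L. mean_and_integral x (\<lambda>z. \<Sum>i\<in>I. f i z) L"
  using assms
proof (induction I rule: finite_induct)
  case empty
  have "mean_and_integral x (\<lambda>z. 0) 0" by (simp add: mean_and_integral_def)
  then show ?case by auto
next
  case (insert i I)
  then obtain K L where "mean_and_integral x (f i) K" "mean_and_integral x (\<lambda>z. \<Sum>i\<in>I. f i z) L"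
    by (meson insertCI)
  from mean_and_integral_add[OF this] show ?case using insert.hyps by auto
qed

lemma circ_int_has_integral:
  assumes "m \<noteq> (0::int)"
  shows "((\<lambda>t. circ (of_int m * t)) has_integral 0) {0..1}"
proof -
  define c where "c = 2 * of_real pi * \<i> * of_int m"
  have c: "c \<noteq> 0" using assms by (simp add: c_def)
  have ce: "circ (of_int m * t) = exp (c * of_real t)" for t
    by (simp add: circ_def cis_conv_exp c_def mult_ac)
  have "((\<lambda>t. exp (c * of_real t) / c) has_vector_derivative exp (c * of_real t)) (at t within {0..1})" for t :: real
  proof -
    have "((\<lambda>z. exp (c * z) / c) has_field_derivative exp (c * of_real t)) (at (of_real t))"
      using c by (auto intro!: derivative_eq_intros)
    from has_vector_derivative_real_field[OF this] show ?thesis .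
  qed
  then have "((\<lambda>t. exp (c * of_real t)) has_integral (exp (c * of_real 1) / c - exp (c * of_real 0) / c)) {0..1}"
    by (intro fundamental_theorem_of_calculus) auto
  moreover have "exp (c * of_real 1) = 1"
    using ce[of 1] circ_of_int[of m] by simp
  ultimately show ?thesis unfolding ce by simp
qed

lemma circ_nat_mult_power: "circ (real n * t) = circ t ^ n"
proof (induction n)
  case 0
  show ?case by (simp add: circ_def)
next
  case (Suc n)
  have "circ (real (Suc n) * t) = circ (t + real n * t)" by (simp add: distrib_right)
  then show ?case by (simp only: circ_add Suc.IH power_Suc)
qed

lemma mean_and_integral_monom:
  assumes weyl: "\<And>l. l \<ge> 1 \<Longrightarrow> null_mean0 (\<lambda>j. circ (real l * x j))"
  shows "\<exists>L. mean_and_integral x (\<lambda>z. z ^ i * cnj z ^ k) L"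
proof -
  have e: "circ t ^ i * cnj (circ t) ^ k = circ (of_int (int i - int k) * t)" for t
  proof -
    have "circ (of_int (int i - int k) * t) = circ (real i * t - real k * t)" by (simp add: left_diff_distrib)
    then show ?thesis by (simp only: circ_diff circ_nat_mult_power complex_cnj_power)
  qed
  show ?thesis
  proof (cases "i = k")
    case True
    have "(\<lambda>N. (\<Sum>j<N. (1::complex)) / of_nat N) \<longlonglongrightarrow> 1"
      by (rule tendsto_eventually) (auto intro!: eventually_sequentiallyI[of 1])
    moreover have "((\<lambda>t::real. 1::complex) has_integral 1) {0..1}"
      using has_integral_const_real[of "1::complex" 0 1] by simp
    moreover have "circ 0 = 1" by (simp add: circ_def)
    ultimately show ?thesis unfolding mean_and_integral_def e using True by (intro exI[of _ 1]) simp
  next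
    case False
    have "null_mean0 (\<lambda>j. circ (of_int (int i - int k) * x j))"
    proof (cases "i > k")
      case True
      then show ?thesis using weyl[of "i - k"] by (simp add: of_nat_diff)
    next
      case False
      then have "null_mean0 (\<lambda>j. cnj (circ (real (k - i) * x j)))"
        unfolding null_mean0_cnj using \<open>i \<noteq> k\<close> by (intro weyl) auto
      moreover have "cnj (circ (real (k - i) * t)) = circ (of_int (int i - int k) * t)" for t
      proof -
        have "of_int (int i - int k) * t = - (real (k - i) * t)"
          using False by (simp add: of_nat_diff algebra_simps)
        then show ?thesis by (simp only: circ_minus)
      qed
      ultimately show ?thesis by (simp only:)
    qed
    moreover have "((\<lambda>t. circ (of_int (int i - int k) * t)) has_integral 0) {0..1}"
      by (rule circ_int_has_integral) (use False in simp)
    ultimately show ?thesis unfolding mean_and_integral_def e null_mean0_def by blast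
  qed
qed

lemma weyl_continuous:
  fixes \<beta> :: "complex \<Rightarrow> real"
  assumes weyl: "\<And>l. l \<ge> 1 \<Longrightarrow> null_mean0 (\<lambda>j. circ (real l * x j))"
    and \<beta>: "continuous_on (sphere 0 1) \<beta>"
  shows "(\<lambda>N. (\<Sum>j<N. \<beta> (circ (x j))) / real N) \<longlonglongrightarrow> integral {0..1} (\<lambda>t. \<beta> (circ t))"
proof (rule LIMSEQ_I)
  fix e :: real assume e: "e > 0"
  define J where "J = integral {0..1} (\<lambda>t. \<beta> (circ t))"
  have "continuous_on {0..1} (\<lambda>t. \<beta> (circ t))"
    by (rule continuous_on_compose2[OF \<beta>]) (auto simp: circ_def intro!: continuous_intros)
  then have J: "((\<lambda>t. \<beta> (circ t)) has_integral J) {0..1}"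
    unfolding J_def by (intro integrable_integral integrable_continuous_real)
  obtain g where g: "conj_poly g" "\<And>z. z \<in> sphere 0 1 \<Longrightarrow> norm (of_real (\<beta> z) - g z) < e / 4"
    using conj_poly_approximation[OF compact_sphere \<beta>, of "e / 4"] e by auto
  obtain I c where I: "finite I" "\<And>z. g z = (\<Sum>(i, j)\<in>I. c (i, j) * (z ^ i * cnj z ^ j))"
    using g(1) unfolding conj_poly_def by blast
  have "\<exists>L. mean_and_integral x (\<lambda>z. \<Sum>y\<in>I. c y * (z ^ fst y * cnj z ^ snd y)) L"
  proof (rule mean_and_integral_sum[OF I(1)])
    fix y
    obtain L where "mean_and_integral x (\<lambda>z. z ^ fst y * cnj z ^ snd y) L"
      using mean_and_integral_monom[OF weyl] by blast
    then show "\<exists>L. mean_and_integral x (\<lambda>z. c y * (z ^ fst y * cnj z ^ snd y)) L"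
      using mean_and_integral_cmult by blast
  qed
  moreover have "g = (\<lambda>z. \<Sum>y\<in>I. c y * (z ^ fst y * cnj z ^ snd y))"
    by (simp add: fun_eq_iff I(2) case_prod_unfold)
  ultimately obtain L where L: "(\<lambda>N. (\<Sum>j<N. g (circ (x j))) / of_nat N) \<longlonglongrightarrow> L" "((\<lambda>t. g (circ t)) has_integral L) {0..1}"
    unfolding mean_and_integral_def by auto
  have JL: "norm (of_real J - L) \<le> e / 4"
  proof -
    have d: "((\<lambda>t. of_real (\<beta> (circ t)) - g (circ t)) has_integral (of_real J - L)) {0..1}"
      by (intro has_integral_diff has_integral_of_real J L(2))
    have c: "((\<lambda>t::real. e / 4) has_integral e / 4) {0..1}"
      using has_integral_const_real[of "e / 4" 0 1] by simp
    have b: "norm (of_real (\<beta> (circ t)) - g (circ t)) \<le> e / 4" for t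
      using g(2)[of "circ t"] by (simp add: less_imp_le)
    have "norm (integral {0..1} (\<lambda>t. of_real (\<beta> (circ t)) - g (circ t))) \<le> integral {0..1} (\<lambda>t::real. e / 4)"
      by (rule integral_norm_bound_integral[OF has_integral_integrable[OF d] has_integral_integrable[OF c] b])
    then show ?thesis unfolding integral_unique[OF d] integral_unique[OF c] .
  qed
  obtain N0 where N0: "\<And>N. N \<ge> N0 \<Longrightarrow> norm ((\<Sum>j<N. g (circ (x j))) / of_nat N - L) < e / 4"
    using LIMSEQ_D[OF L(1), of "e / 4"] e by auto
  have "norm ((\<Sum>j<N. \<beta> (circ (x j))) / real N - J) < e" if N: "N \<ge> N0" for N
  proof -
    define m where "m = (\<Sum>j<N. \<beta> (circ (x j))) / real N"
    define mg where "mg = (\<Sum>j<N. g (circ (x j))) / of_nat N"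
    have "norm (of_real m - mg) \<le> e / 4"
    proof -
      have "norm (\<Sum>j<N. of_real (\<beta> (circ (x j))) - g (circ (x j))) \<le> (\<Sum>j<N. e / 4)"
        using g(2) by (intro sum_norm_le) (auto intro: less_imp_le)
      then have le: "norm (\<Sum>j<N. of_real (\<beta> (circ (x j))) - g (circ (x j))) \<le> e / 4 * real N" by (simp add: mult.commute)
      have eq: "of_real m - mg = (\<Sum>j<N. of_real (\<beta> (circ (x j))) - g (circ (x j))) / of_nat N"
        by (simp add: m_def mg_def sum_subtractf diff_divide_distrib)
      show ?thesis
      proof (cases "N = 0")
        case False
        then show ?thesis unfolding eq norm_divide norm_of_nat
          using le by (simp only: pos_divide_le_eq of_nat_0_less_iff neq0_conv)
      qed (use e in \<open>simp add: m_def mg_def\<close>)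
    qed
    moreover have "norm (mg - L) < e / 4" using N0[OF N] by (simp add: mg_def)
    moreover have "norm (complex_of_real m - of_real J) \<le> norm (of_real m - mg) + norm (mg - L) + norm (of_real J - L)"
      by norm
    ultimately have "norm (complex_of_real m - of_real J) < e" using JL e by linarith
    then have "norm (complex_of_real (m - J)) < e" by simp
    then show ?thesis unfolding norm_of_real by (simp add: m_def)
  qed
  then show "\<exists>no. \<forall>n\<ge>no. norm ((\<Sum>j<n. \<beta> (circ (x j))) / real n - integral {0..1} (\<lambda>t. \<beta> (circ t))) < e"
    unfolding J_def by blast
qed

lemma finite_circ_vimage:
  assumes "finite F"
  shows "finite {t\<in>{0..1}. circ t \<in> F}"
proof -
  have "finite {t\<in>{0..1}. circ t = z}" for z
  proof (cases "\<exists>s\<in>{0..1}. circ s = z")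
    case True
    then obtain s where s: "s \<in> {0..1}" "circ s = z" by blast
    have "{t\<in>{0..1}. circ t = z} \<subseteq> {s - 1, s, s + 1}"
    proof
      fix t assume t: "t \<in> {t\<in>{0..1}. circ t = z}"
      then have "t - s \<in> \<int>" using s circ_eq_iff by auto
      then obtain k where k: "t - s = of_int k" by (rule Ints_cases)
      have "\<bar>real_of_int k\<bar> \<le> 1" using k t s by auto
      then have "k = - 1 \<or> k = 0 \<or> k = 1" by linarith
      then show "t \<in> {s - 1, s, s + 1}" using k by auto
    qed
    then show ?thesis by (rule finite_subset) simp
  next
    case False
    then have "{t\<in>{0..1}. circ t = z} = {}" by blast
    then show ?thesis by (simp only: finite.emptyI)
  qed
  then have "finite (\<Union>z\<in>F. {t\<in>{0..1}. circ t = z})" using assms by (intro finite_UN_I)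
  then show ?thesis by (rule rev_finite_subset) auto
qed

text \<open>Cut-off functions approximate the indicator function from below, and their integrals
  converge to that of the indicator function, since only finitely many parameters are mapped
  into \<open>F\<close>. Applied to an arc and to its complement, lower bounds are enough.\<close>

lemma weyl_lower_bound:
  assumes weyl: "\<And>l. l \<ge> 1 \<Longrightarrow> null_mean0 (\<lambda>j. circ (real l * x j))"
    and B: "tame (sphere 0 1) F B" and L: "((\<lambda>t. of_bool (circ t \<in> B)) has_integral L) {0..1}" and \<eta>: "\<eta> > 0"
  shows "\<forall>\<^sub>F N in sequentially. (\<Sum>j<N. of_bool (circ (x j) \<in> B)) / real N > L - \<eta>"
proof -
  have F: "finite F" "F \<noteq> {}" using B by (auto simp: tame_def)
  define e where "e n = 1 / real (Suc n)" for n
  have e: "e n > 0" for n by (simp add: e_def)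
  define g where "g n t = cutoff F (e n) B (circ t)" for n t
  have cont: "continuous_on {0..1} (g n)" for n
    unfolding g_def by (rule continuous_on_compose2[OF continuous_on_cutoff[OF B e]])
      (auto simp: circ_def intro!: continuous_intros)
  have int: "g n integrable_on {0..1}" for n by (rule integrable_continuous_real[OF cont])
  define G where "G t = (of_bool (circ t \<in> B \<and> circ t \<notin> F) :: real)" for t
  have lim: "(\<lambda>n. g n t) \<longlonglongrightarrow> G t" for t
  proof (cases "circ t \<in> B \<and> circ t \<notin> F")
    case True
    have pos: "infdist (circ t) F > 0"
      using True F infdist_pos_not_in_closed[of F "circ t"] finite_imp_closed by auto
    obtain n0 where n0: "1 / infdist (circ t) F < real n0" using reals_Archimedean2 by blast
    have "g n t = 1" if "n \<ge> n0" for n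
    proof -
      have "1 / infdist (circ t) F < real (Suc n)" using n0 that by linarith
      then have "1 \<le> infdist (circ t) F * real (Suc n)" using pos by (simp add: pos_divide_less_eq mult.commute)
      then show ?thesis using True by (simp add: g_def cutoff_def e_def)
    qed
    then have "\<forall>\<^sub>F n in sequentially. g n t = G t" using True by (auto simp: eventually_sequentially G_def)
    then show ?thesis by (rule tendsto_eventually)
  next
    case False
    then have "g n t = G t" for n by (auto simp: g_def cutoff_def G_def)
    then show ?thesis by simp
  qed
  have bound: "norm (g n t) \<le> 1" for n t
    using cutoff_bounds(1)[OF e[of n], where F = F and A = B and x = "circ t"]
      cutoff_bounds(2)[where F = F and e = "e n" and A = B and x = "circ t"]
    by (cases "circ t \<in> B") (auto simp: g_def)
  have "(\<lambda>n. integral {0..1} (g n)) \<longlonglongrightarrow> integral {0..1} G"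
    by (rule dominated_convergence(2)[where h = "\<lambda>_. 1"]) (use int bound lim in auto)
  moreover have "integral {0..1} G = L"
  proof (rule integral_unique)
    show "(G has_integral L) {0..1}"
      by (rule has_integral_spike_finite[OF finite_circ_vimage[OF F(1)] _ L]) (auto simp: G_def)
  qed
  ultimately have "(\<lambda>n. integral {0..1} (g n)) \<longlonglongrightarrow> L" by simp
  then have "\<forall>\<^sub>F n in sequentially. integral {0..1} (g n) > L - \<eta>" by (rule order_tendstoD) (use \<eta> in simp)
  then obtain n where n: "integral {0..1} (g n) > L - \<eta>" by (auto simp: eventually_sequentially)
  have "(\<lambda>N. (\<Sum>j<N. cutoff F (e n) B (circ (x j))) / real N) \<longlonglongrightarrow> integral {0..1} (g n)"
    unfolding g_def by (rule weyl_continuous[OF weyl continuous_on_cutoff[OF B e]])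
  then have "\<forall>\<^sub>F N in sequentially. (\<Sum>j<N. cutoff F (e n) B (circ (x j))) / real N > L - \<eta>"
    by (rule order_tendstoD) (rule n)
  then show ?thesis
  proof (rule eventually_mono)
    fix N assume "(\<Sum>j<N. cutoff F (e n) B (circ (x j))) / real N > L - \<eta>"
    moreover have "(\<Sum>j<N. cutoff F (e n) B (circ (x j))) / real N \<le> (\<Sum>j<N. of_bool (circ (x j) \<in> B)) / real N"
      by (intro divide_right_mono sum_mono cutoff_bounds) auto
    ultimately show "(\<Sum>j<N. of_bool (circ (x j) \<in> B)) / real N > L - \<eta>" by linarith
  qed
qed

lemma circ_mem_arc_iff:
  assumes "0 \<le> a" "b \<le> 1"
  shows "circ y \<in> circ ` {a..<b} \<longleftrightarrow> frac y \<in> {a..<b}"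
proof
  assume "circ y \<in> circ ` {a..<b}"
  then obtain s where s: "s \<in> {a..<b}" "circ y = circ s" by auto
  then have "y - s \<in> \<int>" by (simp only: circ_eq_iff)
  then obtain k where "y - s = of_int k" by (rule Ints_cases)
  then have "y = s + of_int k" by simp
  then have "frac y = frac s" by (simp add: frac_def)
  also have "\<dots> = s" using s assms by (simp add: frac_eq)
  finally show "frac y \<in> {a..<b}" using s by simp
next
  assume f: "frac y \<in> {a..<b}"
  have "circ y = circ (frac y)" unfolding circ_eq_iff by (simp add: frac_def)
  then show "circ y \<in> circ ` {a..<b}" using f by blast
qed

theorem weyl_criterion:
  assumes weyl: "\<And>l. l \<ge> 1 \<Longrightarrow> null_mean0 (\<lambda>j. circ (real l * x j))"
  shows "uniformly_distributed_mod1 x"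
  unfolding uniformly_distributed_mod1_def
proof (intro allI impI)
  fix a b :: real assume ab: "0 \<le> a \<and> a < b \<and> b \<le> 1"
  define B where "B = circ ` {a..<b}"
  have "is_interval {a..<b}" by (rule is_interval_co)
  then obtain F where tame: "tame (sphere 0 1) F B" unfolding B_def by (rule tame_angular)
  then have tame': "tame (sphere 0 1) F (- B)" unfolding tame_def by simp
  have int1: "((\<lambda>t. of_bool (t \<in> {a..b})) has_integral (b - a)) {0..1::real}"
  proof -
    have "((\<lambda>t. 1::real) has_integral (b - a)) {a..b}"
      using has_integral_const_real[of "1::real" a b] ab by simp
    then have "((\<lambda>t. if t \<in> {a..b} then 1 else 0::real) has_integral (b - a)) {0..1}"
      by (subst has_integral_restrict) (use ab in auto)
    then show ?thesis by (simp add: of_bool_def)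
  qed
  have int: "((\<lambda>t. of_bool (circ t \<in> B)) has_integral (b - a)) {0..1::real}"
  proof (rule has_integral_spike_finite[OF _ _ int1])
    show "of_bool (circ t \<in> B) = (of_bool (t \<in> {a..b}) :: real)" if "t \<in> {0..1} - {b, 1}" for t
    proof -
      have "frac t = t" using that by (simp add: frac_eq)
      then show ?thesis using that ab unfolding B_def by (subst circ_mem_arc_iff) auto
    qed
  qed simp
  have "((\<lambda>t. 1 - of_bool (circ t \<in> B)) has_integral (1 - (b - a))) {0..1::real}"
    using has_integral_const_real[of "1::real" 0 1] by (intro has_integral_diff int) simp
  moreover have "(\<lambda>t. 1 - of_bool (circ t \<in> B)) = (\<lambda>t. of_bool (circ t \<in> - B) :: real)" by (simp add: fun_eq_iff)
  ultimately have int': "((\<lambda>t. of_bool (circ t \<in> - B)) has_integral (1 - (b - a))) {0..1::real}" by simp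
  have card_eq: "real (card {j. j < N \<and> frac (x j) \<in> {a..<b}}) = (\<Sum>j<N. of_bool (circ (x j) \<in> B))" for N
  proof -
    have "{j. j < N \<and> frac (x j) \<in> {a..<b}} = {j\<in>{..<N}. circ (x j) \<in> B}"
      unfolding B_def using circ_mem_arc_iff[of a b] ab by auto
    then show ?thesis by (simp add: Int_def)
  qed
  show "(\<lambda>N. real (card {j. j < N \<and> frac (x j) \<in> {a..<b}}) / real N) \<longlonglongrightarrow> b - a"
    unfolding card_eq
  proof (rule LIMSEQ_I)
    fix e :: real assume e: "e > 0"
    have lower: "\<forall>\<^sub>F N in sequentially. (\<Sum>j<N. of_bool (circ (x j) \<in> B)) / real N > b - a - e"
      by (rule weyl_lower_bound[OF weyl tame int e])
    have lower': "\<forall>\<^sub>F N in sequentially. (\<Sum>j<N. of_bool (circ (x j) \<in> - B)) / real N > 1 - (b - a) - e"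
      by (rule weyl_lower_bound[OF weyl tame' int' e])
    have "\<forall>\<^sub>F N in sequentially. norm ((\<Sum>j<N. of_bool (circ (x j) \<in> B)) / real N - (b - a)) < e"
      using lower lower' eventually_gt_at_top[of 0]
    proof eventually_elim
      case (elim N)
      have "(\<Sum>j<N. of_bool (circ (x j) \<in> - B)) = real N - (\<Sum>j<N. of_bool (circ (x j) \<in> B))"
      proof -
        have "(\<Sum>j<N. of_bool (circ (x j) \<in> - B)) = (\<Sum>j<N. 1 - (of_bool (circ (x j) \<in> B) :: real))"
          by (intro sum.cong) auto
        then show ?thesis by (simp add: sum_subtractf)
      qed
      then have "(\<Sum>j<N. of_bool (circ (x j) \<in> - B)) / real N = 1 - (\<Sum>j<N. of_bool (circ (x j) \<in> B)) / real N"
        using elim by (simp add: diff_divide_distrib)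
      then show ?case using elim by (simp add: abs_less_iff)
    qed
    then show "\<exists>no. \<forall>n\<ge>no. norm ((\<Sum>j<n. of_bool (circ (x j) \<in> B)) / real n - (b - a)) < e"
      by (simp add: eventually_sequentially)
  qed
qed

section \<open>From the level set to its enumeration\<close>

lemma common_denominator:
  assumes "\<And>i. coeff p i \<in> \<rat>"
  shows "\<exists>D::nat. D > 0 \<and> (\<forall>i. real D * coeff p i \<in> \<int>)"
  using assms
proof (induction p)
  case 0
  show ?case by (intro exI[of _ 1]) simp
next
  case (pCons c p)
  have "\<And>i. coeff p i \<in> \<rat>" using pCons.prems[of "Suc _"] by simp
  then obtain D :: nat where D: "D > 0" "\<And>i. real D * coeff p i \<in> \<int>" using pCons.IH by blast
  have "c \<in> \<rat>" using pCons.prems[of 0] by simp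
  then obtain m :: int and n :: nat where mn: "n > 0" "c = of_int m / of_nat n"
    by (auto elim: Rats_cases'[where ?'a = real] simp: Rats_eq_int_div_nat)
  show ?case
  proof (intro exI[of _ "D * n"] conjI allI)
    fix i
    show "real (D * n) * coeff (pCons c p) i \<in> \<int>"
    proof (cases i)
      case 0
      have "real (D * n) * c = real D * of_int m" using mn by simp
      then show ?thesis using 0 by (simp del: of_nat_mult)
    next
      case (Suc j)
      have "real n * (real D * coeff p j) \<in> \<int>" by (intro Ints_mult D(2)) simp
      then show ?thesis using Suc by (simp add: mult_ac)
    qed
  qed (use D mn in simp)
qed

text \<open>A common denominator \<open>D\<close> of the coefficients is a period, because \<open>D\<close> divides
  \<open>(n + D)\<^sup>i - n\<^sup>i\<close>.\<close>

lemma rational_polynomial_phase_periodic: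
  fixes r :: "rat poly"
  obtains Q :: nat where "Q > 0"
    "\<And>n. circ (poly (map_poly of_rat r) (real (n + Q))) = circ (poly (map_poly of_rat r) (real n))"
proof -
  define p :: "real poly" where "p = map_poly of_rat r"
  have "coeff p i \<in> \<rat>" for i by (simp add: p_def coeff_map_poly)
  from common_denominator[OF this] obtain D :: nat where D: "D > 0" "\<And>i. real D * coeff p i \<in> \<int>" by blast
  have "circ (poly p (real (n + D))) = circ (poly p (real n))" for n
    unfolding circ_eq_iff
  proof -
    have "poly p (real (n + D)) - poly p (real n)
       = (\<Sum>i\<le>degree p. coeff p i * (real (n + D) ^ i - real n ^ i))"
      by (simp add: poly_altdef sum_subtractf right_diff_distrib)
    also have "\<dots> \<in> \<int>"
    proof (rule Ints_sum)
      fix i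
      have "real (n + D) ^ i - real n ^ i = real D * (\<Sum>j<i. real n ^ (i - Suc j) * real (n + D) ^ j)"
        using power_diff_sumr2[of "real (n + D)" i "real n"] by simp
      then have "coeff p i * (real (n + D) ^ i - real n ^ i)
         = (real D * coeff p i) * (\<Sum>j<i. real n ^ (i - Suc j) * real (n + D) ^ j)" by simp
      also have "\<dots> \<in> \<int>" by (intro Ints_mult D(2) Ints_sum Ints_power Ints_of_nat)
      finally show "coeff p i * (real (n + D) ^ i - real n ^ i) \<in> \<int>" .
    qed
    finally show "poly p (real (n + D)) - poly p (real n) \<in> \<int>" .
  qed
  then show ?thesis using D(1) that unfolding p_def by blast
qed

text \<open>The rational part of \<open>h\<close> supplies the periodic factor and the rest the uncorrelated
  dilations.\<close>

lemma null_mean_on_level_set: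
  assumes E: "E \<in> D_infinity \<or> E \<in> E_cpt \<or> E \<in> E_pol"
    and "belongs_to_hardy_field h" "polynomial_growth h" "far_from_rat_polys h"
  shows "null_mean (\<lambda>n. of_bool (n \<in> E) * circ (h (real n)))"
proof -
  obtain H where H: "hardy_field H" "germ_of h \<in> H" using assms(2) by (auto simp: belongs_to_hardy_field_def)
  interpret hardy H by standard (rule H(1))
  have "hfun h" using H(2) by (simp add: hfun_def)
  then obtain r f where rf: "\<And>t. h t = poly (map_poly of_rat r) t + f t"
    "\<And>p q. 1 \<le> p \<Longrightarrow> 1 \<le> q \<Longrightarrow> p \<noteq> q \<Longrightarrow>
       null_mean (\<lambda>n. circ (f (real (p * n))) * cnj (circ (f (real (q * n)))))"
    using hardy_dilation_correlations[OF _ assms(3,4)] by blast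
  obtain Q where Q: "Q > 0"
    "\<And>n. circ (poly (map_poly of_rat r) (real (n + Q))) = circ (poly (map_poly of_rat r) (real n))"
    using rational_polynomial_phase_periodic[of r] by blast
  interpret decorrelated_phase "\<lambda>n. circ (f (real n))" "\<lambda>n. circ (poly (map_poly of_rat r) (real n))" Q
  proof
    fix p q :: nat assume "prime p" "prime q" "p \<noteq> q"
    then show "null_mean (\<lambda>n. circ (f (real (p * n))) * cnj (circ (f (real (q * n)))))"
      by (intro rf(2)) (auto simp: Suc_le_eq prime_gt_0_nat)
  qed (use Q in auto)
  have "orthogonal (\<lambda>n. of_bool (n \<in> E))"
    using E orthogonal_E_cpt orthogonal_E_pol orthogonal_D_class by (auto simp: D_infinity_def)
  then show ?thesis unfolding orthogonal_def by (simp add: rf(1) circ_add)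
qed

lemma polynomial_growth_cmult:
  assumes "polynomial_growth h" "c > 0"
  shows "polynomial_growth (\<lambda>t. c * h t)"
proof -
  obtain k where k: "k \<ge> 1" "filterlim (\<lambda>t. t ^ k / \<bar>h t\<bar>) at_top at_top"
    using assms(1) by (auto simp: polynomial_growth_def grows_slower_def)
  have "filterlim (\<lambda>t. (1 / c) * (t ^ k / \<bar>h t\<bar>)) at_top at_top"
    by (rule filterlim_tendsto_pos_mult_at_top[OF tendsto_const _ k(2)]) (use assms(2) in simp)
  moreover have "(\<lambda>t. (1 / c) * (t ^ k / \<bar>h t\<bar>)) = (\<lambda>t. t ^ k / \<bar>c * h t\<bar>)"
    using assms(2) by (simp add: fun_eq_iff abs_mult)
  ultimately show ?thesis using k(1) unfolding polynomial_growth_def grows_slower_def by auto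
qed

lemma far_from_rat_polys_nat_mult:
  assumes "far_from_rat_polys h" "l \<ge> 1"
  shows "far_from_rat_polys (\<lambda>t. real l * h t)"
  unfolding far_from_rat_polys_def
proof
  fix r :: "rat poly"
  define r' where "r' = smult (1 / of_nat l) r"
  have r': "poly (map_poly of_rat r') t = poly (map_poly of_rat r) t / real l" for t :: real
  proof -
    have "map_poly of_rat r' = smult (1 / real l) (map_poly of_rat r)"
      by (intro poly_eqI) (simp add: r'_def coeff_map_poly of_rat_mult of_rat_divide)
    then show ?thesis by simp
  qed
  have "filterlim (\<lambda>t. \<bar>h t - poly (map_poly of_rat r') t\<bar> / (ln t)\<^sup>2) at_top at_top"
    using assms(1) unfolding far_from_rat_polys_def grows_slower_def by blast
  then have "filterlim (\<lambda>t. real l * (\<bar>h t - poly (map_poly of_rat r') t\<bar> / (ln t)\<^sup>2)) at_top at_top"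
    by (rule filterlim_tendsto_pos_mult_at_top[OF tendsto_const, rotated]) (use assms(2) in simp)
  moreover have "real l * (\<bar>h t - poly (map_poly of_rat r') t\<bar> / (ln t)\<^sup>2)
     = \<bar>real l * h t - poly (map_poly of_rat r) t\<bar> / (ln t)\<^sup>2" for t
  proof -
    have "real l * h t - poly (map_poly of_rat r) t = real l * (h t - poly (map_poly of_rat r') t)"
      using assms(2) by (simp add: r' right_diff_distrib)
    then show ?thesis by (simp add: abs_mult)
  qed
  ultimately show "(\<lambda>t. (ln t)\<^sup>2) \<prec> (\<lambda>t. \<bar>real l * h t - poly (map_poly of_rat r) t\<bar>)"
    unfolding grows_slower_def by (simp only: abs_abs)
qed

lemma belongs_to_hardy_field_nat_mult:
  assumes "belongs_to_hardy_field h"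
  shows "belongs_to_hardy_field (\<lambda>t. real l * h t)"
proof -
  obtain H where H: "hardy_field H" "germ_of h \<in> H" using assms by (auto simp: belongs_to_hardy_field_def)
  interpret hardy H by standard (rule H(1))
  have "hfun (\<lambda>t. real l * h t)" by (rule hfun_mult[OF hfun_of_nat]) (simp add: hfun_def H(2))
  then show ?thesis using H(1) unfolding belongs_to_hardy_field_def hfun_def by blast
qed

lemma positive_density_infinite:
  assumes "has_natural_density E d" "d > 0"
  shows "infinite E"
proof
  assume fin: "finite E"
  have "(\<lambda>N. real (card E) / real N) \<longlonglongrightarrow> 0" by (rule lim_const_over_n)
  moreover have "\<forall>\<^sub>F N in sequentially. norm (real (card (E \<inter> {1..N})) / real N) \<le> real (card E) / real N"
    using fin by (intro always_eventually allI) (auto intro!: divide_right_mono card_mono)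
  ultimately have "(\<lambda>N. real (card (E \<inter> {1..N})) / real N) \<longlonglongrightarrow> 0" by (rule Lim_null_comparison[rotated])
  then show False using LIMSEQ_unique[OF _ assms(1)[unfolded has_natural_density_def]] assms(2) by force
qed

lemma image_enumerate_lessThan:
  fixes E :: "nat set"
  assumes "infinite E"
  shows "enumerate E ` {..<J} = {n\<in>E. n < enumerate E J}"
proof (intro equalityI subsetI)
  fix n assume "n \<in> enumerate E ` {..<J}"
  then show "n \<in> {n\<in>E. n < enumerate E J}"
    using assms by (auto simp: enumerate_in_set enumerate_mono)
next
  fix n :: nat assume n: "n \<in> {n\<in>E. n < enumerate E J}"
  then obtain j where j: "n = enumerate E j" using enumerate_Ex[OF assms, of n] by auto
  then have "j < J" using n assms by (metis enumerate_mono_iff mem_Collect_eq)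
  then show "n \<in> enumerate E ` {..<J}" using j by blast
qed

text \<open>Evaluate the mean at \<open>M J = enumerate E J - 1\<close>, the end of the stretch that contains
  exactly the first \<open>J\<close> elements of \<open>E\<close>. There the normalisation changes from \<open>M J\<close> to \<open>J\<close>,
  and \<open>J / M J\<close> tends to \<open>d > 0\<close>.\<close>

lemma null_mean_along_enumeration:
  assumes null: "null_mean (\<lambda>n. of_bool (n \<in> E) * g n)" and E: "has_natural_density E d" "d > 0" "0 \<notin> E"
  shows "null_mean0 (\<lambda>j. g (enumerate E j))"
proof -
  have inf: "infinite E" by (rule positive_density_infinite[OF E(1,2)])
  define M where "M J = enumerate E J - 1" for J
  have E_pos: "enumerate E J \<ge> 1" for J
    using enumerate_in_set[OF inf, of J] E(3) by (metis One_nat_def Suc_leI gr0I)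
  have set_eq: "E \<inter> {1..M J} = enumerate E ` {..<J}" for J
    unfolding image_enumerate_lessThan[OF inf] M_def using E(3) E_pos[of J]
    by (auto simp: Suc_le_eq intro: gr0I)
  have inj: "inj_on (enumerate E) {..<J}" for J
    using inf by (intro inj_onI) (metis enumerate_mono_iff linorder_neqE_nat less_irrefl)
  have card_eq: "card (E \<inter> {1..M J}) = J" for J
    unfolding set_eq using card_image[OF inj] by simp
  have M_ge: "J \<le> M J + 1" for J using le_enumerate[OF inf, of J] E_pos[of J] by (simp add: M_def)
  have M_top: "filterlim M sequentially sequentially"
    unfolding filterlim_at_top
  proof
    fix Z
    show "\<forall>\<^sub>F J in sequentially. Z \<le> M J"
      using eventually_ge_at_top[of "Z + 1"] by eventually_elim (use M_ge in \<open>metis add_le_cancel_right order_trans\<close>)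
  qed
  define w where "w n = of_bool (n \<in> E) * g n" for n
  have sum_eq: "(\<Sum>j<J. g (enumerate E j)) = (\<Sum>n=1..M J. w n)" for J
  proof -
    have "(\<Sum>n=1..M J. w n) = (\<Sum>n\<in>E \<inter> {1..M J}. g n)"
      unfolding w_def by (intro sum.mono_neutral_cong_right) auto
    then show ?thesis unfolding set_eq by (simp add: sum.reindex[OF inj])
  qed
  have dens: "(\<lambda>J. real J / real (M J)) \<longlonglongrightarrow> d"
    using filterlim_compose[OF E(1)[unfolded has_natural_density_def] M_top] unfolding card_eq .
  have "(\<lambda>J. avg w (M J)) \<longlonglongrightarrow> 0"
    using filterlim_compose[OF null[unfolded null_mean_def] M_top] by (simp add: w_def[abs_def])
  then have "(\<lambda>J. avg w (M J) / of_real (real J / real (M J))) \<longlonglongrightarrow> 0 / of_real d"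
    by (intro tendsto_divide tendsto_of_real dens) (use E(2) in auto)
  moreover have "\<forall>\<^sub>F J in sequentially. avg w (M J) / of_real (real J / real (M J)) = (\<Sum>j<J. g (enumerate E j)) / of_nat J"
    using eventually_ge_at_top[of 2]
  proof eventually_elim
    case (elim J)
    then have "M J > 0" "J > 0" using M_ge[of J] by linarith+
    then show ?case unfolding sum_eq avg_def by (simp add: field_simps)
  qed
  ultimately have "(\<lambda>J. (\<Sum>j<J. g (enumerate E j)) / of_nat J) \<longlonglongrightarrow> 0 / of_real d"
    by (rule Lim_transform_eventually)
  then show ?thesis unfolding null_mean0_def by simp
qed

theorem theorem4:
  fixes E :: "nat set" and h :: "real \<Rightarrow> real" and d :: real
  assumes "E \<in> D_infinity \<or> E \<in> E_cpt \<or> E \<in> E_pol"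
    and "belongs_to_hardy_field h"
    and "polynomial_growth h"
    and "\<And>r :: rat poly. (\<lambda>t. (ln t)\<^sup>2) \<prec> (\<lambda>t. \<bar>h t - poly (map_poly of_rat r) t\<bar>)"
    and "has_natural_density E d"
    and "d > 0"
  shows "uniformly_distributed_mod1 (\<lambda>j. h (real (enumerate E j)))"
proof (rule weyl_criterion)
  fix l :: nat assume l: "l \<ge> 1"
  have far: "far_from_rat_polys h" unfolding far_from_rat_polys_def using assms(4) by blast
  have "null_mean (\<lambda>n. of_bool (n \<in> E) * circ (real l * h (real n)))"
    by (rule null_mean_on_level_set[OF assms(1) belongs_to_hardy_field_nat_mult[OF assms(2)]
        polynomial_growth_cmult[OF assms(3)] far_from_rat_polys_nat_mult[OF far l]]) (use l in simp)
  moreover have "0 \<notin> E" using assms(1) by (auto simp: D_infinity_def D_class_def E_cpt_def E_pol_def)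
  ultimately show "null_mean0 (\<lambda>j. circ (real l * h (real (enumerate E j))))"
    by (intro null_mean_along_enumeration[where g = "\<lambda>n. circ (real l * h (real n))", OF _ assms(5,6)])
qed

end
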